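(* Let $K$ be a knot in $S^3$ and let $\rho\colon \pi_1(E_K)\to \mathrm{SL}_2(\mathbb{C})$ be an irreducible metabelian representation. Then there exist metabelian representations $\psi_1,\ldots,\psi_p\colon \pi_1(E_K)\to \mathrm{SL}_2(\mathbb{C})$ (for some positive integer $p$) such that $\psi_1=\rho$ and the limit of the leading coefficient of $\log\Delta_{K,\rho_{2N}}(t)$ is expressed as \[ \lim_{N\to\infty}\frac{\log \Delta_{K,\rho_{2N}}(t)}{2N}=\frac{1}{2p}\sum_{j=1}^{p}\log\Delta_{K,\psi_j}(t), \] where $\rho_{2N}=\sigma_{2N}\circ\rho$.
   Context: $E_K=S^3\setminus N(K)$ is the exterior of $K$, with $N(K)$ an open tubular neighbourhood, and $\alpha\colon\pi_1(E_K)\to\langle t\rangle\simeq H_1(E_K;\mathbb{Z})$ is the abelianization, $t$ being the class of a meridian. A representation $\rho\colon\pi_1(E_K)\to\mathrm{SL}_2(\mathbb{C})$ is metabelian if it sends the commutator subgroup $[\pi_1(E_K),\pi_1(E_K)]$ into an abelian subgroup of $\mathrm{SL}_2(\mathbb{C})$; it is irreducible if $\rho(\pi_1(E_K))$ leaves invariant no subspace of $\mathbb{C}^2$ other than $\{0\}$ and $\mathbb{C}^2$. $\sigma_n\colon\mathrm{SL}_2(\mathbb{C})\to\mathrm{SL}_n(\mathbb{C})$ is the $n$-dimensional irreducible representation, given by the action on the space $V_n$ of homogeneous polynomials $p(x,y)$ of degree $n-1$: $A\cdot p(x,y)=p(x',y')$ with $\binom{x'}{y'}=A^{-1}\binom{x}{y}$.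 Twisted Alexander polynomial (Wada). For $\varphi\colon\pi_1(E_K)\to\mathrm{GL}_n(\mathbb{C})$ let $\Phi_\varphi\colon\mathbb{Z}[\pi_1(E_K)]\to M_n(\mathbb{C}[t^{\pm1}])$ be the $\mathbb{Z}$-linear extension of $\gamma\mapsto\alpha(\gamma)\varphi(\gamma)$. For a deficiency-one presentation $\pi_1(E_K)=\langle g_1,\ldots,g_k\mid r_1,\ldots,r_{k-1}\rangle$ and an index $\ell$ with $\det\Phi_\varphi(g_\ell-1)\neq0$, \[ \Delta_{K,\varphi}(t)=\frac{\det\big(\Phi_\varphi(\partial r_i/\partial g_j)\big)_{1\le i\le k-1,\;1\le j\le k,\,j\ne\ell}}{\det\Phi_\varphi(g_\ell-1)}, \] which is in general a rational function of $t$, where $\partial r_i/\partial g_j$ are Fox derivatives. *)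

theory Defs
  imports
    "HOL-Analysis.Analysis"
    "HOL-Algebra.Elementary_Groups"
    "HOL-Algebra.Generated_Groups"
    "HOL-Library.Poly_Mapping"
    "HOL-Computational_Algebra.Normalized_Fraction"
    "HOL-Computational_Algebra.Polynomial_Factorial"
    "HOL-Computational_Algebra.Field_as_Ring"
    "Jordan_Normal_Form.VS_Connect"
begin

unbundle no vec_syntax
hide_const (open) Determinants.det

section \<open>Fundamental group\<close>

definition path_class :: "'a::topological_space set \<Rightarrow> (real \<Rightarrow> 'a) \<Rightarrow> (real \<Rightarrow> 'a) set" where
  "path_class X p = {q. homotopic_paths X p q}"

definition loops_at :: "'a::topological_space set \<Rightarrow> 'a \<Rightarrow> (real \<Rightarrow> 'a) set" where
  "loops_at X x = {p. path p \<and> path_image p \<subseteq> X \<and> pathstart p = x \<and> pathfinish p = x}"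

text \<open>The product of two classes is the class of the concatenation of any two representatives.\<close>

definition fundamental_group :: "'a::topological_space set \<Rightarrow> 'a \<Rightarrow> (real \<Rightarrow> 'a) set monoid" where
  "fundamental_group X x =
     \<lparr>carrier = path_class X ` loops_at X x,
      monoid.mult = (\<lambda>a b. \<Union>p\<in>a. \<Union>q\<in>b. path_class X (p +++ q)),
      one = path_class X (\<lambda>_. x)\<rparr>"

section \<open>Knots and their exteriors\<close>

text \<open>
  The three-sphere is the unit sphere of \<open>\<real>\<^sup>4\<close>. A knot is a tame (locally flat) embedded circle:
  it is the core of an embedded solid torus. The parametrised solid torus has radius 2,
  and the tubular neighbourhood proper is the open part of radius 1, so that the
  boundary torus of the exterior is bicollared (hence not wild).
\<close>

definition tubular_embedding :: "(real^4) set \<Rightarrow> (complex \<times> complex \<Rightarrow> real^4) \<Rightarrow> bool" where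
  "tubular_embedding K h \<longleftrightarrow>
     continuous_on (sphere 0 1 \<times> cball 0 2) h \<and>
     inj_on h (sphere 0 1 \<times> cball 0 2) \<and>
     h ` (sphere 0 1 \<times> cball 0 2) \<subseteq> sphere 0 1 \<and>
     K = h ` (sphere 0 1 \<times> {0})"

definition knot :: "(real^4) set \<Rightarrow> bool" where
  "knot K \<longleftrightarrow> (\<exists>h. tubular_embedding K h)"

definition exterior :: "(complex \<times> complex \<Rightarrow> real^4) \<Rightarrow> (real^4) set" where
  "exterior h = sphere 0 1 - h ` (sphere 0 1 \<times> ball 0 1)"

text \<open>
  Classes of meridians: the boundary of a fibre disc of the tube, joined to the base point
  by an arc in the exterior. The orientation is the one given by \<open>h\<close>; precomposing \<open>h\<close> with
  complex conjugation of the disc gives the other one.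
\<close>

definition meridian_classes ::
    "(complex \<times> complex \<Rightarrow> real^4) \<Rightarrow> real^4 \<Rightarrow> (real \<Rightarrow> real^4) set set" where
  "meridian_classes h x =
     {path_class (exterior h) (p +++ ((\<lambda>s. h (z, cis (2 * pi * s))) +++ reversepath p)) | z p.
        z \<in> sphere 0 1 \<and> path p \<and> path_image p \<subseteq> exterior h \<and>
        pathstart p = x \<and> pathfinish p = h (z, 1)}"

text \<open>
  The abelianization onto \<open>\<langle>t\<rangle>\<close>, with \<open>t\<close> the class of a meridian; \<open>\<alpha> \<gamma>\<close> is the exponent of \<open>t\<close>.
\<close>

definition knot_abelianization ::
    "(complex \<times> complex \<Rightarrow> real^4) \<Rightarrow> real^4 \<Rightarrow> ((real \<Rightarrow> real^4) set \<Rightarrow> int) \<Rightarrow> bool" where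
  "knot_abelianization h x \<alpha> \<longleftrightarrow>
     (let G = fundamental_group (exterior h) x in
        \<alpha> \<in> hom G integer_group \<and>
        \<alpha> ` carrier G = UNIV \<and>
        kernel G integer_group \<alpha> = derived G (carrier G) \<and>
        (\<forall>m\<in>meridian_classes h x. \<alpha> m = 1))"

section \<open>Presentations and Fox calculus\<close>

text \<open>
  A word is a list of letters; \<open>(i, True)\<close> stands for \<open>g\<^sub>i\<close> and \<open>(i, False)\<close> for its inverse.
  Generators are numbered from 0.
\<close>

type_synonym group_word = "(nat \<times> bool) list"

fun letter_eval :: "('g, 'b) monoid_scheme \<Rightarrow> (nat \<Rightarrow> 'g) \<Rightarrow> nat \<times> bool \<Rightarrow> 'g" where
  "letter_eval G g (i, b) = (if b then g i else inv\<^bsub>G\<^esub> (g i))"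

primrec word_eval :: "('g, 'b) monoid_scheme \<Rightarrow> (nat \<Rightarrow> 'g) \<Rightarrow> group_word \<Rightarrow> 'g" where
  "word_eval G g [] = \<one>\<^bsub>G\<^esub>"
| "word_eval G g (x # w) = letter_eval G g x \<otimes>\<^bsub>G\<^esub> word_eval G g w"

definition words_on :: "nat \<Rightarrow> group_word set" where
  "words_on k = {w. \<forall>(i, b)\<in>set w. i < k}"

text \<open>
  Equality in the group presented by \<open>k\<close> generators and the relators \<open>rs\<close>: the congruence on words
  generated by free cancellation and deletion of relators.
\<close>

inductive presented_eq :: "nat \<Rightarrow> group_word list \<Rightarrow> group_word \<Rightarrow> group_word \<Rightarrow> bool"
  for k :: nat and rs :: "group_word list" where
  refl: "w \<in> words_on k \<Longrightarrow> presented_eq k rs w w"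
| sym: "presented_eq k rs v w \<Longrightarrow> presented_eq k rs w v"
| trans: "presented_eq k rs u v \<Longrightarrow> presented_eq k rs v w \<Longrightarrow> presented_eq k rs u w"
| cancel: "u \<in> words_on k \<Longrightarrow> v \<in> words_on k \<Longrightarrow> i < k \<Longrightarrow>
    presented_eq k rs (u @ [(i, b), (i, \<not> b)] @ v) (u @ v)"
| relator: "u \<in> words_on k \<Longrightarrow> v \<in> words_on k \<Longrightarrow> r \<in> set rs \<Longrightarrow>
    presented_eq k rs (u @ r @ v) (u @ v)"

text \<open>
  \<open>G = \<langle>g\<^sub>0, \<dots>, g\<^bsub>k-1\<^esub> | rs\<rangle>\<close> with \<open>k\<close> one more than the number of relators: the evaluation map from
  words to \<open>G\<close> is onto and identifies exactly the words that are equal in the presented group.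
\<close>

definition deficiency_one_presentation ::
    "('g, 'b) monoid_scheme \<Rightarrow> nat \<Rightarrow> (nat \<Rightarrow> 'g) \<Rightarrow> group_word list \<Rightarrow> bool" where
  "deficiency_one_presentation G k g rs \<longleftrightarrow>
     k = length rs + 1 \<and> (\<forall>i<k. g i \<in> carrier G) \<and> set rs \<subseteq> words_on k \<and>
     word_eval G g ` words_on k = carrier G \<and>
     (\<forall>v\<in>words_on k. \<forall>w\<in>words_on k.
        word_eval G g v = word_eval G g w \<longleftrightarrow> presented_eq k rs v w)"

text \<open>
  The Fox derivative \<open>\<partial>w/\<partial>g\<^sub>j\<close>, by \<open>\<partial>(xw) = \<partial>x + x \<partial>w\<close> for a letter \<open>x\<close>, as an integral combination of
  (not necessarily reduced) words.
\<close>

fun fox_letter :: "nat \<Rightarrow> nat \<times> bool \<Rightarrow> group_word \<Rightarrow>\<^sub>0 int" where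
  "fox_letter j (i, b) =
     (if i = j then (if b then frag_of [] else - frag_of [(i, False)]) else 0)"

primrec fox :: "nat \<Rightarrow> group_word \<Rightarrow> group_word \<Rightarrow>\<^sub>0 int" where
  "fox j [] = 0"
| "fox j (x # w) = fox_letter j x + frag_extend (\<lambda>u. frag_of (x # u)) (fox j w)"

text \<open>The image of a combination of words in the group ring \<open>\<int>[G]\<close>.\<close>

definition to_group_ring ::
    "('g, 'b) monoid_scheme \<Rightarrow> (nat \<Rightarrow> 'g) \<Rightarrow> (group_word \<Rightarrow>\<^sub>0 int) \<Rightarrow> 'g \<Rightarrow>\<^sub>0 int" where
  "to_group_ring G g = frag_extend (\<lambda>w. frag_of (word_eval G g w))"

section \<open>Wada's twisted Alexander polynomial\<close>

text \<open>Rational functions in \<open>t\<close> are the fraction field of \<open>\<complex>[t]\<close>, which contains \<open>\<complex>[t\<^sup>\<plusminus>\<^sup>1]\<close>.\<close>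

definition rat_t :: "complex poly fract" where
  "rat_t = to_fract [:0, 1:]"

text \<open>The \<open>\<int>\<close>-linear extension \<open>\<Phi>\<^sub>\<phi>\<close> of \<open>\<gamma> \<mapsto> \<alpha>(\<gamma>) \<phi>(\<gamma>)\<close>, for \<open>\<phi>\<close> with values in \<open>n \<times> n\<close> matrices.\<close>

definition twisted_map ::
    "('g \<Rightarrow> int) \<Rightarrow> nat \<Rightarrow> ('g \<Rightarrow> complex mat) \<Rightarrow> ('g \<Rightarrow>\<^sub>0 int) \<Rightarrow> complex poly fract mat" where
  "twisted_map \<alpha> n \<phi> x = mat n n (\<lambda>(a, b).
     \<Sum>\<gamma>\<in>Poly_Mapping.keys x.
       of_int (Poly_Mapping.lookup x \<gamma>) * (rat_t powi \<alpha> \<gamma>) * to_fract [:\<phi> \<gamma> $$ (a, b):])"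

definition wada_denominator ::
    "('g, 'b) monoid_scheme \<Rightarrow> (nat \<Rightarrow> 'g) \<Rightarrow> ('g \<Rightarrow> int) \<Rightarrow> nat \<Rightarrow> ('g \<Rightarrow> complex mat) \<Rightarrow> nat
      \<Rightarrow> complex poly fract" where
  "wada_denominator G g \<alpha> n \<phi> l = det (twisted_map \<alpha> n \<phi> (frag_of (g l) - frag_of \<one>\<^bsub>G\<^esub>))"

text \<open>The block matrix of all \<open>\<Phi>\<^sub>\<phi>(\<partial>r\<^sub>i/\<partial>g\<^sub>j)\<close>, with the column of blocks \<open>j = l\<close> left out.\<close>

definition wada_numerator ::
    "('g, 'b) monoid_scheme \<Rightarrow> (nat \<Rightarrow> 'g) \<Rightarrow> group_word list \<Rightarrow> ('g \<Rightarrow> int) \<Rightarrow> nat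
      \<Rightarrow> ('g \<Rightarrow> complex mat) \<Rightarrow> nat \<Rightarrow> complex poly fract" where
  "wada_numerator G g rs \<alpha> n \<phi> l =
     det (mat (length rs * n) (length rs * n) (\<lambda>(a, b).
       let i = a div n; c = b div n; j = (if c < l then c else c + 1)
       in twisted_map \<alpha> n \<phi> (to_group_ring G g (fox j (rs ! i))) $$ (a mod n, b mod n)))"

text \<open>
  The index is any admissible one; for even \<open>n\<close> and \<open>\<phi>\<close> with values in \<open>SL\<^sub>n\<close> the quotient does not
  depend on it. Across presentations \<open>\<Delta>\<close> is only determined up to a factor \<open>t\<^bsup>nm\<^esup>\<close>, so one
  presentation has to be used for all representations that are compared.
\<close>

definition twisted_alexander ::
    "('g, 'b) monoid_scheme \<Rightarrow> nat \<Rightarrow> (nat \<Rightarrow> 'g) \<Rightarrow> group_word list \<Rightarrow> ('g \<Rightarrow> int) \<Rightarrow> nat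
      \<Rightarrow> ('g \<Rightarrow> complex mat) \<Rightarrow> complex poly fract" where
  "twisted_alexander G k g rs \<alpha> n \<phi> =
     (let l = (SOME l. l < k \<and> wada_denominator G g \<alpha> n \<phi> l \<noteq> 0)
      in wada_numerator G g rs \<alpha> n \<phi> l / wada_denominator G g \<alpha> n \<phi> l)"

section \<open>Representations\<close>

definition SL :: "nat \<Rightarrow> complex mat monoid" where
  "SL n = \<lparr>carrier = {A \<in> carrier_mat n n. det A = 1}, monoid.mult = (*), one = 1\<^sub>m n\<rparr>"

definition metabelian_rep :: "('g, 'b) monoid_scheme \<Rightarrow> ('g \<Rightarrow> complex mat) \<Rightarrow> bool" where
  "metabelian_rep G \<rho> \<longleftrightarrow> \<rho> \<in> hom G (SL 2) \<and>
     (\<exists>H. subgroup H (SL 2) \<and> comm_group ((SL 2)\<lparr>carrier := H\<rparr>) \<and>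
          \<rho> ` derived G (carrier G) \<subseteq> H)"

definition irreducible_rep :: "('g, 'b) monoid_scheme \<Rightarrow> ('g \<Rightarrow> complex mat) \<Rightarrow> bool" where
  "irreducible_rep G \<rho> \<longleftrightarrow> \<rho> \<in> hom G (SL 2) \<and>
     (\<forall>W. VectorSpace.subspace class_ring W (module_vec TYPE(complex) 2) \<and>
          (\<forall>\<gamma>\<in>carrier G. \<forall>w\<in>W. \<rho> \<gamma> *\<^sub>v w \<in> W) \<longrightarrow>
          W = {0\<^sub>v 2} \<or> W = carrier_vec 2)"

text \<open>Polynomials in \<open>x, y\<close> are polynomials in \<open>y\<close> over \<open>\<complex>[x]\<close>.\<close>

definition var_x :: "complex poly poly" where "var_x = [:[:0, 1:]:]"

definition var_y :: "complex poly poly" where "var_y = [:0, 1:]"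

definition const_xy :: "complex \<Rightarrow> complex poly poly" where "const_xy c = [:[:c:]:]"

definition coeff_xy :: "complex poly poly \<Rightarrow> nat \<Rightarrow> nat \<Rightarrow> complex" where
  "coeff_xy p a b = coeff (coeff p b) a"

definition subst_xy ::
    "complex poly poly \<Rightarrow> complex poly poly \<Rightarrow> complex poly poly \<Rightarrow> complex poly poly" where
  "subst_xy p u v =
     (\<Sum>b\<le>degree p. \<Sum>a\<le>degree (coeff p b). const_xy (coeff_xy p a b) * u ^ a * v ^ b)"

text \<open>\<open>A \<cdot> p(x, y) = p(x', y')\<close>, where \<open>(x', y')\<close> is \<open>A\<^sup>-\<^sup>1\<close> applied to the column \<open>(x, y)\<close>.\<close>

definition SL2_action :: "complex mat \<Rightarrow> complex poly poly \<Rightarrow> complex poly poly" where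
  "SL2_action A p = (let B = inv\<^bsub>SL 2\<^esub> A in
     subst_xy p (const_xy (B $$ (0, 0)) * var_x + const_xy (B $$ (0, 1)) * var_y)
                (const_xy (B $$ (1, 0)) * var_x + const_xy (B $$ (1, 1)) * var_y))"

text \<open>
  The representation \<open>\<sigma>\<^sub>n\<close>: the matrix of this action on homogeneous polynomials of degree \<open>n - 1\<close> in the basis
  \<open>x\<^bsup>n-1\<^esup>, x\<^bsup>n-2\<^esup>y, \<dots>, y\<^bsup>n-1\<^esup>\<close>; column \<open>j\<close> holds the coordinates of the image of \<open>x\<^bsup>n-1-j\<^esup>y\<^bsup>j\<^esup>\<close>.
\<close>

definition sym_power :: "nat \<Rightarrow> complex mat \<Rightarrow> complex mat" where
  "sym_power n A = mat n n (\<lambda>(i, j).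
     coeff_xy (SL2_action A (var_x ^ (n - 1 - j) * var_y ^ j)) (n - 1 - i) i)"

section \<open>Values and logarithms of rational functions\<close>

text \<open>\<open>quot_of_fract\<close> yields the numerator and denominator in lowest terms.\<close>

definition rat_eval :: "complex poly fract \<Rightarrow> complex \<Rightarrow> complex" where
  "rat_eval f z = poly (fst (quot_of_fract f)) z / poly (snd (quot_of_fract f)) z"

definition no_zero_or_pole :: "complex poly fract \<Rightarrow> complex \<Rightarrow> bool" where
  "no_zero_or_pole f z \<longleftrightarrow>
     poly (fst (quot_of_fract f)) z \<noteq> 0 \<and> poly (snd (quot_of_fract f)) z \<noteq> 0"

definition log_branch_on :: "complex set \<Rightarrow> complex poly fract \<Rightarrow> (complex \<Rightarrow> complex) \<Rightarrow> bool" where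
  "log_branch_on D f L \<longleftrightarrow> L holomorphic_on D \<and>
     (\<forall>z\<in>D. no_zero_or_pole f z \<and> exp (L z) = rat_eval f z)"

text \<open>
  The asymptotic statement \<open>lim (log F\<^sub>N) / (2N) = c (log f\<^sub>1 + \<dots> + log f\<^sub>p)\<close> for rational functions of \<open>t\<close>.
  Complex logarithms are only determined up to \<open>2\<pi>\<i>\<int>\<close>, and for fixed (say principal) branches the
  imaginary parts need not converge to the asserted value. The equation is therefore read as follows.
  At each \<open>t \<noteq> 0\<close> at which the left-hand side is defined, so is the right-hand side, and the real
  parts satisfy the equation; and, on every open set on which the logarithms on the right
  have holomorphic branches, for all such branches there are holomorphic branches of the
  logarithms on the left for which the equation holds at every point.
\<close>

definition log_limit_eq ::
    "(nat \<Rightarrow> complex poly fract) \<Rightarrow> real \<Rightarrow> nat \<Rightarrow> (nat \<Rightarrow> complex poly fract) \<Rightarrow> bool" where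
  "log_limit_eq F c p f \<longleftrightarrow>
     (\<forall>z. z \<noteq> 0 \<and> (\<forall>N\<ge>1. no_zero_or_pole (F N) z) \<longrightarrow>
        (\<forall>j\<in>{1..p}. no_zero_or_pole (f j) z) \<and>
        (\<lambda>N. ln (cmod (rat_eval (F N) z)) / (2 * real N))
          \<longlonglongrightarrow> c * (\<Sum>j=1..p. ln (cmod (rat_eval (f j) z)))) \<and>
     (\<forall>D l. open D \<and> 0 \<notin> D \<and> (\<forall>j\<in>{1..p}. log_branch_on D (f j) (l j)) \<longrightarrow>
        (\<exists>L. (\<forall>N\<ge>1. log_branch_on D (F N) (L N)) \<and>
             (\<forall>z\<in>D. (\<lambda>N. L N z / (2 * of_nat N))
                \<longlonglongrightarrow> complex_of_real c * (\<Sum>j=1..p. l j z))))"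

end

theory Submission
  imports Defs "HOL-Library.Z2"
begin

text \<open>
  Since the representation is irreducible and metabelian, it can be conjugated into the monomial
  matrices: the commutator subgroup acts diagonally by a character \<open>\<chi>\<close>, and a meridian swaps the two
  eigenlines, so that conjugation by it inverts \<open>\<chi>\<close>. The values of \<open>\<chi>\<close> form a finitely generated group.
  Modulo squares inversion is trivial, so that \<open>\<chi>\<close> extends to a homomorphism from the whole group to an
  abelian group, which vanishes on commutators. Hence every value of \<open>\<chi>\<close> is a square of such a
  value, and the group of values is finite.

  For a monomial representation the monomials \<open>x\<^bsup>i\<^esup>y\<^bsup>j\<^esup>\<close> and \<open>x\<^bsup>j\<^esup>y\<^bsup>i\<^esup>\<close> span an invariant plane, and the
  \<open>2N\<close>-th symmetric power splits into the representations \<open>\<theta>\<^sub>0, \<dots>, \<theta>\<^bsub>N-1\<^esub>\<close>, where \<open>\<theta>\<^sub>m\<close> raises all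
  entries to the power \<open>2m + 1\<close>. As the entries are roots of unity, \<open>\<theta>\<^sub>m\<close> is periodic in \<open>m\<close>, and since
  the twisted Alexander polynomial is multiplicative, its logarithm for \<open>\<rho>\<^sub>2\<^sub>N\<close> is a partial sum of
  a periodic sequence, with a mean over one period as the limit.
\<close>

section \<open>Block matrices\<close>

text \<open>The product of two antidiagonal matrices of determinant 1 introduces a sign, so the
  finiteness argument runs on squares: the square of the nonzero entry in the first column is
  multiplicative on the whole group up to inversion of one factor. This is also where the period
  comes from. If the p-th powers of these squares are 1, then a^(2p) = 1 for every entry a, and the
  exponent 2m + 1 grows by 2p when m grows by p. That every generating value is a square of a
  product of generating values is a multiplicative linear system with matrix 1 - 2n; an odd
  determinant cannot vanish, and so it bounds the order of all values at once.

  The decomposition of the twisted Alexander polynomials has to hold exactly, not up to units, since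
  logarithms are taken and divided by 2N. Two choices ensure this: all blocks have even size, so
  that deleting block rows and columns costs no sign, and one generator with nonzero exponent in the
  abelianization supplies an index that is admissible for all representations into SL2
  simultaneously.\<close>

definition skip :: "nat \<Rightarrow> nat \<Rightarrow> nat" where
  "skip l c = (if c < l then c else c + 1)"

text \<open>The div/mod layout of \<open>wada_numerator\<close>. With \<open>skip l\<close>
  enumerating the column blocks other than \<open>l\<close>, the numerator becomes the determinant
  of such a matrix by mere unfolding.\<close>

definition block_mat :: "nat \<Rightarrow> nat \<Rightarrow> nat \<Rightarrow> (nat \<Rightarrow> nat \<Rightarrow> 'a mat) \<Rightarrow> 'a mat" where
  "block_mat r s n M = mat (r * n) (s * n) (\<lambda>(a, b). M (a div n) (b div n) $$ (a mod n, b mod n))"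

lemma block_mat_carrier [simp]: "block_mat r s n M \<in> carrier_mat (r * n) (s * n)"
  and dim_row_block_mat [simp]: "dim_row (block_mat r s n M) = r * n"
  and dim_col_block_mat [simp]: "dim_col (block_mat r s n M) = s * n"
  by (auto simp: block_mat_def)

lemma div_mod_block:
  fixes a k n :: nat
  assumes "a < k * n"
  shows "a div n < k" "a mod n < n"
  using assms by (auto simp: less_mult_imp_div_less intro!: mod_less_divisor gr0I)

lemma mult_add_div_mod:
  fixes b n :: nat
  assumes "b < n"
  shows "(a * n + b) div n = a" "(a * n + b) mod n = b"
  using assms by auto

lemma index_block_mat:
  "a < r * n \<Longrightarrow> b < s * n \<Longrightarrow>
    block_mat r s n M $$ (a, b) = M (a div n) (b div n) $$ (a mod n, b mod n)"
  by (simp add: block_mat_def)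

lemma block_mat_cong:
  assumes "\<And>i j a b. i < r \<Longrightarrow> j < s \<Longrightarrow> a < n \<Longrightarrow> b < n \<Longrightarrow> M i j $$ (a, b) = M' i j $$ (a, b)"
  shows "block_mat r s n M = block_mat r s n M'"
  by (rule eq_matI) (auto simp: index_block_mat div_mod_block intro!: assms)

lemma sum_blocks: "(\<Sum>c<s * n. f c) = (\<Sum>e<s. \<Sum>b<n. f (e * n + b :: nat))"
proof -
  have "(\<Sum>c<s * n. f c) = (\<Sum>e<s. sum f {e * n..<e * n + n})"
    by (rule sum.nat_group [symmetric])
  also have "\<dots> = (\<Sum>e<s. \<Sum>b<n. f (e * n + b))"
  proof (rule sum.cong [OF HOL.refl])
    fix e
    show "sum f {e * n..<e * n + n} = (\<Sum>b<n. f (e * n + b))"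
      using sum.shift_bounds_nat_ivl [of f 0 "e * n" n]
      by (simp add: add.commute atLeast0LessThan)
  qed
  finally show ?thesis .
qed

lemma block_mat_mult:
  fixes M :: "nat \<Rightarrow> nat \<Rightarrow> 'a :: semiring_0 mat"
  assumes M: "\<And>i e. i < r \<Longrightarrow> e < s \<Longrightarrow> M i e \<in> carrier_mat n n"
    and M': "\<And>e c. e < s \<Longrightarrow> c < t \<Longrightarrow> M' e c \<in> carrier_mat n n"
  shows "block_mat r s n M * block_mat s t n M' =
    block_mat r t n (\<lambda>i c. mat n n (\<lambda>x. \<Sum>e<s. (M i e * M' e c) $$ x))"
proof (rule eq_matI, goal_cases)
  case (1 a b)
  then have a: "a < r * n" and b: "b < t * n" by auto
  note d = div_mod_block [OF a] div_mod_block [OF b]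
  have "(block_mat r s n M * block_mat s t n M') $$ (a, b)
      = (\<Sum>c<s * n. block_mat r s n M $$ (a, c) * block_mat s t n M' $$ (c, b))"
    using a b by (simp add: scalar_prod_def atLeast0LessThan)
  also have "\<dots> = (\<Sum>e<s. \<Sum>f<n. M (a div n) e $$ (a mod n, f) * M' e (b div n) $$ (f, b mod n))"
    unfolding sum_blocks
  proof (intro sum.cong HOL.refl)
    fix e f assume "e \<in> {..<s}" "f \<in> {..<n}"
    then have "e < s" "f < n" by auto
    have "e * n + f < Suc e * n" using \<open>f < n\<close> by simp
    also have "\<dots> \<le> s * n" using \<open>e < s\<close> by (intro mult_le_mono1) simp
    finally show "block_mat r s n M $$ (a, e * n + f) * block_mat s t n M' $$ (e * n + f, b)
        = M (a div n) e $$ (a mod n, f) * M' e (b div n) $$ (f, b mod n)"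
      using a b \<open>f < n\<close> by (simp add: index_block_mat)
  qed
  also have "\<dots> = (\<Sum>e<s. (M (a div n) e * M' e (b div n)) $$ (a mod n, b mod n))"
  proof (intro sum.cong HOL.refl)
    fix e assume "e \<in> {..<s}"
    then have "M (a div n) e \<in> carrier_mat n n" "M' e (b div n) \<in> carrier_mat n n"
      using M M' d by auto
    then show "(\<Sum>f<n. M (a div n) e $$ (a mod n, f) * M' e (b div n) $$ (f, b mod n))
        = (M (a div n) e * M' e (b div n)) $$ (a mod n, b mod n)"
      using d by (simp add: scalar_prod_def atLeast0LessThan)
  qed
  finally show ?case using a b d by (simp add: index_block_mat)
qed auto

lemma block_mat_one:
  "block_mat k k n (\<lambda>i c. if i = c then 1\<^sub>m n else 0\<^sub>m n n) = 1\<^sub>m (k * n)"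
proof (rule eq_matI, goal_cases)
  case (1 a b)
  then have *: "a < k * n" "b < k * n" by auto
  moreover have "a = b \<longleftrightarrow> a div n = b div n \<and> a mod n = b mod n"
    by (metis div_mult_mod_eq)
  ultimately show ?case
    using div_mod_block [OF *(1)] div_mod_block [OF *(2)] by (auto simp: index_block_mat)
qed auto

lemma transpose_block_mat:
  assumes "\<And>i c. i < r \<Longrightarrow> c < s \<Longrightarrow> M i c \<in> carrier_mat n n"
  shows "(block_mat r s n M)\<^sup>T = block_mat s r n (\<lambda>c i. (M i c)\<^sup>T)"
proof (rule eq_matI, goal_cases)
  case (1 a b)
  then have *: "a < s * n" "b < r * n" by auto
  then show ?case
    using div_mod_block [OF *(1)] div_mod_block [OF *(2)] assms [of "b div n" "a div n"]
    by (simp add: index_block_mat)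
qed auto

section \<open>Determinants of matrices with unit block rows\<close>

text \<open>Expansion along row \<open>r\<close> removes one unit row at a time. After each removal
  the next unit row has moved up to position \<open>r\<close> and its entry 1 left to column
  \<open>c\<close>, so every step contributes the same sign.\<close>

lemma det_delete_unit_rows:
  fixes A :: "'a :: comm_ring_1 mat"
  assumes "A \<in> carrier_mat (m + s) (m + s)" "r \<le> m" "c \<le> m"
    and "\<And>i j. i < s \<Longrightarrow> j < m + s \<Longrightarrow> A $$ (r + i, j) = (if j = c + i then 1 else 0)"
  shows "det A = (- 1) ^ (s * (r + c)) *
    det (mat m m (\<lambda>(i, j). A $$ (if i < r then i else i + s, if j < c then j else j + s)))"
  using assms
proof (induction s arbitrary: A)
  case 0
  then have "mat m m (\<lambda>(i, j). A $$ (if i < r then i else i + 0, if j < c then j else j + 0)) = A"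
    by (intro eq_matI) auto
  then show ?case by simp
next
  case (Suc s)
  let ?B = "mat_delete A r c"
  have A: "A \<in> carrier_mat (Suc (m + s)) (Suc (m + s))" using Suc.prems by simp
  have B: "?B \<in> carrier_mat (m + s) (m + s)"
    using mat_delete_carrier [OF A] by simp
  have Bi: "?B $$ (i, j) = A $$ (insert_index r i, insert_index c j)" if "i < m + s" "j < m + s" for i j
    using mat_delete_index [OF A _ _ that] Suc.prems(2,3) by simp
  have "det A = (\<Sum>j<Suc (m + s). A $$ (r, j) * cofactor A r j)"
    using A Suc.prems(2) by (intro laplace_expansion_row) auto
  also have "\<dots> = (\<Sum>j<Suc (m + s). if j = c then cofactor A r j else 0)"
    using Suc.prems(4) [of 0] by (intro sum.cong) auto
  also have "\<dots> = (- 1) ^ (r + c) * det ?B"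
    using Suc.prems(3) by (simp add: cofactor_def)
  also have "det ?B = (- 1) ^ (s * (r + c)) *
    det (mat m m (\<lambda>(i, j). ?B $$ (if i < r then i else i + s, if j < c then j else j + s)))"
  proof (rule Suc.IH [OF B Suc.prems(2,3)])
    fix i j assume ij: "i < s" "j < m + s"
    then have "?B $$ (r + i, j) = A $$ (r + Suc i, insert_index c j)"
      using Suc.prems(2) by (simp add: Bi)
    also have "\<dots> = (if insert_index c j = c + Suc i then 1 else 0)"
      using ij by (intro Suc.prems(4)) (auto simp: insert_index_def)
    finally show "?B $$ (r + i, j) = (if j = c + i then 1 else 0)"
      by (auto simp: insert_index_def split: if_splits)
  qed
  also have "mat m m (\<lambda>(i, j). ?B $$ (if i < r then i else i + s, if j < c then j else j + s))
    = mat m m (\<lambda>(i, j). A $$ (if i < r then i else i + Suc s, if j < c then j else j + Suc s))"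
    by (intro eq_matI) (auto simp: Bi insert_index_def)
  finally show ?case by (simp add: power_add algebra_simps)
qed

text \<open>The n deletions contribute the sign (-1)^(n n (r + c)). The parity hypothesis serves two
  situations: even block size at an arbitrary position, and arbitrary block size with
  \<open>r = c\<close>.\<close>

lemma det_block_unit_row:
  fixes M :: "nat \<Rightarrow> nat \<Rightarrow> 'a :: comm_ring_1 mat"
  assumes "r \<le> k" "c \<le> k" "even (n * (r + c))"
    and unit: "\<And>j. j \<le> k \<Longrightarrow> M r j = (if j = c then 1\<^sub>m n else 0\<^sub>m n n)"
  shows "det (block_mat (Suc k) (Suc k) n M) = det (block_mat k k n (\<lambda>i j. M (skip r i) (skip c j)))"
proof -
  have skip: "(if a < l * n then a else a + n) div n = skip l (a div n)"
    "(if a < l * n then a else a + n) mod n = a mod n"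
    if "a < k * n" for a l
    using that div_mod_block[OF that]
    by (auto simp: skip_def less_mult_imp_div_less div_less_iff_less_mult)
  have lt: "(if a < l * n then a else a + n) < Suc k * n" if "a < k * n" for a l
    using that by auto
  have "det (block_mat (Suc k) (Suc k) n M) = (- 1) ^ (n * (r * n + c * n)) *
    det (mat (k * n) (k * n) (\<lambda>(i, j). block_mat (Suc k) (Suc k) n M
      $$ (if i < r * n then i else i + n, if j < c * n then j else j + n)))"
  proof (rule det_delete_unit_rows)
    fix i j assume i: "i < n" and j: "j < k * n + n"
    have j': "j < Suc k * n" using j by simp
    have "r * n + i < Suc r * n" using i by simp
    also have "\<dots> \<le> Suc k * n" using assms(1) by (intro mult_le_mono1) simp
    finally have ri: "r * n + i < Suc k * n" .
    have "j = c * n + i \<longleftrightarrow> j div n = c \<and> j mod n = i"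
    proof
      assume "j div n = c \<and> j mod n = i"
      then show "j = c * n + i" by (metis div_mult_mod_eq)
    qed (use i in simp)
    then show "block_mat (Suc k) (Suc k) n M $$ (r * n + i, j) = (if j = c * n + i then 1 else 0)"
      using unit [of "j div n"] i div_mod_block [OF j'] j'
      by (auto simp: index_block_mat [OF ri j'])
  qed (use assms in \<open>auto simp: block_mat_def\<close>)
  also have "(- 1 :: 'a) ^ (n * (r * n + c * n)) = 1"
    using assms(3) by (intro neg_one_even_power) (auto simp flip: add_mult_distrib)
  also have "mat (k * n) (k * n) (\<lambda>(i, j). block_mat (Suc k) (Suc k) n M
      $$ (if i < r * n then i else i + n, if j < c * n then j else j + n))
    = block_mat k k n (\<lambda>i j. M (skip r i) (skip c j))"
    by (rule eq_matI) (simp_all only: index_mat index_block_mat skip lt prod.case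
        dim_row_block_mat dim_col_block_mat dim_row_mat dim_col_mat)
  finally show ?thesis by simp
qed

text \<open>The unit block rows are peeled off one after the other; as their row and column indices
  agree, no sign arises for any block size.\<close>

lemma det_block_id_except_row:
  fixes Q :: "nat \<Rightarrow> nat \<Rightarrow> 'a :: comm_ring_1 mat"
  assumes "l \<le> k"
    and "\<And>i c. i \<le> k \<Longrightarrow> c \<le> k \<Longrightarrow> i \<noteq> l \<Longrightarrow> Q i c = (if i = c then 1\<^sub>m n else 0\<^sub>m n n)"
    and "Q l l \<in> carrier_mat n n"
  shows "det (block_mat (Suc k) (Suc k) n Q) = det (Q l l)"
  using assms
proof (induction k arbitrary: l Q)
  case 0
  then have "block_mat (Suc 0) (Suc 0) n Q = Q l l"
    by (intro eq_matI) (auto simp: index_block_mat)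
  then show ?case by simp
next
  case (Suc k)
  define r where "r = (if l = 0 then Suc k else 0)"
  have r: "r \<le> Suc k" "r \<noteq> l" by (auto simp: r_def)
  have inj: "skip r i = skip r c \<longleftrightarrow> i = c" for i c by (auto simp: skip_def)
  define l' where "l' = (if l = 0 then 0 else l - 1)"
  have l': "l' \<le> k" "skip r l' = l" using Suc.prems(1) by (auto simp: l'_def r_def skip_def)
  have "det (block_mat (Suc (Suc k)) (Suc (Suc k)) n Q)
      = det (block_mat (Suc k) (Suc k) n (\<lambda>i j. Q (skip r i) (skip r j)))"
    using Suc.prems r by (intro det_block_unit_row) auto
  also have "\<dots> = det (Q (skip r l') (skip r l'))"
  proof (rule Suc.IH [OF l'(1)])
    fix i c assume ic: "i \<le> k" "c \<le> k" "i \<noteq> l'"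
    then have "skip r i \<le> Suc k" "skip r c \<le> Suc k" "skip r i \<noteq> l"
      using l' inj by (auto simp: skip_def split: if_splits)
    then show "Q (skip r i) (skip r c) = (if i = c then 1\<^sub>m n else 0\<^sub>m n n)"
      using Suc.prems(2) inj by auto
  qed (use l' Suc.prems in auto)
  finally show ?case by (simp add: l')
qed

lemma det_block_id_except_col:
  fixes Q :: "nat \<Rightarrow> nat \<Rightarrow> 'a :: comm_ring_1 mat"
  assumes l: "l \<le> k"
    and Q: "\<And>i c. i \<le> k \<Longrightarrow> c \<le> k \<Longrightarrow> c \<noteq> l \<Longrightarrow> Q i c = (if i = c then 1\<^sub>m n else 0\<^sub>m n n)"
    and C: "\<And>i. i \<le> k \<Longrightarrow> Q i l \<in> carrier_mat n n"
  shows "det (block_mat (Suc k) (Suc k) n Q) = det (Q l l)"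
proof -
  have C': "Q i c \<in> carrier_mat n n" if "i < Suc k" "c < Suc k" for i c
    using that Q C by (cases "c = l") auto
  have "det (block_mat (Suc k) (Suc k) n Q) = det ((block_mat (Suc k) (Suc k) n Q)\<^sup>T)"
    by (rule det_transpose [OF block_mat_carrier, symmetric])
  also have "\<dots> = det (block_mat (Suc k) (Suc k) n (\<lambda>c i. (Q i c)\<^sup>T))"
    by (subst transpose_block_mat) (auto intro: C')
  also have "\<dots> = det ((Q l l)\<^sup>T)"
    using l C Q by (intro det_block_id_except_row) auto
  also have "\<dots> = det (Q l l)"
    by (rule det_transpose) (use C l in auto)
  finally show ?thesis .
qed

text \<open>
  The index-independence behind Wada's invariant. Appending the block row \<open>E\<^sub>l\<close> (identity in block
  \<open>l\<close>) to \<open>M\<close> gives a square matrix with determinant the minor omitting block column \<open>l\<close>;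
  multiplying it by the identity with block column \<open>l'\<close> replaced by \<open>V\<close> kills that column except
  for its last entry \<open>V l\<close>. Blocks of even size avoid all signs.
\<close>

lemma det_block_omit_column:
  fixes M :: "nat \<Rightarrow> nat \<Rightarrow> 'a :: comm_ring_1 mat"
  assumes "even n"
    and M: "\<And>i j. i < k \<Longrightarrow> j \<le> k \<Longrightarrow> M i j \<in> carrier_mat n n"
    and V: "\<And>j. j \<le> k \<Longrightarrow> V j \<in> carrier_mat n n"
    and MV: "\<And>i a b. i < k \<Longrightarrow> a < n \<Longrightarrow> b < n \<Longrightarrow> (\<Sum>j\<le>k. (M i j * V j) $$ (a, b)) = 0"
    and l: "l \<le> k" "l' \<le> k"
  shows "det (block_mat k k n (\<lambda>i c. M i (skip l c))) * det (V l') =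
         det (block_mat k k n (\<lambda>i c. M i (skip l' c))) * det (V l)"
proof -
  let ?\<delta> = "\<lambda>i c. if i = c then 1\<^sub>m n else 0\<^sub>m n n"
  define F where "F = (\<lambda>i c. if i = k then ?\<delta> l c else M i c)"
  define W where "W = (\<lambda>i c. if c = l' then V i else ?\<delta> i c)"
  \<comment> \<open>\<open>F0\<close> and \<open>Q\<close> give a second factorisation of
    \<open>F * W\<close>: the column killed by \<open>V\<close> can be zero in \<open>F0\<close>
    from the start, and block row \<open>l'\<close> of \<open>Q\<close>, selected by the last row of
    \<open>F0\<close>, is the last row of the product.\<close>
  define F0 where "F0 = (\<lambda>i c. if i = k then ?\<delta> l' c else if c = l' then 0\<^sub>m n n else M i c)"
  define Q where "Q = (\<lambda>i c. if i = l' then (if c = l' then V l else ?\<delta> l c) else ?\<delta> i c)"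
  let ?b = "block_mat (Suc k) (Suc k) n"
  have carr: "F i c \<in> carrier_mat n n" "W i c \<in> carrier_mat n n" "F0 i c \<in> carrier_mat n n"
    "Q i c \<in> carrier_mat n n" if "i < Suc k" "c < Suc k" for i c
    using that l M V by (auto simp: F_def W_def F0_def Q_def)
  have skip_lt: "skip x i \<le> k" "skip k i = i" "skip x i \<noteq> x" if "i < k" for i x
    using that by (auto simp: skip_def)
  have detF: "det (?b F) = det (block_mat k k n (\<lambda>i c. M i (skip l c)))"
  proof -
    have "det (?b F) = det (block_mat k k n (\<lambda>i c. F (skip k i) (skip l c)))"
      using l \<open>even n\<close> by (intro det_block_unit_row) (auto simp: F_def)
    also have "block_mat k k n (\<lambda>i c. F (skip k i) (skip l c))
        = block_mat k k n (\<lambda>i c. M i (skip l c))"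
      by (rule block_mat_cong) (auto simp: F_def skip_lt)
    finally show ?thesis .
  qed
  have detF0: "det (?b F0) = det (block_mat k k n (\<lambda>i c. M i (skip l' c)))"
  proof -
    have "det (?b F0) = det (block_mat k k n (\<lambda>i c. F0 (skip k i) (skip l' c)))"
      using l \<open>even n\<close> by (intro det_block_unit_row) (auto simp: F0_def)
    also have "block_mat k k n (\<lambda>i c. F0 (skip k i) (skip l' c))
        = block_mat k k n (\<lambda>i c. M i (skip l' c))"
      by (rule block_mat_cong) (auto simp: F0_def skip_lt)
    finally show ?thesis .
  qed
  have detW: "det (?b W) = det (V l')"
    using det_block_id_except_col [of l' k W n] l V by (auto simp: W_def)
  have detQ: "det (?b Q) = det (V l)"
    using det_block_id_except_row [of l' k Q n] l V by (auto simp: Q_def)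
  have pick: "(\<Sum>e<Suc k. if e = x then f e else 0) = f x" if "x \<le> k" for x and f :: "nat \<Rightarrow> 'a"
    using that by auto
  have FW: "(\<Sum>e<Suc k. (F i e * W e c) $$ (a, b)) =
      (if c = l' then if i = k then V l $$ (a, b) else 0 else F i c $$ (a, b))"
    if "i \<le> k" "c \<le> k" "a < n" "b < n" for i c a b
  proof (cases "c = l'")
    case False
    have "(\<Sum>e<Suc k. (F i e * W e c) $$ (a, b)) = (\<Sum>e<Suc k. if e = c then F i e $$ (a, b) else 0)"
      using False that carr(1) [of i]
      by (intro sum.cong) (auto simp: W_def right_mult_one_mat[where nr=n] right_mult_zero_mat[where nr=n])
    then show ?thesis using False that by (simp only: pick if_False)
  next
    case c: True
    show ?thesis
    proof (cases "i = k")
      case False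
      then show ?thesis using that c MV [of i a b]
        by (simp add: F_def W_def lessThan_Suc_atMost)
    next
      case True
      have "(\<Sum>e<Suc k. (F i e * W e c) $$ (a, b)) = (\<Sum>e<Suc k. if e = l then V e $$ (a, b) else 0)"
        using True c that V
        by (intro sum.cong) (auto simp: F_def W_def left_mult_one_mat[where nc=n] left_mult_zero_mat[where nc=n])
      then show ?thesis using True c l by (simp only: pick if_True HOL.refl)
    qed
  qed
  have F0Q: "(\<Sum>e<Suc k. (F0 i e * Q e c) $$ (a, b)) =
      (if c = l' then if i = k then V l $$ (a, b) else 0 else F i c $$ (a, b))"
    if "i \<le> k" "c \<le> k" "a < n" "b < n" for i c a b
  proof (cases "i = k")
    case True
    have "(\<Sum>e<Suc k. (F0 i e * Q e c) $$ (a, b)) = (\<Sum>e<Suc k. if e = l' then Q e c $$ (a, b) else 0)"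
      using True that carr(4) [of _ c]
      by (intro sum.cong) (auto simp: F0_def left_mult_one_mat[where nc=n] left_mult_zero_mat[where nc=n])
    also have "\<dots> = Q l' c $$ (a, b)" using l by (simp only: pick)
    finally show ?thesis using True by (simp add: Q_def F_def)
  next
    case False
    have "(\<Sum>e<Suc k. (F0 i e * Q e c) $$ (a, b)) = (\<Sum>e<Suc k. if e = c then F0 i e $$ (a, b) else 0)"
    proof (intro sum.cong HOL.refl)
      fix e assume e: "e \<in> {..<Suc k}"
      show "(F0 i e * Q e c) $$ (a, b) = (if e = c then F0 i e $$ (a, b) else 0)"
      proof (cases "e = l'")
        case True
        have "Q e c \<in> carrier_mat n n" using carr e that by auto
        then show ?thesis using True False that
          by (simp add: F0_def left_mult_zero_mat[where nc=n])
      next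
        case e': False
        have "F0 i e \<in> carrier_mat n n" using carr e that by auto
        then show ?thesis using e' that
          by (auto simp add: Q_def right_mult_one_mat[where nr=n] right_mult_zero_mat[where nr=n])
      qed
    qed
    also have "\<dots> = F0 i c $$ (a, b)" using that by (simp only: pick)
    finally show ?thesis using False that by (simp add: F_def F0_def)
  qed
  have "?b F * ?b W = ?b F0 * ?b Q"
    by (subst (1 2) block_mat_mult) (auto intro!: carr block_mat_cong simp del: sum.lessThan_Suc simp: FW F0Q)
  then have "det (?b F) * det (?b W) = det (?b F0) * det (?b Q)"
    by (metis det_mult block_mat_carrier)
  then show ?thesis by (simp add: detF detF0 detW detQ)
qed

section \<open>Conjugate and decomposable block matrices\<close>

lemma mult_inverse_cancel:
  fixes x y s t :: "'a :: comm_monoid_mult"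
  assumes "s * t = 1" "x * s = s * y"
  shows "x = y"
proof -
  have "x = (x * s) * t" using assms(1) by (simp add: mult.assoc)
  also have "\<dots> = y * (s * t)" unfolding assms(2) by (simp add: ac_simps)
  finally show ?thesis using assms(1) by simp
qed

text \<open>The block diagonal matrix of copies of \<open>S\<close> intertwines the two block
  matrices, and copies of \<open>T\<close> give its inverse. Its determinant is therefore a unit and
  cancels, even over a ring with zero divisors.\<close>

lemma det_block_intertwine:
  fixes M :: "nat \<Rightarrow> nat \<Rightarrow> 'a :: comm_ring_1 mat"
  assumes ST: "S \<in> carrier_mat n n" "T \<in> carrier_mat n n" "S * T = 1\<^sub>m n"
    and M: "\<And>i j. i < r \<Longrightarrow> j < r \<Longrightarrow> M i j \<in> carrier_mat n n"
    and M': "\<And>i j. i < r \<Longrightarrow> j < r \<Longrightarrow> M' i j \<in> carrier_mat n n"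
    and eq: "\<And>i j. i < r \<Longrightarrow> j < r \<Longrightarrow> M i j * S = S * M' i j"
  shows "det (block_mat r r n M) = det (block_mat r r n M')"
proof -
  define D where "D = (\<lambda>X (i :: nat) c. if i = c then X else 0\<^sub>m n n :: 'a mat)"
  have D: "D X i c \<in> carrier_mat n n" if "X \<in> carrier_mat n n" for X i c
    using that by (simp add: D_def)
  let ?b = "block_mat r r n"
  have pick: "(\<Sum>e<r. if e = x then f e else 0) = f x" if "x < r" for x and f :: "nat \<Rightarrow> 'a"
    using that by auto
  have left: "(\<Sum>e<r. (D X i e * Y e c) $$ (a, b)) = (X * Y i c) $$ (a, b)"
    if "X \<in> carrier_mat n n" "\<And>e. e < r \<Longrightarrow> Y e c \<in> carrier_mat n n" "i < r" "a < n" "b < n"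
    for X Y i c a b
  proof -
    have "(\<Sum>e<r. (D X i e * Y e c) $$ (a, b)) = (\<Sum>e<r. if e = i then (X * Y e c) $$ (a, b) else 0)"
      using that by (intro sum.cong) (auto simp: D_def left_mult_zero_mat[where nc=n])
    then show ?thesis using that by (simp only: pick)
  qed
  have right: "(\<Sum>e<r. (Y i e * D X e c) $$ (a, b)) = (Y i c * X) $$ (a, b)"
    if "X \<in> carrier_mat n n" "\<And>e. e < r \<Longrightarrow> Y i e \<in> carrier_mat n n" "c < r" "a < n" "b < n"
    for X Y i c a b
  proof -
    have "(\<Sum>e<r. (Y i e * D X e c) $$ (a, b)) = (\<Sum>e<r. if e = c then (Y i e * X) $$ (a, b) else 0)"
      using that by (intro sum.cong) (auto simp: D_def right_mult_zero_mat[where nr=n])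
    then show ?thesis using that by (simp only: pick)
  qed
  have "?b (D S) * ?b (D T) = ?b (\<lambda>i c. if i = c then 1\<^sub>m n else 0\<^sub>m n n)"
  proof (subst block_mat_mult, goal_cases)
    case 3
    show ?case using ST
      by (intro block_mat_cong, simp add: left [of S "D T"] D ST(1,2))
        (auto simp: D_def ST(3) right_mult_zero_mat [OF ST(1)])
  qed (auto simp: D ST)
  then have inv: "det (?b (D S)) * det (?b (D T)) = 1"
    by (metis det_mult block_mat_carrier block_mat_one det_one)
  have "?b M * ?b (D S) = ?b (D S) * ?b M'"
  proof -
    have "?b M * ?b (D S) = ?b (\<lambda>i c. mat n n (\<lambda>x. \<Sum>e<r. (M i e * D S e c) $$ x))"
      by (rule block_mat_mult) (simp_all add: D ST M)
    also have "\<dots> = ?b (\<lambda>i c. mat n n (\<lambda>x. \<Sum>e<r. (D S i e * M' e c) $$ x))"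
    proof (rule block_mat_cong)
      fix i c a b assume ic: "i < r" "c < r" and ab: "a < n" "b < n"
      have "(\<Sum>e<r. (M i e * D S e c) $$ (a, b)) = (M i c * S) $$ (a, b)"
        using ic ab by (intro right) (auto intro: ST M)
      also have "\<dots> = (S * M' i c) $$ (a, b)" using eq ic by simp
      also have "\<dots> = (\<Sum>e<r. (D S i e * M' e c) $$ (a, b))"
        using ic ab by (intro left [symmetric]) (auto intro: ST M')
      finally show "mat n n (\<lambda>x. \<Sum>e<r. (M i e * D S e c) $$ x) $$ (a, b) =
          mat n n (\<lambda>x. \<Sum>e<r. (D S i e * M' e c) $$ x) $$ (a, b)"
        using ab by simp
    qed
    also have "\<dots> = ?b (D S) * ?b M'"
      by (rule block_mat_mult [symmetric]) (simp_all add: D ST M')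
    finally show ?thesis .
  qed
  then have comm: "det (?b M) * det (?b (D S)) = det (?b (D S)) * det (?b M')"
    by (metis det_mult block_mat_carrier)
  show ?thesis by (rule mult_inverse_cancel [OF inv comm])
qed

text \<open>The same permutation acts on rows and columns, so its sign enters twice.\<close>

lemma det_reindex:
  fixes A :: "'a :: comm_ring_1 mat"
  assumes A: "A \<in> carrier_mat n n" and p: "p permutes {0..<n}"
  shows "det (mat n n (\<lambda>(i, j). A $$ (p i, p j))) = det A"
proof -
  have pn: "p i < n" if "i < n" for i using permutes_in_image [OF p, of i] that by simp
  define B where "B = (mat n n (\<lambda>(i, j). A $$ (p i, j)))\<^sup>T"
  have B: "B \<in> carrier_mat n n" by (simp add: B_def)
  have "mat n n (\<lambda>(i, j). A $$ (p i, p j)) = (mat n n (\<lambda>(i, j). B $$ (p i, j)))\<^sup>T"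
    by (rule eq_matI) (auto simp: B_def pn)
  then have "det (mat n n (\<lambda>(i, j). A $$ (p i, p j))) = det (mat n n (\<lambda>(i, j). B $$ (p i, j)))"
    by (simp add: det_transpose [where n = n])
  also have "\<dots> = signof p * det B" by (rule det_permute_rows [OF B p])
  also have "det B = signof p * det A"
    unfolding B_def by (subst det_transpose [where n = n]) (auto simp: det_permute_rows [OF A p])
  finally show ?thesis by (simp add: sign_def)
qed

text \<open>Listing the first m coordinates of all blocks before the last n coordinates of all
  blocks turns a block matrix of direct sums into a direct sum of two block matrices; rows and
  columns are reordered alike.\<close>

lemma det_block_direct_sum:
  fixes A B :: "nat \<Rightarrow> nat \<Rightarrow> 'a :: idom mat"
  assumes A: "\<And>i j. i < r \<Longrightarrow> j < r \<Longrightarrow> A i j \<in> carrier_mat m m"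
    and B: "\<And>i j. i < r \<Longrightarrow> j < r \<Longrightarrow> B i j \<in> carrier_mat n n"
  shows "det (block_mat r r (m + n) (\<lambda>i j. four_block_mat (A i j) (0\<^sub>m m n) (0\<^sub>m n m) (B i j))) =
         det (block_mat r r m A) * det (block_mat r r n B)"
proof -
  let ?N = "r * (m + n)"
  let ?M = "block_mat r r (m + n) (\<lambda>i j. four_block_mat (A i j) (0\<^sub>m m n) (0\<^sub>m n m) (B i j))"
  \<comment> \<open>In the new order, position s belongs to block \<open>q s\<close> at offset
    \<open>o' s\<close> within that block; \<open>p\<close> gives its position in the old
    order.\<close>
  define q where "q s = (if s < r * m then s div m else (s - r * m) div n)" for s
  define o' where "o' s = (if s < r * m then s mod m else m + (s - r * m) mod n)" for s
  define p where "p s = (if s < ?N then q s * (m + n) + o' s else s)" for s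
  have N: "?N = r * m + r * n" by (simp add: algebra_simps)
  have dm: "s div m < r" "s mod m < m" if "s < r * m" for s using div_mod_block [OF that] .
  have dn: "(s - r * m) div n < r" "(s - r * m) mod n < n" if "\<not> s < r * m" "s < ?N" for s
    using div_mod_block [of "s - r * m" r n] that N by auto
  have q: "q s < r" if "s < ?N" for s using that dm dn by (simp add: q_def)
  have o': "o' s < m + n" if "s < ?N" for s
    using that dm [of s] dn [of s] by (cases "s < r * m") (simp_all add: o'_def)
  have pdiv: "p s div (m + n) = q s" and pmod: "p s mod (m + n) = o' s" if "s < ?N" for s
    using mult_add_div_mod [OF o' [OF that]] that by (simp_all add: p_def)
  have plt: "p s < ?N" if "s < ?N" for s
  proof -
    have "p s < Suc (q s) * (m + n)" using o' [OF that] that by (simp add: p_def)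
    also have "\<dots> \<le> ?N" using q [OF that] by (intro mult_le_mono1) simp
    finally show ?thesis .
  qed
  have o'_lt: "s < r * m \<Longrightarrow> o' s < m" "\<not> s < r * m \<Longrightarrow> s < ?N \<Longrightarrow> o' s - m < n" for s
    using dm [of s] dn [of s] by (simp_all add: o'_def)
  have low: "o' s < m \<longleftrightarrow> s < r * m" if "s < ?N" for s
    using dm [of s] by (cases "s < r * m") (simp_all add: o'_def)
  have "inj_on p {0..<?N}"
  proof (rule inj_onI)
    fix s t assume st: "s \<in> {0..<?N}" "t \<in> {0..<?N}" "p s = p t"
    then have qo: "q s = q t" "o' s = o' t" using pdiv pmod by (metis atLeastLessThan_iff)+
    then have "s < r * m \<longleftrightarrow> t < r * m" using low st by (metis atLeastLessThan_iff)
    then show "s = t"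
    proof (cases "s < r * m")
      case True
      then show ?thesis using \<open>s < r * m \<longleftrightarrow> t < r * m\<close> qo
        by (simp add: q_def o'_def) (metis div_mult_mod_eq)
    next
      case False
      then have "s - r * m = t - r * m" using \<open>s < r * m \<longleftrightarrow> t < r * m\<close> qo
        by (simp add: q_def o'_def) (metis div_mult_mod_eq)
      then show ?thesis using False \<open>s < r * m \<longleftrightarrow> t < r * m\<close> by simp
    qed
  qed
  moreover have "p ` {0..<?N} \<subseteq> {0..<?N}" using plt by auto
  ultimately have "bij_betw p {0..<?N} {0..<?N}"
    by (simp add: bij_betw_def endo_inj_surj)
  then have "p permutes {0..<?N}"
    by (rule bij_imp_permutes) (simp add: p_def)
  then have "det ?M = det (mat ?N ?N (\<lambda>(i, j). ?M $$ (p i, p j)))"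
    by (intro det_reindex [symmetric]) simp_all
  also have "mat ?N ?N (\<lambda>(i, j). ?M $$ (p i, p j)) =
      four_block_mat (block_mat r r m A) (0\<^sub>m (r * m) (r * n)) (0\<^sub>m (r * n) (r * m)) (block_mat r r n B)"
    (is "?L = ?R")
  proof (rule eq_matI)
    fix i j assume "i < dim_row ?R" "j < dim_col ?R"
    then have ij: "i < ?N" "j < ?N" by (auto simp: N)
    have "A (q i) (q j) \<in> carrier_mat m m" "B (q i) (q j) \<in> carrier_mat n n"
      using A B q ij by auto
    then have "?L $$ (i, j) = (if i < r * m then if j < r * m then A (q i) (q j) $$ (o' i, o' j) else 0
        else if j < r * m then 0 else B (q i) (q j) $$ (o' i - m, o' j - m))"
      using ij o' by (simp add: index_block_mat plt pdiv pmod low o'_lt)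
    also have "\<dots> = ?R $$ (i, j)"
      using ij N by (auto simp: index_block_mat q_def o'_def)
    finally show "?L $$ (i, j) = ?R $$ (i, j)" .
  qed (auto simp: N)
  also have "det \<dots> = det (block_mat r r m A) * det (block_mat r r n B)"
    by (rule det_four_block_mat_upper_right_zero) auto
  finally show ?thesis .
qed

section \<open>Wada's invariant of a deficiency-one presentation\<close>

lemma index_mult_mat_sum:
  assumes "A \<in> carrier_mat m n" "B \<in> carrier_mat n p" "a < m" "b < p"
  shows "(A * B) $$ (a, b) = (\<Sum>e<n. A $$ (a, e) * B $$ (e, b))"
  using assms by (simp add: scalar_prod_def atLeast0LessThan)

lemma det_mat2:
  fixes A :: "'a :: comm_ring_1 mat"
  assumes A: "A \<in> carrier_mat 2 2"
  shows "det A = A $$ (0, 0) * A $$ (1, 1) - A $$ (0, 1) * A $$ (1, 0)"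
proof -
  have "mat_delete A 0 j \<in> carrier_mat 1 1" for j
    using mat_delete_carrier [OF A] by simp
  then have "det (mat_delete A 0 j) = mat_delete A 0 j $$ (0, 0)" for j
    by (rule det_single)
  then show ?thesis
    using A laplace_expansion_row [OF A, of 0]
    by (simp add: cofactor_def mat_delete_def numeral_2_eq_2)
qed

section \<open>The linear extension of a representation to the group ring\<close>

definition const_fract :: "complex \<Rightarrow> complex poly fract" where
  "const_fract c = to_fract [:c:]"

lemma const_fract_0 [simp]: "const_fract 0 = 0"
  and const_fract_1 [simp]: "const_fract 1 = 1"
  and const_fract_add: "const_fract (a + b) = const_fract a + const_fract b"
  and const_fract_diff: "const_fract (a - b) = const_fract a - const_fract b"
  and const_fract_mult: "const_fract (a * b) = const_fract a * const_fract b"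
  by (simp_all add: const_fract_def one_pCons [symmetric] flip: to_fract_add to_fract_diff to_fract_mult)

lemma to_fract_power: "to_fract (x ^ n) = to_fract x ^ n"
  by (induction n) simp_all

lemma const_fract_sum: "const_fract (sum f A) = (\<Sum>x\<in>A. const_fract (f x))"
  by (induction A rule: infinite_finite_induct) (simp_all add: const_fract_add)

lemma map_const_fract_mult:
  assumes "A \<in> carrier_mat m n" "B \<in> carrier_mat n p"
  shows "map_mat const_fract (A * B) = map_mat const_fract A * map_mat const_fract B"
  using assms by (intro eq_matI) (auto simp: scalar_prod_def const_fract_sum const_fract_mult)

lemma map_const_fract_one: "map_mat const_fract (1\<^sub>m n) = 1\<^sub>m n"
  by (intro eq_matI) auto

lemma rat_t_neq_0 [simp]: "rat_t \<noteq> 0"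
  by (simp add: rat_t_def)

lemma twisted_map_carrier [simp]: "twisted_map \<alpha> n \<phi> x \<in> carrier_mat n n"
  and dim_row_twisted_map [simp]: "dim_row (twisted_map \<alpha> n \<phi> x) = n"
  and dim_col_twisted_map [simp]: "dim_col (twisted_map \<alpha> n \<phi> x) = n"
  by (simp_all add: twisted_map_def)

text \<open>Coefficients vanish off the support, so any finite superset may index the sum; sums and
  differences are then compared over a common index set.\<close>

lemma index_twisted_map:
  assumes "finite S" "Poly_Mapping.keys x \<subseteq> S" "a < n" "b < n"
  shows "twisted_map \<alpha> n \<phi> x $$ (a, b) =
    (\<Sum>\<gamma>\<in>S. of_int (Poly_Mapping.lookup x \<gamma>) * rat_t powi \<alpha> \<gamma> * const_fract (\<phi> \<gamma> $$ (a, b)))"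
proof -
  have "(\<Sum>\<gamma>\<in>Poly_Mapping.keys x. of_int (Poly_Mapping.lookup x \<gamma>) * rat_t powi \<alpha> \<gamma> * const_fract (\<phi> \<gamma> $$ (a, b)))
    = (\<Sum>\<gamma>\<in>S. of_int (Poly_Mapping.lookup x \<gamma>) * rat_t powi \<alpha> \<gamma> * const_fract (\<phi> \<gamma> $$ (a, b)))"
    using assms by (intro sum.mono_neutral_left) (auto simp: in_keys_iff)
  then show ?thesis using assms by (simp add: twisted_map_def const_fract_def)
qed

lemma twisted_map_0 [simp]: "twisted_map \<alpha> n \<phi> 0 = 0\<^sub>m n n"
  by (intro eq_matI) (auto simp: twisted_map_def)

lemma twisted_map_diff:
  "twisted_map \<alpha> n \<phi> (x - y) = twisted_map \<alpha> n \<phi> x - twisted_map \<alpha> n \<phi> y"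
proof (rule eq_matI, goal_cases)
  case (1 a b)
  let ?S = "Poly_Mapping.keys x \<union> Poly_Mapping.keys y"
  have "Poly_Mapping.keys (x - y) \<subseteq> ?S" by (rule keys_diff)
  then show ?case using 1
    by (simp add: index_twisted_map [where S = ?S] lookup_minus algebra_simps sum_subtractf)
qed auto

lemma twisted_map_add:
  "twisted_map \<alpha> n \<phi> (x + y) = twisted_map \<alpha> n \<phi> x + twisted_map \<alpha> n \<phi> y"
proof (rule eq_matI, goal_cases)
  case (1 a b)
  let ?S = "Poly_Mapping.keys x \<union> Poly_Mapping.keys y"
  have "Poly_Mapping.keys (x + y) \<subseteq> ?S" by (rule Poly_Mapping.keys_add)
  then show ?case using 1
    by (simp add: index_twisted_map [where S = ?S] lookup_add algebra_simps sum.distrib)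
qed auto

lemma index_twisted_map_frag_of:
  "a < n \<Longrightarrow> b < n \<Longrightarrow>
    twisted_map \<alpha> n \<phi> (frag_of \<gamma>) $$ (a, b) = rat_t powi \<alpha> \<gamma> * const_fract (\<phi> \<gamma> $$ (a, b))"
  by (simp add: index_twisted_map [where S = "{\<gamma>}"] keys_frag_of)

lemma twisted_map_intertwine:
  assumes S: "S \<in> carrier_mat n n"
    and \<phi>: "\<And>\<gamma>. \<gamma> \<in> Poly_Mapping.keys x \<Longrightarrow> \<phi> \<gamma> \<in> carrier_mat n n"
    and \<phi>': "\<And>\<gamma>. \<gamma> \<in> Poly_Mapping.keys x \<Longrightarrow> \<phi>' \<gamma> \<in> carrier_mat n n"
    and eq: "\<And>\<gamma>. \<gamma> \<in> Poly_Mapping.keys x \<Longrightarrow> \<phi> \<gamma> * S = S * \<phi>' \<gamma>"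
  shows "twisted_map \<alpha> n \<phi> x * map_mat const_fract S = map_mat const_fract S * twisted_map \<alpha> n \<phi>' x"
    (is "?L = ?R")
proof (rule eq_matI)
  fix a b assume "a < dim_row ?R" "b < dim_col ?R"
  then have ab: "a < n" "b < n" using S by auto
  let ?K = "Poly_Mapping.keys x"
  let ?c = "\<lambda>\<gamma>. of_int (Poly_Mapping.lookup x \<gamma>) * rat_t powi \<alpha> \<gamma>"
  have "?L $$ (a, b) = (\<Sum>i<n. \<Sum>\<gamma>\<in>?K. ?c \<gamma> * const_fract (\<phi> \<gamma> $$ (a, i)) * const_fract (S $$ (i, b)))"
    using ab S by (simp add: scalar_prod_def index_twisted_map [where S = ?K] sum_distrib_right atLeast0LessThan)
  also have "\<dots> = (\<Sum>\<gamma>\<in>?K. ?c \<gamma> * const_fract ((\<phi> \<gamma> * S) $$ (a, b)))"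
    unfolding sum.swap [of _ _ "{..<n}"]
  proof (intro sum.cong HOL.refl)
    fix \<gamma> assume "\<gamma> \<in> ?K"
    then have "dim_row (\<phi> \<gamma>) = n" "dim_col (\<phi> \<gamma>) = n" using \<phi> by auto
    then show "(\<Sum>i<n. ?c \<gamma> * const_fract (\<phi> \<gamma> $$ (a, i)) * const_fract (S $$ (i, b)))
        = ?c \<gamma> * const_fract ((\<phi> \<gamma> * S) $$ (a, b))"
      using ab S
      by (simp add: scalar_prod_def const_fract_sum const_fract_mult sum_distrib_left mult.assoc atLeast0LessThan)
  qed
  also have "\<dots> = (\<Sum>\<gamma>\<in>?K. ?c \<gamma> * const_fract ((S * \<phi>' \<gamma>) $$ (a, b)))"
    by (simp add: eq)
  also have "\<dots> = (\<Sum>i<n. \<Sum>\<gamma>\<in>?K. const_fract (S $$ (a, i)) * (?c \<gamma> * const_fract (\<phi>' \<gamma> $$ (i, b))))"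
    unfolding sum.swap [of _ _ "{..<n}"]
  proof (intro sum.cong HOL.refl)
    fix \<gamma> assume "\<gamma> \<in> ?K"
    then have "dim_row (\<phi>' \<gamma>) = n" "dim_col (\<phi>' \<gamma>) = n" using \<phi>' by auto
    then show "?c \<gamma> * const_fract ((S * \<phi>' \<gamma>) $$ (a, b))
        = (\<Sum>i<n. const_fract (S $$ (a, i)) * (?c \<gamma> * const_fract (\<phi>' \<gamma> $$ (i, b))))"
      using ab S
      by (simp add: scalar_prod_def const_fract_sum const_fract_mult sum_distrib_left algebra_simps atLeast0LessThan)
  qed
  also have "\<dots> = ?R $$ (a, b)"
    using ab S by (simp add: scalar_prod_def index_twisted_map [where S = ?K] sum_distrib_left atLeast0LessThan)
  finally show "?L $$ (a, b) = ?R $$ (a, b)" .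
qed (use S in auto)

lemma twisted_map_direct_sum:
  assumes \<phi>: "\<And>\<gamma>. \<gamma> \<in> Poly_Mapping.keys x \<Longrightarrow> \<phi> \<gamma> \<in> carrier_mat m m"
    and \<phi>': "\<And>\<gamma>. \<gamma> \<in> Poly_Mapping.keys x \<Longrightarrow> \<phi>' \<gamma> \<in> carrier_mat n n"
  shows "twisted_map \<alpha> (m + n) (\<lambda>\<gamma>. four_block_mat (\<phi> \<gamma>) (0\<^sub>m m n) (0\<^sub>m n m) (\<phi>' \<gamma>)) x =
    four_block_mat (twisted_map \<alpha> m \<phi> x) (0\<^sub>m m n) (0\<^sub>m n m) (twisted_map \<alpha> n \<phi>' x)" (is "?L = ?R")
proof (rule eq_matI)
  fix a b assume "a < dim_row ?R" "b < dim_col ?R"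
  then have ab: "a < m + n" "b < m + n" by auto
  let ?K = "Poly_Mapping.keys x"
  have "?L $$ (a, b) = (\<Sum>\<gamma>\<in>?K. of_int (Poly_Mapping.lookup x \<gamma>) * rat_t powi \<alpha> \<gamma> *
      const_fract (if a < m then if b < m then \<phi> \<gamma> $$ (a, b) else 0
        else if b < m then 0 else \<phi>' \<gamma> $$ (a - m, b - m)))"
    unfolding index_twisted_map [OF finite_keys order_refl ab]
  proof (intro sum.cong HOL.refl)
    fix \<gamma> assume "\<gamma> \<in> ?K"
    then have "\<phi> \<gamma> \<in> carrier_mat m m" "\<phi>' \<gamma> \<in> carrier_mat n n" using \<phi> \<phi>' by auto
    then show "of_int (Poly_Mapping.lookup x \<gamma>) * rat_t powi \<alpha> \<gamma> *
        const_fract (four_block_mat (\<phi> \<gamma>) (0\<^sub>m m n) (0\<^sub>m n m) (\<phi>' \<gamma>) $$ (a, b))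
      = of_int (Poly_Mapping.lookup x \<gamma>) * rat_t powi \<alpha> \<gamma> *
      const_fract (if a < m then if b < m then \<phi> \<gamma> $$ (a, b) else 0
        else if b < m then 0 else \<phi>' \<gamma> $$ (a - m, b - m))"
      using ab by auto
  qed
  also have "\<dots> = ?R $$ (a, b)"
    using ab by (auto simp: index_twisted_map [where S = ?K])
  finally show "?L $$ (a, b) = ?R $$ (a, b)" .
qed auto

primrec direct_sum :: "(nat \<Rightarrow> 'g \<Rightarrow> 'a::zero mat) \<Rightarrow> nat \<Rightarrow> nat \<Rightarrow> 'g \<Rightarrow> 'a mat" where
  "direct_sum \<theta> n 0 = (\<lambda>\<gamma>. 0\<^sub>m 0 0)"
| "direct_sum \<theta> n (Suc N) =
    (\<lambda>\<gamma>. four_block_mat (direct_sum \<theta> n N \<gamma>) (0\<^sub>m (n * N) n) (0\<^sub>m n (n * N)) (\<theta> N \<gamma>))"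

lemma direct_sum_carrier:
  "(\<And>m. m < N \<Longrightarrow> \<theta> m \<gamma> \<in> carrier_mat n n) \<Longrightarrow> direct_sum \<theta> n N \<gamma> \<in> carrier_mat (n * N) (n * N)"
proof (induction N)
  case (Suc N)
  then have "direct_sum \<theta> n N \<gamma> \<in> carrier_mat (n * N) (n * N)" "\<theta> N \<gamma> \<in> carrier_mat n n"
    by auto
  then show ?case
    by (metis direct_sum.simps(2) four_block_carrier_mat add.commute mult_Suc_right)
qed simp

lemma index_direct_sum:
  assumes "\<And>m. m < N \<Longrightarrow> \<theta> m \<gamma> \<in> carrier_mat n n" "a < n * N" "b < n * N"
  shows "direct_sum \<theta> n N \<gamma> $$ (a, b) =
    (if a div n = b div n then \<theta> (a div n) \<gamma> $$ (a mod n, b mod n) else 0)"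
  using assms
proof (induction N arbitrary: a b)
  case (Suc N)
  have c: "direct_sum \<theta> n N \<gamma> \<in> carrier_mat (n * N) (n * N)" "\<theta> N \<gamma> \<in> carrier_mat n n"
    using Suc.prems direct_sum_carrier [of N \<theta> \<gamma> n] by auto
  have d: "a div n = N \<and> a mod n = a - n * N" if "\<not> a < n * N" "a < n * Suc N" for a
    using that mult_add_div_mod [of "a - n * N" n N] by (simp add: mult.commute)
  have d': "a div n \<noteq> N" if "a < n * N" for a
    using that by (metis less_mult_imp_div_less mult.commute nat_neq_iff)
  show ?case
    using Suc.prems Suc.IH [of a b] carrier_matD [OF c(1)] carrier_matD [OF c(2)]
      d [of a] d [of b] d' [of a] d' [of b]
    by (cases "a < n * N"; cases "b < n * N") auto
qed simp

section \<open>Groups with a deficiency-one presentation\<close>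

locale deficiency_one = group G for G (structure) +
  fixes \<alpha> :: "'a \<Rightarrow> int" and k :: nat and g :: "nat \<Rightarrow> 'a" and rs :: "group_word list"
  assumes \<alpha>_hom: "\<alpha> \<in> hom G integer_group"
    and \<alpha>_surj: "\<alpha> ` carrier G = UNIV"
    and presentation: "deficiency_one_presentation G k g rs"
begin

lemma k_eq: "k = Suc (length rs)"
  and g_closed: "i < k \<Longrightarrow> g i \<in> carrier G"
  and rs_words: "r \<in> set rs \<Longrightarrow> r \<in> words_on k"
  and word_eval_surj: "word_eval G g ` words_on k = carrier G"
  using presentation by (auto simp: deficiency_one_presentation_def)

lemma \<alpha>_mult: "\<gamma> \<in> carrier G \<Longrightarrow> \<delta> \<in> carrier G \<Longrightarrow> \<alpha> (\<gamma> \<otimes> \<delta>) = \<alpha> \<gamma> + \<alpha> \<delta>"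
  using \<alpha>_hom by (simp add: hom_def integer_group_def)

lemma \<alpha>_one: "\<alpha> \<one> = 0"
  using \<alpha>_mult [of \<one> \<one>] by simp

lemma \<alpha>_inv: "\<gamma> \<in> carrier G \<Longrightarrow> \<alpha> (inv \<gamma>) = - \<alpha> \<gamma>"
  using \<alpha>_mult [of \<gamma> "inv \<gamma>"] by (simp add: \<alpha>_one)

lemma words_on_Cons: "(i, b) # w \<in> words_on k \<longleftrightarrow> i < k \<and> w \<in> words_on k"
  by (auto simp: words_on_def)

lemma letter_eval_closed: "i < k \<Longrightarrow> letter_eval G g (i, b) \<in> carrier G"
  by (auto simp: g_closed)

lemma word_eval_closed: "w \<in> words_on k \<Longrightarrow> word_eval G g w \<in> carrier G"
  using word_eval_surj by blast

lemma word_eval_relator: "r \<in> set rs \<Longrightarrow> word_eval G g r = \<one>"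
proof -
  assume r: "r \<in> set rs"
  have "[] \<in> words_on k" by (simp add: words_on_def)
  then have "presented_eq k rs r []"
    using presented_eq.relator [of "[]" k "[]" r rs] r by simp
  then have "word_eval G g r = word_eval G g []"
    using presentation rs_words [OF r] \<open>[] \<in> words_on k\<close>
    unfolding deficiency_one_presentation_def by blast
  then show ?thesis by simp
qed

lemma generator_induct [consumes 1, case_names one gen]:
  assumes "\<gamma> \<in> carrier G" "P \<one>"
    and "\<And>i b \<delta>. i < k \<Longrightarrow> \<delta> \<in> carrier G \<Longrightarrow> P \<delta> \<Longrightarrow> P (letter_eval G g (i, b) \<otimes> \<delta>)"
  shows "P \<gamma>"
proof -
  have "P (word_eval G g w)" if "w \<in> words_on k" for w
    using that
  proof (induction w)
    case (Cons x w)
    then show ?case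
      using assms(3) word_eval_closed by (cases x) (auto simp: words_on_Cons simp del: letter_eval.simps)
  qed (simp add: assms(2))
  moreover obtain w where "w \<in> words_on k" "\<gamma> = word_eval G g w"
    using assms(1) word_eval_surj by (metis imageE)
  ultimately show ?thesis by simp
qed

text \<open>Otherwise \<open>\<alpha>\<close> would vanish on all words in the generators, against
  surjectivity. Such an index is admissible in Wada's quotient for every representation into
  SL2.\<close>

lemma exists_generator_nonzero: "\<exists>l<k. \<alpha> (g l) \<noteq> 0"
proof (rule ccontr)
  assume "\<not> ?thesis"
  then have zero: "\<alpha> (g l) = 0" if "l < k" for l using that by auto
  have "\<alpha> \<gamma> = 0" if "\<gamma> \<in> carrier G" for \<gamma>
    using that
  proof (induction rule: generator_induct)
    case (gen i b \<delta>)
    then show ?case by (simp add: \<alpha>_mult g_closed \<alpha>_inv zero)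
  qed (simp add: \<alpha>_one)
  moreover obtain \<gamma> where "\<gamma> \<in> carrier G" "\<alpha> \<gamma> = 1" using \<alpha>_surj by (metis imageE UNIV_I)
  ultimately show False by simp
qed

lemma keys_fox: "w \<in> words_on k \<Longrightarrow> Poly_Mapping.keys (fox j w) \<subseteq> words_on k"
proof (induction w)
  case (Cons x w)
  obtain i b where x: "x = (i, b)" by (cases x)
  have w: "w \<in> words_on k" "i < k" using Cons.prems by (auto simp: x words_on_Cons)
  have "Poly_Mapping.keys (fox_letter j x) \<subseteq> words_on k"
    using w by (auto simp: x keys_frag_of words_on_def)
  moreover have "Poly_Mapping.keys (frag_extend (\<lambda>u. frag_of (x # u)) (fox j w)) \<subseteq> words_on k"
    using keys_frag_extend [of "\<lambda>u. frag_of (x # u)" "fox j w"] Cons.IH w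
    by (fastforce simp: keys_frag_of x words_on_Cons)
  ultimately show ?case
    using Poly_Mapping.keys_add [of "fox_letter j x" "frag_extend (\<lambda>u. frag_of (x # u)) (fox j w)"]
    by (simp del: fox_letter.simps) blast
qed simp

lemma keys_to_group_ring:
  assumes "Poly_Mapping.keys c \<subseteq> words_on k"
  shows "Poly_Mapping.keys (to_group_ring G g c) \<subseteq> carrier G"
  using keys_frag_extend [of "\<lambda>w. frag_of (word_eval G g w)" c] assms word_eval_closed
  by (fastforce simp: to_group_ring_def keys_frag_of)

text \<open>Determinants are left free, so that symmetric powers qualify without a computation of
  theirs.\<close>

definition mat_rep :: "nat \<Rightarrow> ('a \<Rightarrow> complex mat) \<Rightarrow> bool" where
  "mat_rep n \<phi> \<longleftrightarrow> (\<forall>\<gamma>\<in>carrier G. \<phi> \<gamma> \<in> carrier_mat n n) \<and> \<phi> \<one> = 1\<^sub>m n \<and>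
    (\<forall>\<gamma>\<in>carrier G. \<forall>\<delta>\<in>carrier G. \<phi> (\<gamma> \<otimes> \<delta>) = \<phi> \<gamma> * \<phi> \<delta>)"

abbreviation fox_block :: "nat \<Rightarrow> ('a \<Rightarrow> complex mat) \<Rightarrow> nat \<Rightarrow> group_word \<Rightarrow> complex poly fract mat" where
  "fox_block n \<phi> j w \<equiv> twisted_map \<alpha> n \<phi> (to_group_ring G g (fox j w))"

section \<open>The fundamental formula of Fox calculus\<close>

context
  fixes n :: nat and \<phi> :: "'a \<Rightarrow> complex mat"
  assumes rep: "mat_rep n \<phi>"
begin

lemma twisted_map_mult:
  assumes "\<gamma> \<in> carrier G" "\<delta> \<in> carrier G"
  shows "twisted_map \<alpha> n \<phi> (frag_of (\<gamma> \<otimes> \<delta>)) =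
    twisted_map \<alpha> n \<phi> (frag_of \<gamma>) * twisted_map \<alpha> n \<phi> (frag_of \<delta>)" (is "?L = ?R")
proof (rule eq_matI)
  fix a b assume "a < dim_row ?R" "b < dim_col ?R"
  then have ab: "a < n" "b < n" by auto
  have "\<phi> \<gamma> \<in> carrier_mat n n" "\<phi> \<delta> \<in> carrier_mat n n" "\<phi> (\<gamma> \<otimes> \<delta>) = \<phi> \<gamma> * \<phi> \<delta>"
    using rep assms by (auto simp: mat_rep_def)
  then show "?L $$ (a, b) = ?R $$ (a, b)"
    using ab assms
    by (simp add: index_twisted_map_frag_of scalar_prod_def const_fract_sum const_fract_mult
        \<alpha>_mult power_int_add sum_distrib_left mult.assoc mult.left_commute)
qed auto

lemma twisted_map_one: "twisted_map \<alpha> n \<phi> (frag_of \<one>) = 1\<^sub>m n"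
  using rep by (intro eq_matI) (auto simp: index_twisted_map_frag_of \<alpha>_one mat_rep_def)

lemma twisted_map_letter_mult:
  assumes "Poly_Mapping.keys c \<subseteq> words_on k" "i < k"
  shows "twisted_map \<alpha> n \<phi> (to_group_ring G g (frag_extend (\<lambda>u. frag_of ((i, b) # u)) c)) =
    twisted_map \<alpha> n \<phi> (frag_of (letter_eval G g (i, b))) * twisted_map \<alpha> n \<phi> (to_group_ring G g c)"
  using assms(1)
proof (induction c rule: frag_induction)
  case zero
  then show ?case by (simp add: to_group_ring_def right_mult_zero_mat [where nr = n])
next
  case (one w)
  then show ?case
    using letter_eval_closed [OF assms(2)] word_eval_closed
    by (simp add: to_group_ring_def twisted_map_mult del: letter_eval.simps)
next
  case (diff c d)
  then show ?case
    by (simp add: to_group_ring_def frag_extend_diff twisted_map_diff del: letter_eval.simps)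
      (subst mult_minus_distrib_mat [where nc = n and n = n and nr = n]; simp)
qed

text \<open>Image under \<open>twisted_map\<close> of Fox's formula, which writes w - 1 as the sum
  over j of the derivative of w by g_j times g_j - 1; the induction rests on xw - 1 = (x - 1) + x (w
  - 1). For a relator the right-hand side is zero, so the blocks of g_j - 1 form a column
  annihilated by the Fox matrix.\<close>

lemma fox_fundamental:
  assumes "w \<in> words_on k" "a < n" "b < n"
  shows "(\<Sum>j<k. (fox_block n \<phi> j w * twisted_map \<alpha> n \<phi> (frag_of (g j) - frag_of \<one>)) $$ (a, b)) =
    twisted_map \<alpha> n \<phi> (frag_of (word_eval G g w)) $$ (a, b) - 1\<^sub>m n $$ (a, b)"
  using assms
proof (induction w arbitrary: a)
  case Nil
  then show ?case
    by (simp add: to_group_ring_def twisted_map_one left_mult_zero_mat [where nc = n])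
next
  case (Cons x w)
  obtain i c where x: "x = (i, c)" by (cases x)
  have i: "i < k" and w: "w \<in> words_on k" using Cons.prems by (auto simp: x words_on_Cons)
  define R where "R \<gamma> = twisted_map \<alpha> n \<phi> (frag_of \<gamma>)" for \<gamma>
  define V where "V j = twisted_map \<alpha> n \<phi> (frag_of (g j) - frag_of \<one>)" for j
  define F where "F j = fox_block n \<phi> j w" for j
  define L where "L j = twisted_map \<alpha> n \<phi> (to_group_ring G g (fox_letter j x))" for j
  let ?x = "letter_eval G g x"
  have carr [simp]: "R \<gamma> \<in> carrier_mat n n" "V j \<in> carrier_mat n n" "F j \<in> carrier_mat n n"
    "L j \<in> carrier_mat n n" for \<gamma> j
    by (simp_all add: R_def V_def F_def L_def)
  have V: "V j = R (g j) - 1\<^sub>m n" for j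
    by (simp add: V_def R_def twisted_map_diff twisted_map_one)
  have x_closed: "?x \<in> carrier G" using letter_eval_closed [OF i] by (simp add: x)
  have letter: "(\<Sum>j<k. (L j * V j) $$ (a, b)) = R ?x $$ (a, b) - 1\<^sub>m n $$ (a, b)"
  proof -
    have "(\<Sum>j<k. (L j * V j) $$ (a, b)) = (\<Sum>j<k. if j = i then (L i * V i) $$ (a, b) else 0)"
      using Cons.prems
      by (intro sum.cong) (auto simp: L_def x to_group_ring_def left_mult_zero_mat [where nc = n])
    also have "\<dots> = (L i * V i) $$ (a, b)" using i by simp
    also have "L i * V i = R ?x - 1\<^sub>m n"
    proof (cases c)
      case True
      then have "L i = 1\<^sub>m n" by (simp add: L_def x to_group_ring_def twisted_map_one)
      then show ?thesis using True by (simp add: V x)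
    next
      \<comment> \<open>The derivative of an inverse letter is -g^(-1), and -g^(-1) (g - 1) = g^(-1)
        - 1.\<close>
      case False
      have "twisted_map \<alpha> n \<phi> (- frag_of (inv (g i))) = - R (inv (g i))"
        using twisted_map_diff [of \<alpha> n \<phi> 0 "frag_of (inv (g i))"]
        by (simp add: R_def) (auto intro!: eq_matI)
      then have "L i = - R (inv (g i))"
        using False i by (simp add: L_def x to_group_ring_def frag_extend_minus g_closed)
      then have "L i * V i = - (R (inv (g i)) * (R (g i) - 1\<^sub>m n))"
        unfolding V by (simp add: uminus_mult_left_mat R_def)
      also have "R (inv (g i)) * (R (g i) - 1\<^sub>m n) = R (inv (g i)) * R (g i) - R (inv (g i))"
        by (subst mult_minus_distrib_mat [where nc = n and n = n and nr = n]) (simp_all add: right_mult_one_mat [where nr = n])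
      also have "R (inv (g i)) * R (g i) = 1\<^sub>m n"
        using g_closed [OF i] by (simp add: R_def twisted_map_mult [symmetric] twisted_map_one)
      also have "- (1\<^sub>m n - R (inv (g i))) = R (inv (g i)) - 1\<^sub>m n"
        using carr(1) [of "inv (g i)"] by (intro eq_matI) (auto simp del: carr)
      finally show ?thesis using False by (simp add: x)
    qed
    finally show ?thesis using Cons.prems carr(1) [of ?x] by (simp del: carr)
  qed
  have tail: "(\<Sum>j<k. (R ?x * F j * V j) $$ (a, b)) =
      R (word_eval G g (x # w)) $$ (a, b) - R ?x $$ (a, b)"
  proof -
    have IH: "(\<Sum>j<k. (F j * V j) $$ (e, b)) = R (word_eval G g w) $$ (e, b) - 1\<^sub>m n $$ (e, b)"
      if "e < n" for e
      using Cons.IH [OF w that Cons.prems(3)] by (simp add: F_def V_def R_def)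
    have "(\<Sum>j<k. (R ?x * F j * V j) $$ (a, b)) = (\<Sum>j<k. \<Sum>e<n. R ?x $$ (a, e) * (F j * V j) $$ (e, b))"
    proof (intro sum.cong HOL.refl)
      fix j
      have assoc: "R ?x * F j * V j = R ?x * (F j * V j)"
        by (rule assoc_mult_mat [where ?n\<^sub>1 = n and ?n\<^sub>2 = n and ?n\<^sub>3 = n and ?n\<^sub>4 = n]) simp_all
      have FV: "F j * V j \<in> carrier_mat n n" by (rule mult_carrier_mat [where n = n]) simp_all
      show "(R ?x * F j * V j) $$ (a, b) = (\<Sum>e<n. R ?x $$ (a, e) * (F j * V j) $$ (e, b))"
        by (simp only: assoc index_mult_mat_sum [OF carr(1) FV Cons.prems(2,3)])
    qed
    also have "\<dots> = (\<Sum>e<n. R ?x $$ (a, e) * (\<Sum>j<k. (F j * V j) $$ (e, b)))"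
      by (subst sum.swap) (simp add: sum_distrib_left)
    also have "\<dots> = (\<Sum>e<n. R ?x $$ (a, e) * (R (word_eval G g w) $$ (e, b) - 1\<^sub>m n $$ (e, b)))"
      using IH by (intro sum.cong) auto
    also have "\<dots> = (\<Sum>e<n. R ?x $$ (a, e) * R (word_eval G g w) $$ (e, b)) - (\<Sum>e<n. if e = b then R ?x $$ (a, e) else 0)"
      using Cons.prems by (subst sum_subtractf [symmetric]) (auto intro!: sum.cong simp: algebra_simps)
    also have "(\<Sum>e<n. R ?x $$ (a, e) * R (word_eval G g w) $$ (e, b)) = (R ?x * R (word_eval G g w)) $$ (a, b)"
      using Cons.prems by (simp add: R_def scalar_prod_def atLeast0LessThan)
    also have "R ?x * R (word_eval G g w) = R (word_eval G g (x # w))"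
      using x_closed word_eval_closed [OF w] by (simp add: R_def twisted_map_mult)
    finally show ?thesis using Cons.prems by simp
  qed
  have "fox_block n \<phi> j (x # w) = L j + R ?x * F j" for j
    using twisted_map_letter_mult [OF keys_fox [OF w] i, of c j]
    by (simp add: L_def F_def R_def x to_group_ring_def frag_extend_add twisted_map_add
        del: fox_letter.simps letter_eval.simps)
  then have "(\<Sum>j<k. (fox_block n \<phi> j (x # w) * V j) $$ (a, b)) =
      (\<Sum>j<k. (L j * V j) $$ (a, b)) + (\<Sum>j<k. (R ?x * F j * V j) $$ (a, b))"
  proof (subst sum.distrib [symmetric], intro sum.cong HOL.refl)
    fix j assume *: "\<And>j. fox_block n \<phi> j (x # w) = L j + R ?x * F j"
    have "R ?x * F j \<in> carrier_mat n n" by (rule mult_carrier_mat [where n = n]) simp_all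
    then have "(L j + R ?x * F j) * V j = L j * V j + R ?x * F j * V j"
      by (intro add_mult_distrib_mat [where nr = n and n = n and nc = n]) simp_all
    moreover have "L j * V j \<in> carrier_mat n n" "R ?x * F j * V j \<in> carrier_mat n n"
      by (intro mult_carrier_mat [where n = n] carr)+
    ultimately show "(fox_block n \<phi> j (x # w) * V j) $$ (a, b) = (L j * V j) $$ (a, b) + (R ?x * F j * V j) $$ (a, b)"
      using Cons.prems by (simp only: * index_add_mat carrier_matD)
  qed
  then show ?case by (simp add: letter tail flip: V_def R_def)
qed

end

section \<open>Invariance and multiplicativity of Wada's quotient\<close>

lemma wada_numerator_block_mat:
  "wada_numerator G g rs \<alpha> n \<phi> l =
    det (block_mat (length rs) (length rs) n (\<lambda>i c. fox_block n \<phi> (skip l c) (rs ! i)))"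
  unfolding wada_numerator_def block_mat_def skip_def Let_def by simp

text \<open>Fox's formula at the relators provides the vanishing column that
  \<open>det_block_omit_column\<close> asks for; the even size removes the sign between the two
  minors.\<close>

lemma wada_index_independent:
  assumes "mat_rep n \<phi>" "even n" "l < k" "l' < k"
  shows "wada_numerator G g rs \<alpha> n \<phi> l * wada_denominator G g \<alpha> n \<phi> l' =
    wada_numerator G g rs \<alpha> n \<phi> l' * wada_denominator G g \<alpha> n \<phi> l"
  unfolding wada_numerator_block_mat wada_denominator_def
proof (rule det_block_omit_column [where M = "\<lambda>i j. fox_block n \<phi> j (rs ! i)"
      and V = "\<lambda>j. twisted_map \<alpha> n \<phi> (frag_of (g j) - frag_of \<one>)"])
  fix i a b assume i: "i < length rs" and ab: "a < n" "b < n"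
  have "rs ! i \<in> set rs" using i by simp
  then show "(\<Sum>j\<le>length rs. (fox_block n \<phi> j (rs ! i) *
      twisted_map \<alpha> n \<phi> (frag_of (g j) - frag_of \<one>)) $$ (a, b)) = 0"
    using fox_fundamental [OF assms(1) rs_words ab, of "rs ! i"]
    by (simp add: word_eval_relator twisted_map_one [OF assms(1)] k_eq lessThan_Suc_atMost del: index_one_mat)
qed (use assms in \<open>auto simp: k_eq\<close>)

text \<open>The index picked by \<open>SOME\<close> in the definition is inaccessible; the
  cross-multiplied independence trades it for any index with nonzero denominator.\<close>

lemma twisted_alexander_eq:
  assumes "mat_rep n \<phi>" "even n" "l < k" "wada_denominator G g \<alpha> n \<phi> l \<noteq> 0"
  shows "twisted_alexander G k g rs \<alpha> n \<phi> =
    wada_numerator G g rs \<alpha> n \<phi> l / wada_denominator G g \<alpha> n \<phi> l"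
proof -
  define m where "m = (SOME l. l < k \<and> wada_denominator G g \<alpha> n \<phi> l \<noteq> 0)"
  have "m < k \<and> wada_denominator G g \<alpha> n \<phi> m \<noteq> 0"
    unfolding m_def by (rule someI [of _ l]) (use assms in simp)
  then show ?thesis
    using wada_index_independent [OF assms(1,2), of m l] assms
    by (simp add: twisted_alexander_def m_def [symmetric] frac_eq_eq)
qed

lemma keys_fox_block: "i < length rs \<Longrightarrow> Poly_Mapping.keys (to_group_ring G g (fox j (rs ! i))) \<subseteq> carrier G"
  by (intro keys_to_group_ring keys_fox rs_words) simp

lemma keys_denominator: "l < k \<Longrightarrow> Poly_Mapping.keys (frag_of (g l) - frag_of \<one>) \<subseteq> carrier G"
  using keys_diff [of "frag_of (g l)" "frag_of \<one>"] g_closed by (auto simp: keys_frag_of)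

lemma wada_intertwine:
  assumes ST: "S \<in> carrier_mat n n" "T \<in> carrier_mat n n" "S * T = 1\<^sub>m n"
    and \<phi>: "\<And>\<gamma>. \<gamma> \<in> carrier G \<Longrightarrow> \<phi> \<gamma> \<in> carrier_mat n n"
    and \<phi>': "\<And>\<gamma>. \<gamma> \<in> carrier G \<Longrightarrow> \<phi>' \<gamma> \<in> carrier_mat n n"
    and eq: "\<And>\<gamma>. \<gamma> \<in> carrier G \<Longrightarrow> \<phi> \<gamma> * S = S * \<phi>' \<gamma>"
  shows "wada_numerator G g rs \<alpha> n \<phi> l = wada_numerator G g rs \<alpha> n \<phi>' l"
    and "l < k \<Longrightarrow> wada_denominator G g \<alpha> n \<phi> l = wada_denominator G g \<alpha> n \<phi>' l"
proof -
  let ?S = "map_mat const_fract S" and ?T = "map_mat const_fract T"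
  have ST': "?S \<in> carrier_mat n n" "?T \<in> carrier_mat n n" "?S * ?T = 1\<^sub>m n"
    using ST by (auto simp: map_const_fract_mult [symmetric] map_const_fract_one)
  have tw: "twisted_map \<alpha> n \<phi> x * ?S = ?S * twisted_map \<alpha> n \<phi>' x"
    if "Poly_Mapping.keys x \<subseteq> carrier G" for x
    using that ST by (intro twisted_map_intertwine) (auto intro: \<phi> \<phi>' eq)
  show "wada_numerator G g rs \<alpha> n \<phi> l = wada_numerator G g rs \<alpha> n \<phi>' l"
    unfolding wada_numerator_block_mat
    by (rule det_block_intertwine [OF ST']) (auto intro!: tw keys_fox_block)
  assume "l < k"
  then have "det (twisted_map \<alpha> n \<phi> (frag_of (g l) - frag_of \<one>) * ?S) =
      det (?S * twisted_map \<alpha> n \<phi>' (frag_of (g l) - frag_of \<one>))"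
    using tw keys_denominator by simp
  then have comm: "det (twisted_map \<alpha> n \<phi> (frag_of (g l) - frag_of \<one>)) * det ?S =
      det ?S * det (twisted_map \<alpha> n \<phi>' (frag_of (g l) - frag_of \<one>))"
    by (simp add: det_mult [OF twisted_map_carrier ST'(1)] det_mult [OF ST'(1) twisted_map_carrier])
  have inv: "det ?S * det ?T = 1"
    using ST' by (metis det_mult det_one)
  show "wada_denominator G g \<alpha> n \<phi> l = wada_denominator G g \<alpha> n \<phi>' l"
    unfolding wada_denominator_def by (rule mult_inverse_cancel [OF inv comm])
qed

lemma twisted_alexander_conjugate:
  assumes "mat_rep n \<phi>" "mat_rep n \<phi>'" "even n" "l < k" "wada_denominator G g \<alpha> n \<phi> l \<noteq> 0"
    and "S \<in> carrier_mat n n" "T \<in> carrier_mat n n" "S * T = 1\<^sub>m n"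
    and "\<And>\<gamma>. \<gamma> \<in> carrier G \<Longrightarrow> \<phi> \<gamma> * S = S * \<phi>' \<gamma>"
  shows "twisted_alexander G k g rs \<alpha> n \<phi> = twisted_alexander G k g rs \<alpha> n \<phi>'"
proof -
  have c: "\<phi> \<gamma> \<in> carrier_mat n n" "\<phi>' \<gamma> \<in> carrier_mat n n" if "\<gamma> \<in> carrier G" for \<gamma>
    using assms(1,2) that by (auto simp: mat_rep_def)
  note eq = wada_intertwine [OF assms(6-8) c assms(9), where l = l]
  show ?thesis
    using assms(4,5) eq by (simp add: twisted_alexander_eq [OF assms(1,3,4)] twisted_alexander_eq [OF assms(2,3,4)])
qed

text \<open>Numerator and denominator split separately at one fixed index; the quotient can then be
  formed once the denominators of all factors at this index are known to be nonzero.\<close>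

lemma wada_direct_sum:
  assumes \<theta>: "\<And>m \<gamma>. m < N \<Longrightarrow> \<gamma> \<in> carrier G \<Longrightarrow> \<theta> m \<gamma> \<in> carrier_mat n n"
  shows "wada_numerator G g rs \<alpha> (n * N) (direct_sum \<theta> n N) l = (\<Prod>m<N. wada_numerator G g rs \<alpha> n (\<theta> m) l)"
    and "l < k \<Longrightarrow> wada_denominator G g \<alpha> (n * N) (direct_sum \<theta> n N) l = (\<Prod>m<N. wada_denominator G g \<alpha> n (\<theta> m) l)"
proof -
  have tw: "twisted_map \<alpha> (n * Suc M) (direct_sum \<theta> n (Suc M)) x =
      four_block_mat (twisted_map \<alpha> (n * M) (direct_sum \<theta> n M) x) (0\<^sub>m (n * M) n) (0\<^sub>m n (n * M))
        (twisted_map \<alpha> n (\<theta> M) x)"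
    if "Poly_Mapping.keys x \<subseteq> carrier G" "M < N" for x M
  proof -
    have "n * Suc M = n * M + n" by simp
    then show ?thesis
      unfolding direct_sum.simps using that
      by (simp only:, intro twisted_map_direct_sum) (auto intro!: direct_sum_carrier \<theta>)
  qed
  have "wada_numerator G g rs \<alpha> (n * M) (direct_sum \<theta> n M) l = (\<Prod>m<M. wada_numerator G g rs \<alpha> n (\<theta> m) l)"
    if "M \<le> N" for M
    using that
  proof (induction M)
    case 0
    then show ?case by (simp add: wada_numerator_block_mat block_mat_def)
  next
    case (Suc M)
    let ?r = "length rs"
    have nM: "n * Suc M = n * M + n" by simp
    have "block_mat ?r ?r (n * M + n) (\<lambda>i c. fox_block (n * M + n) (direct_sum \<theta> n (Suc M)) (skip l c) (rs ! i)) =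
        block_mat ?r ?r (n * M + n) (\<lambda>i c. four_block_mat
          (fox_block (n * M) (direct_sum \<theta> n M) (skip l c) (rs ! i)) (0\<^sub>m (n * M) n) (0\<^sub>m n (n * M))
          (fox_block n (\<theta> M) (skip l c) (rs ! i)))"
    proof (rule block_mat_cong)
      fix i c a b assume "i < ?r"
      then show "fox_block (n * M + n) (direct_sum \<theta> n (Suc M)) (skip l c) (rs ! i) $$ (a, b) =
          four_block_mat (fox_block (n * M) (direct_sum \<theta> n M) (skip l c) (rs ! i))
            (0\<^sub>m (n * M) n) (0\<^sub>m n (n * M)) (fox_block n (\<theta> M) (skip l c) (rs ! i)) $$ (a, b)"
        using tw [OF keys_fox_block, of i M "skip l c"] Suc.prems by (simp only: nM Suc_le_eq)
    qed
    then have "wada_numerator G g rs \<alpha> (n * Suc M) (direct_sum \<theta> n (Suc M)) l =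
        det (block_mat ?r ?r (n * M) (\<lambda>i c. fox_block (n * M) (direct_sum \<theta> n M) (skip l c) (rs ! i))) *
        det (block_mat ?r ?r n (\<lambda>i c. fox_block n (\<theta> M) (skip l c) (rs ! i)))"
      unfolding wada_numerator_block_mat nM by (simp only: det_block_direct_sum twisted_map_carrier)
    then show ?case using Suc by (simp add: wada_numerator_block_mat)
  qed
  then show "wada_numerator G g rs \<alpha> (n * N) (direct_sum \<theta> n N) l = (\<Prod>m<N. wada_numerator G g rs \<alpha> n (\<theta> m) l)"
    by simp
  assume l: "l < k"
  have "wada_denominator G g \<alpha> (n * M) (direct_sum \<theta> n M) l = (\<Prod>m<M. wada_denominator G g \<alpha> n (\<theta> m) l)"
    if "M \<le> N" for M
    using that
  proof (induction M)
    case 0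
    then show ?case by (simp add: wada_denominator_def)
  next
    case (Suc M)
    then show ?case
      using tw [OF keys_denominator [OF l], of M]
      by (simp add: wada_denominator_def det_four_block_mat_upper_right_zero [where n = "n * M" and m = n]
          del: direct_sum.simps mult_Suc_right)
  qed
  then show "wada_denominator G g \<alpha> (n * N) (direct_sum \<theta> n N) l = (\<Prod>m<N. wada_denominator G g \<alpha> n (\<theta> m) l)"
    by simp
qed

text \<open>With e the exponent of the generator and A its matrix, the determinant is t^(2e) - tr(A)
  t^e + 1. For e > 0 this is a polynomial with value 1 at 0; a negative e reduces to that case
  because the expression is palindromic.\<close>

lemma wada_denominator_SL2_neq_0:
  assumes "l < k" "\<alpha> (g l) \<noteq> 0" "\<phi> (g l) \<in> carrier_mat 2 2" "\<phi> \<one> = 1\<^sub>m 2" "det (\<phi> (g l)) = 1"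
  shows "wada_denominator G g \<alpha> 2 \<phi> l \<noteq> 0"
proof -
  define A where "A = \<phi> (g l)"
  define t where "t = rat_t powi \<alpha> (g l)"
  define s where "s = rat_t ^ nat \<bar>\<alpha> (g l)\<bar>"
  define c where "c = A $$ (0, 0) + A $$ (1, 1)"
  have entry: "twisted_map \<alpha> 2 \<phi> (frag_of (g l) - frag_of \<one>) $$ (a, b) =
      t * const_fract (A $$ (a, b)) - (if a = b then 1 else 0)" if "a < 2" "b < 2" for a b
    using that assms by (simp add: twisted_map_diff index_twisted_map_frag_of \<alpha>_one A_def t_def)
  have "const_fract (A $$ (0, 0) * A $$ (1, 1) - A $$ (0, 1) * A $$ (1, 0)) = 1"
    using assms det_mat2 [of A] by (simp add: A_def)
  then have det1: "const_fract (A $$ (0, 0)) * const_fract (A $$ (1, 1))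
      - const_fract (A $$ (0, 1)) * const_fract (A $$ (1, 0)) = 1"
    by (simp only: const_fract_diff const_fract_mult)
  have "wada_denominator G g \<alpha> 2 \<phi> l = t\<^sup>2 - const_fract c * t + 1"
  proof -
    have "wada_denominator G g \<alpha> 2 \<phi> l =
        (t * const_fract (A $$ (0, 0)) - 1) * (t * const_fract (A $$ (1, 1)) - 1) -
        t * const_fract (A $$ (0, 1)) * (t * const_fract (A $$ (1, 0)))"
      unfolding wada_denominator_def by (subst det_mat2) (simp_all add: entry)
    also have "\<dots> = t\<^sup>2 * (const_fract (A $$ (0, 0)) * const_fract (A $$ (1, 1))
        - const_fract (A $$ (0, 1)) * const_fract (A $$ (1, 0))) - const_fract c * t + 1"
      by (simp add: c_def const_fract_add algebra_simps power2_eq_square)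
    finally show ?thesis by (simp only: det1 mult_1_right)
  qed
  moreover have "s\<^sup>2 - const_fract c * s + 1 \<noteq> 0"
  proof -
    define e where "e = nat \<bar>\<alpha> (g l)\<bar>"
    have e: "e > 0" using assms by (simp add: e_def)
    have "s\<^sup>2 - const_fract c * s + 1 = to_fract ([:0, 1:] ^ (2 * e) - [:c:] * [:0, 1:] ^ e + 1)"
      by (simp only: s_def e_def rat_t_def const_fract_def to_fract_add to_fract_diff to_fract_mult
          to_fract_power to_fract_1 power_mult [symmetric] mult.commute [of 2])
    moreover have "poly ([:0, 1:] ^ (2 * e) - [:c:] * [:0, 1:] ^ e + 1) 0 = 1"
      using e by (simp add: poly_power zero_power)
    then have "[:0, 1:] ^ (2 * e) - [:c:] * [:0, 1:] ^ e + 1 \<noteq> 0"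
      by (metis poly_0 zero_neq_one)
    ultimately show ?thesis by (simp only: to_fract_eq_0_iff not_False_eq_True)
  qed
  moreover have "t = s \<or> t = inverse s"
    by (auto simp: t_def s_def power_int_def power_inverse)
  moreover have "s \<noteq> 0" by (simp add: s_def)
  then have "i\<^sup>2 - const_fract c * i + 1 = i\<^sup>2 * (s\<^sup>2 - const_fract c * s + 1)" if "i = inverse s" for i
  proof -
    have "i\<^sup>2 * (s\<^sup>2 - const_fract c * s + 1) = (i * s)\<^sup>2 - const_fract c * i * (i * s) + i\<^sup>2"
      by (simp add: algebra_simps power2_eq_square)
    also have "i * s = 1" using that \<open>s \<noteq> 0\<close> by simp
    finally show ?thesis by simp
  qed
  ultimately show ?thesis using \<open>s \<noteq> 0\<close> by auto
qed

end

section \<open>Symmetric powers of monomial matrices\<close>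

lemma group_SL: "group (SL n)"
proof (rule groupI)
  fix A assume "A \<in> carrier (SL n)"
  then have A: "A \<in> carrier_mat n n" "det A = 1" by (auto simp: SL_def)
  note adj = adj_mat [OF A(1)]
  have "adj_mat A * A = 1\<^sub>m n"
    unfolding adj(3) A(2) by (intro eq_matI) auto
  then have "det (adj_mat A) * det A = 1"
    by (metis adj(1) A(1) det_mult det_one)
  then show "\<exists>B\<in>carrier (SL n). B \<otimes>\<^bsub>SL n\<^esub> A = \<one>\<^bsub>SL n\<^esub>"
    using adj A by (intro bexI [of _ "adj_mat A"]) (auto simp: SL_def)
qed (auto simp: SL_def det_mult)

lemma SL_simps:
  "A \<in> carrier (SL n) \<longleftrightarrow> A \<in> carrier_mat n n \<and> det A = 1"
  "A \<otimes>\<^bsub>SL n\<^esub> B = A * B"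
  "\<one>\<^bsub>SL n\<^esub> = 1\<^sub>m n"
  by (auto simp: SL_def)

definition mat2 :: "'a \<Rightarrow> 'a \<Rightarrow> 'a \<Rightarrow> 'a \<Rightarrow> 'a mat" where
  "mat2 a b c d = mat 2 2 (\<lambda>(i, j). if i = 0 then (if j = 0 then a else b) else (if j = 0 then c else d))"

lemma mat2_carrier [simp]: "mat2 a b c d \<in> carrier_mat 2 2"
  and dim_row_mat2 [simp]: "dim_row (mat2 a b c d) = 2"
  and dim_col_mat2 [simp]: "dim_col (mat2 a b c d) = 2"
  and index_mat2 [simp]: "mat2 a b c d $$ (0, 0) = a" "mat2 a b c d $$ (0, 1) = b"
    "mat2 a b c d $$ (1, 0) = c" "mat2 a b c d $$ (1, 1) = d"
    "mat2 a b c d $$ (0, Suc 0) = b" "mat2 a b c d $$ (Suc 0, 0) = c" "mat2 a b c d $$ (Suc 0, Suc 0) = d"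
  by (simp_all add: mat2_def)

lemma mat2_eqI:
  assumes "A \<in> carrier_mat 2 2" "B \<in> carrier_mat 2 2"
    and "A $$ (0, 0) = B $$ (0, 0)" "A $$ (0, 1) = B $$ (0, 1)"
    and "A $$ (1, 0) = B $$ (1, 0)" "A $$ (1, 1) = B $$ (1, 1)"
  shows "A = B"
  using assms by (intro eq_matI) (auto simp: less_2_cases_iff)

lemma mat2_exhaust:
  assumes "A \<in> carrier_mat 2 2"
  shows "\<exists>a b c d. A = mat2 a b c d"
  using assms by (metis mat2_eqI mat2_carrier index_mat2(1-4))

lemma mat2_eq_iff: "mat2 a b c d = mat2 a' b' c' d' \<longleftrightarrow> a = a' \<and> b = b' \<and> c = c' \<and> d = d'"
  by (metis index_mat2(1-4))

lemma mat2_mult: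
  fixes a :: "'a :: semiring_0"
  shows "mat2 a b c d * mat2 a' b' c' d' = mat2 (a * a' + b * c') (a * b' + b * d') (c * a' + d * c') (c * b' + d * d')"
  by (rule mat2_eqI) (auto simp: scalar_prod_def numeral_2_eq_2)

lemma det_mat2_eq: "det (mat2 a b c d) = a * d - b * c"
  for a :: "'a :: comm_ring_1"
  by (simp add: det_mat2)

lemma one_mat2: "1\<^sub>m 2 = mat2 1 0 0 (1 :: 'a :: semiring_1)"
  by (rule mat2_eqI) auto

lemma inv_SL2: "det (mat2 a b c d) = 1 \<Longrightarrow> inv\<^bsub>SL 2\<^esub> (mat2 a b c d) = mat2 d (- b) (- c) a"
  by (rule group.inv_equality [OF group_SL]) (auto simp: SL_simps mat2_mult one_mat2 mat2_eq_iff det_mat2_eq algebra_simps)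

section \<open>Binary forms and their values\<close>

definition eval_xy :: "complex \<Rightarrow> complex \<Rightarrow> complex poly poly \<Rightarrow> complex" where
  "eval_xy x y p = poly (poly p [:y:]) x"

lemma eval_xy_simps [simp]:
  "eval_xy x y (p + q) = eval_xy x y p + eval_xy x y q"
  "eval_xy x y (p * q) = eval_xy x y p * eval_xy x y q"
  "eval_xy x y (p ^ n) = eval_xy x y p ^ n"
  "eval_xy x y (const_xy c) = c"
  "eval_xy x y var_x = x"
  "eval_xy x y var_y = y"
  by (simp_all add: eval_xy_def const_xy_def var_x_def var_y_def)

lemma eval_xy_sum [simp]: "eval_xy x y (sum f A) = (\<Sum>i\<in>A. eval_xy x y (f i))"
  by (simp add: eval_xy_def poly_sum)

lemma eval_xy_altdef:
  "eval_xy x y p = (\<Sum>b\<le>degree p. \<Sum>a\<le>degree (coeff p b). coeff_xy p a b * x ^ a * y ^ b)"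
proof -
  have "eval_xy x y p = (\<Sum>b\<le>degree p. poly (coeff p b) x * y ^ b)"
    by (simp add: eval_xy_def poly_altdef [of p] poly_sum)
  also have "\<dots> = (\<Sum>b\<le>degree p. \<Sum>a\<le>degree (coeff p b). coeff_xy p a b * x ^ a * y ^ b)"
    by (simp add: poly_altdef coeff_xy_def sum_distrib_right)
  finally show ?thesis .
qed

text \<open>Evaluation turns substitution into composition, so images of forms are compared through
  their values; \<open>binary_form_coeffs_unique\<close> recovers the coefficients at the
  end.\<close>

lemma eval_xy_subst_xy: "eval_xy x y (subst_xy p u v) = eval_xy (eval_xy x y u) (eval_xy x y v) p"
  by (simp add: subst_xy_def eval_xy_altdef [of _ _ p])

definition homogeneous :: "nat \<Rightarrow> complex poly poly \<Rightarrow> bool" where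
  "homogeneous d p \<longleftrightarrow> (\<forall>a b. a + b \<noteq> d \<longrightarrow> coeff_xy p a b = 0)"

lemma homogeneous_0 [simp]: "homogeneous d 0"
  by (simp add: homogeneous_def coeff_xy_def)

lemma homogeneous_add: "homogeneous d p \<Longrightarrow> homogeneous d q \<Longrightarrow> homogeneous d (p + q)"
  by (simp add: homogeneous_def coeff_xy_def)

lemma homogeneous_sum: "(\<And>i. i \<in> A \<Longrightarrow> homogeneous d (f i)) \<Longrightarrow> homogeneous d (sum f A)"
  by (induction A rule: infinite_finite_induct) (auto intro: homogeneous_add)

lemma homogeneous_mult:
  assumes "homogeneous d p" "homogeneous e q"
  shows "homogeneous (d + e) (p * q)"
  unfolding homogeneous_def
proof (intro allI impI)
  fix a b assume ab: "a + b \<noteq> d + e"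
  have "coeff_xy (p * q) a b = (\<Sum>i\<le>b. \<Sum>j\<le>a. coeff_xy p j i * coeff_xy q (a - j) (b - i))"
    by (simp add: coeff_xy_def coeff_mult coeff_sum)
  also have "\<dots> = 0"
  proof (intro sum.neutral ballI)
    fix i j assume "i \<in> {..b}" "j \<in> {..a}"
    then have "j + i \<noteq> d \<or> (a - j) + (b - i) \<noteq> e" using ab by auto
    then show "coeff_xy p j i * coeff_xy q (a - j) (b - i) = 0"
      using assms by (auto simp: homogeneous_def)
  qed
  finally show "coeff_xy (p * q) a b = 0" .
qed

lemma homogeneous_const: "homogeneous 0 (const_xy c)"
  by (auto simp: homogeneous_def coeff_xy_def const_xy_def coeff_pCons split: nat.splits)

lemma homogeneous_var: "homogeneous 1 var_x" "homogeneous 1 var_y"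
  by (auto simp: homogeneous_def coeff_xy_def var_x_def var_y_def coeff_pCons split: nat.splits)

lemma homogeneous_power: "homogeneous d p \<Longrightarrow> homogeneous (d * n) (p ^ n)"
proof (induction n)
  case 0
  have "(1 :: complex poly poly) = const_xy 1" by (simp add: const_xy_def one_pCons)
  then show ?case using homogeneous_const [of 1] by simp
next
  case (Suc n)
  then show ?case using homogeneous_mult [of d p "d * n" "p ^ n"] by simp
qed

lemma homogeneous_subst_xy:
  assumes "homogeneous d p" "homogeneous 1 u" "homogeneous 1 v"
  shows "homogeneous d (subst_xy p u v)"
  unfolding subst_xy_def
proof (intro homogeneous_sum)
  fix a b
  show "homogeneous d (const_xy (coeff_xy p a b) * u ^ a * v ^ b)"
  proof (cases "a + b = d")
    case True
    have "homogeneous (0 + 1 * a + 1 * b) (const_xy (coeff_xy p a b) * u ^ a * v ^ b)"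
      using assms by (intro homogeneous_mult homogeneous_power homogeneous_const)
    then show ?thesis using True by simp
  next
    case False
    then have "coeff_xy p a b = 0" using assms by (simp add: homogeneous_def)
    then show ?thesis by (simp add: const_xy_def)
  qed
qed

lemma eval_xy_homogeneous:
  assumes "homogeneous d p"
  shows "eval_xy x y p = (\<Sum>i\<le>d. coeff_xy p (d - i) i * x ^ (d - i) * y ^ i)"
proof -
  have coeff: "coeff p b = (if b \<le> d then monom (coeff_xy p (d - b) b) (d - b) else 0)" for b
    using assms by (intro poly_eqI) (auto simp: homogeneous_def coeff_xy_def)
  have "degree p \<le> d" using coeff by (intro degree_le) auto
  have "eval_xy x y p = (\<Sum>b\<le>degree p. poly (coeff p b) x * y ^ b)"
    by (simp add: eval_xy_def poly_altdef [of p] poly_sum)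
  also have "\<dots> = (\<Sum>b\<le>d. poly (coeff p b) x * y ^ b)"
    using \<open>degree p \<le> d\<close> by (intro sum.mono_neutral_left) (auto simp: coeff_eq_0)
  also have "\<dots> = (\<Sum>i\<le>d. coeff_xy p (d - i) i * x ^ (d - i) * y ^ i)"
    by (intro sum.cong) (auto simp: coeff poly_monom simp del: coeff_xy_def)
  finally show ?thesis .
qed

section \<open>Symmetric powers as matrices\<close>

lemma sym_power_carrier [simp]: "sym_power n A \<in> carrier_mat n n"
  and dim_row_sym_power [simp]: "dim_row (sym_power n A) = n"
  and dim_col_sym_power [simp]: "dim_col (sym_power n A) = n"
  by (simp_all add: sym_power_def)

text \<open>Column j is read as the form whose coefficients it lists, the image of x^(n-1-j) y^j.
  Homogeneity of this image guarantees that the n entries exhaust its coefficients.\<close>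

lemma sym_power_eval:
  assumes "inv\<^bsub>SL 2\<^esub> A = mat2 a b c d" "j < n"
  shows "(\<Sum>i<n. sym_power n A $$ (i, j) * x ^ (n - 1 - i) * y ^ i) =
    (a * x + b * y) ^ (n - 1 - j) * (c * x + d * y) ^ j"
proof -
  let ?p = "SL2_action A (var_x ^ (n - 1 - j) * var_y ^ j)"
  have "homogeneous (1 * (n - 1 - j) + 1 * j) (var_x ^ (n - 1 - j) * var_y ^ j)"
    by (intro homogeneous_mult homogeneous_power homogeneous_var)
  then have mono: "homogeneous (n - 1) (var_x ^ (n - 1 - j) * var_y ^ j)"
    using assms(2) by simp
  have lin: "homogeneous 1 (const_xy e * var_x + const_xy f * var_y)" for e f
    using homogeneous_mult [OF homogeneous_const homogeneous_var(1)]
      homogeneous_mult [OF homogeneous_const homogeneous_var(2)]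
    by (auto intro: homogeneous_add)
  have hom: "homogeneous (n - 1) ?p"
    unfolding SL2_action_def Let_def by (intro homogeneous_subst_xy mono lin)
  have "(\<Sum>i<n. sym_power n A $$ (i, j) * x ^ (n - 1 - i) * y ^ i) =
      (\<Sum>i\<le>n - 1. coeff_xy ?p (n - 1 - i) i * x ^ (n - 1 - i) * y ^ i)"
    using assms(2) by (intro sum.cong) (auto simp: sym_power_def)
  also have "\<dots> = eval_xy x y ?p" by (rule eval_xy_homogeneous [OF hom, symmetric])
  also have "\<dots> = (a * x + b * y) ^ (n - 1 - j) * (c * x + d * y) ^ j"
    unfolding SL2_action_def Let_def eval_xy_subst_xy assms(1) by simp
  finally show ?thesis .
qed

text \<open>At x = 1 a form becomes a polynomial in y with the same coefficients.\<close>

lemma binary_form_coeffs_unique: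
  fixes f g :: "nat \<Rightarrow> complex"
  assumes "\<And>x y. (\<Sum>i<n. f i * x ^ (n - 1 - i) * y ^ i) = (\<Sum>i<n. g i * x ^ (n - 1 - i) * y ^ i)"
    and "i < n"
  shows "f i = g i"
proof -
  have "poly (\<Sum>i<n. monom (f i) i) = poly (\<Sum>i<n. monom (g i) i)"
    using assms(1) [of 1] by (auto simp: poly_sum poly_monom)
  then have "coeff (\<Sum>i<n. monom (f i) i) i = coeff (\<Sum>i<n. monom (g i) i) i"
    by (simp add: poly_eq_poly_eq_iff)
  then show ?thesis using assms(2) by (simp add: coeff_sum)
qed

lemma sym_power_eqI:
  assumes "inv\<^bsub>SL 2\<^esub> A = mat2 a b c d" "M \<in> carrier_mat n n"
    and "\<And>j x y. j < n \<Longrightarrow> (\<Sum>i<n. M $$ (i, j) * x ^ (n - 1 - i) * y ^ i) =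
      (a * x + b * y) ^ (n - 1 - j) * (c * x + d * y) ^ j"
  shows "sym_power n A = M"
proof (rule eq_matI)
  fix i j assume "i < dim_row M" "j < dim_col M"
  then have ij: "i < n" "j < n" using assms(2) by auto
  show "sym_power n A $$ (i, j) = M $$ (i, j)"
    by (rule binary_form_coeffs_unique [where n = n])
      (simp_all only: sym_power_eval [OF assms(1) ij(2)] assms(3) [OF ij(2)] ij)
qed (use assms(2) in auto)

text \<open>The column forms compose by substitution in reverse order, and the inverse in the action
  reverses the order once more.\<close>

lemma sym_power_mult:
  assumes "A \<in> carrier (SL 2)" "B \<in> carrier (SL 2)"
  shows "sym_power n (A * B) = sym_power n A * sym_power n B"
proof -
  interpret SL2: group "SL 2" by (rule group_SL)
  obtain a b c d where A: "inv\<^bsub>SL 2\<^esub> A = mat2 a b c d"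
    by (metis mat2_exhaust SL2.inv_closed [OF assms(1)] SL_simps(1))
  obtain a' b' c' d' where B: "inv\<^bsub>SL 2\<^esub> B = mat2 a' b' c' d'"
    by (metis mat2_exhaust SL2.inv_closed [OF assms(2)] SL_simps(1))
  have AB: "inv\<^bsub>SL 2\<^esub> (A * B) = mat2 (a' * a + b' * c) (a' * b + b' * d) (c' * a + d' * c) (c' * b + d' * d)"
    using SL2.inv_mult_group [OF assms] by (simp add: A B SL_simps mat2_mult)
  show ?thesis
  proof (rule sym_power_eqI [OF AB])
    fix j x y assume j: "j < n"
    let ?u = "a * x + b * y" and ?v = "c * x + d * y"
    have "(\<Sum>i<n. (sym_power n A * sym_power n B) $$ (i, j) * x ^ (n - 1 - i) * y ^ i) =
        (\<Sum>i<n. \<Sum>l<n. sym_power n B $$ (l, j) * (sym_power n A $$ (i, l) * x ^ (n - 1 - i) * y ^ i))"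
    proof (intro sum.cong HOL.refl)
      fix i assume "i \<in> {..<n}"
      then show "(sym_power n A * sym_power n B) $$ (i, j) * x ^ (n - 1 - i) * y ^ i =
          (\<Sum>l<n. sym_power n B $$ (l, j) * (sym_power n A $$ (i, l) * x ^ (n - 1 - i) * y ^ i))"
        using j by (subst index_mult_mat_sum [OF sym_power_carrier sym_power_carrier])
          (auto simp: sum_distrib_left sum_distrib_right ac_simps)
    qed
    also have "\<dots> = (\<Sum>l<n. sym_power n B $$ (l, j) * (\<Sum>i<n. sym_power n A $$ (i, l) * x ^ (n - 1 - i) * y ^ i))"
      by (subst sum.swap) (simp add: sum_distrib_left)
    also have "\<dots> = (\<Sum>l<n. sym_power n B $$ (l, j) * ?u ^ (n - 1 - l) * ?v ^ l)"
      by (intro sum.cong HOL.refl) (subst sym_power_eval [OF A]; simp)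
    also have "\<dots> = (a' * ?u + b' * ?v) ^ (n - 1 - j) * (c' * ?u + d' * ?v) ^ j"
      by (rule sym_power_eval [OF B j])
    finally show "(\<Sum>i<n. (sym_power n A * sym_power n B) $$ (i, j) * x ^ (n - 1 - i) * y ^ i) =
        ((a' * a + b' * c) * x + (a' * b + b' * d) * y) ^ (n - 1 - j) *
        ((c' * a + d' * c) * x + (c' * b + d' * d) * y) ^ j"
      by (simp add: algebra_simps)
  qed (auto intro: mult_carrier_mat)
qed

abbreviation diag_SL2 :: "complex \<Rightarrow> complex mat" where
  "diag_SL2 a \<equiv> mat2 a 0 0 (inverse a)"

abbreviation antidiag_SL2 :: "complex \<Rightarrow> complex mat" where
  "antidiag_SL2 a \<equiv> mat2 0 a (- inverse a) 0"

lemma sum_single_nat: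
  "k < n \<Longrightarrow> (\<Sum>i<n. (if i = k then c else 0) * f i) = c * f k" for c :: "'a :: semiring_0" and k n :: nat
  by (simp add: if_distrib [of "\<lambda>x. x * _"] cong: if_cong)

lemma sym_power_diag:
  assumes "a \<noteq> 0"
  shows "sym_power n (diag_SL2 a) = mat n n (\<lambda>(i, j). if i = j then a ^ j * inverse a ^ (n - 1 - j) else 0)"
    (is "_ = ?M")
proof (rule sym_power_eqI)
  show "inv\<^bsub>SL 2\<^esub> (diag_SL2 a) = mat2 (inverse a) (- 0) (- 0) a"
    using assms by (intro inv_SL2) (simp add: det_mat2_eq)
  fix j x y assume j: "j < n"
  have "(\<Sum>i<n. ?M $$ (i, j) * x ^ (n - 1 - i) * y ^ i) =
      (\<Sum>i<n. (if i = j then a ^ j * inverse a ^ (n - 1 - j) else 0) * (x ^ (n - 1 - i) * y ^ i))"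
    using j by (intro sum.cong) auto
  also have "\<dots> = a ^ j * inverse a ^ (n - 1 - j) * (x ^ (n - 1 - j) * y ^ j)"
    by (rule sum_single_nat [OF j])
  finally show "(\<Sum>i<n. ?M $$ (i, j) * x ^ (n - 1 - i) * y ^ i) =
      (inverse a * x + - 0 * y) ^ (n - 1 - j) * (- 0 * x + a * y) ^ j"
    by (simp add: power_mult_distrib)
qed simp

lemma sym_power_antidiag:
  assumes "a \<noteq> 0"
  shows "sym_power n (antidiag_SL2 a) =
    mat n n (\<lambda>(i, j). if i = n - 1 - j then (- a) ^ (n - 1 - j) * inverse a ^ j else 0)" (is "_ = ?M")
proof (rule sym_power_eqI)
  show "inv\<^bsub>SL 2\<^esub> (antidiag_SL2 a) = mat2 0 (- a) (- (- inverse a)) 0"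
    using assms by (intro inv_SL2) (simp add: det_mat2_eq)
  fix j x y assume j: "j < n"
  have "(\<Sum>i<n. ?M $$ (i, j) * x ^ (n - 1 - i) * y ^ i) =
      (\<Sum>i<n. (if i = n - 1 - j then (- a) ^ (n - 1 - j) * inverse a ^ j else 0) * (x ^ (n - 1 - i) * y ^ i))"
    using j by (intro sum.cong) auto
  also have "\<dots> = (- a) ^ (n - 1 - j) * inverse a ^ j * (x ^ (n - 1 - (n - 1 - j)) * y ^ (n - 1 - j))"
    using j by (intro sum_single_nat) auto
  also have "n - 1 - (n - 1 - j) = j" using j by simp
  finally show "(\<Sum>i<n. ?M $$ (i, j) * x ^ (n - 1 - i) * y ^ i) =
      (0 * x + - a * y) ^ (n - 1 - j) * (- (- inverse a) * x + 0 * y) ^ j"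
    by (simp add: power_minus [of "a * y"] power_minus [of a] power_mult_distrib)
qed simp

lemma sym_power_one: "sym_power n (1\<^sub>m 2) = 1\<^sub>m n"
proof -
  have "sym_power n (diag_SL2 1) = 1\<^sub>m n"
    by (subst sym_power_diag) (auto intro!: eq_matI)
  then show ?thesis by (simp add: one_mat2)
qed

text \<open>
  For a monomial matrix the coordinates \<open>x\<^bsup>N-1-m\<^esup>y\<^bsup>N+m\<^esup>\<close> and \<open>x\<^bsup>N+m\<^esup>y\<^bsup>N-1-m\<^esup>\<close> span an invariant plane, on which
  it acts, after a change of sign, by the matrix of \<open>(2m+1)\<close>-th powers of its entries.
\<close>

definition pairing_index :: "nat \<Rightarrow> nat \<Rightarrow> nat" where
  "pairing_index N i = (if N \<le> i then 2 * (i - N) else 2 * (N - 1 - i) + 1)"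

text \<open>At i = N - 1 - m the sign is (-1)^(N - m). It cancels the sign of (-a)^(N + m), which
  occurs where an antidiagonal matrix exchanges the two monomials of a pair.\<close>

definition pairing_sign :: "nat \<Rightarrow> nat \<Rightarrow> complex" where
  "pairing_sign N i = (if N \<le> i then 1 else (- 1) ^ (i + 1))"

definition pairing_mat :: "nat \<Rightarrow> complex mat" where
  "pairing_mat N = mat (2 * N) (2 * N)
     (\<lambda>(i, c). if c = pairing_index N i then pairing_sign N i else 0)"

abbreviation entry_power :: "nat \<Rightarrow> complex mat \<Rightarrow> complex mat" where
  "entry_power e A \<equiv> map_mat (\<lambda>z. z ^ e) A"

lemma entry_power_mat2: "entry_power e (mat2 a b c d) = mat2 (a ^ e) (b ^ e) (c ^ e) (d ^ e)"
  by (rule mat2_eqI) auto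

text \<open>An odd exponent preserves the minus sign in \<open>antidiag_SL2\<close>, and with it
  determinant 1.\<close>

lemma entry_power_monomial:
  "odd e \<Longrightarrow> entry_power e (diag_SL2 a) = diag_SL2 (a ^ e)"
  "odd e \<Longrightarrow> entry_power e (antidiag_SL2 a) = antidiag_SL2 (a ^ e)"
  by (auto simp: entry_power_mat2 mat2_eq_iff power_inverse odd_pos)

lemma pairing_index_less: "i < 2 * N \<Longrightarrow> pairing_index N i < 2 * N"
  by (auto simp: pairing_index_def)

lemma pairing_index_inj: "i < 2 * N \<Longrightarrow> j < 2 * N \<Longrightarrow> pairing_index N i = pairing_index N j \<longleftrightarrow> i = j"
  unfolding pairing_index_def by (auto split: if_splits) presburger+

lemma pairing_mat_carrier [simp]: "pairing_mat N \<in> carrier_mat (2 * N) (2 * N)"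
  by (simp add: pairing_mat_def)

lemma pairing_mat_mult:
  assumes "M \<in> carrier_mat (2 * N) r" "i < 2 * N" "c < r"
  shows "(pairing_mat N * M) $$ (i, c) = pairing_sign N i * M $$ (pairing_index N i, c)"
proof -
  have "(pairing_mat N * M) $$ (i, c) =
      (\<Sum>e<2 * N. (if e = pairing_index N i then pairing_sign N i else 0) * M $$ (e, c))"
    using assms by (subst index_mult_mat_sum [OF pairing_mat_carrier]) (auto simp: pairing_mat_def)
  then show ?thesis using pairing_index_less [OF assms(2)] by (simp only: sum_single_nat)
qed

lemma pairing_mat_orthogonal: "pairing_mat N * (pairing_mat N)\<^sup>T = 1\<^sub>m (2 * N)"
proof (rule eq_matI)
  fix i j assume "i < dim_row (1\<^sub>m (2 * N))" "j < dim_col (1\<^sub>m (2 * N))"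
  then have ij: "i < 2 * N" "j < 2 * N" by auto
  have "(pairing_mat N * (pairing_mat N)\<^sup>T) $$ (i, j) =
      pairing_sign N i * (pairing_mat N)\<^sup>T $$ (pairing_index N i, j)"
    using ij by (intro pairing_mat_mult) auto
  also have "\<dots> = 1\<^sub>m (2 * N) $$ (i, j)"
    using ij pairing_index_less [of i N] pairing_index_inj [of i N j]
    by (auto simp: pairing_mat_def pairing_sign_def simp flip: power_add mult_2)
  finally show "(pairing_mat N * (pairing_mat N)\<^sup>T) $$ (i, j) = 1\<^sub>m (2 * N) $$ (i, j)" .
qed (auto simp: pairing_mat_def)

lemma pairing_index_cases:
  assumes "i < 2 * N"
  obtains m where "m < N" "i = N + m" "2 * N - 1 - i = N - 1 - m"
      "pairing_index N i = 2 * m" "pairing_index N (2 * N - 1 - i) = 2 * m + 1"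
    | m where "m < N" "i = N - 1 - m" "2 * N - 1 - i = N + m"
      "pairing_index N i = 2 * m + 1" "pairing_index N (2 * N - 1 - i) = 2 * m"
proof (cases "N \<le> i")
  case True
  then show ?thesis using assms by (intro that(1) [of "i - N"]) (auto simp: pairing_index_def)
next
  case False
  then show ?thesis using assms by (intro that(2) [of "N - 1 - i"]) (auto simp: pairing_index_def)
qed

lemma sym_power_monomial:
  assumes "a \<noteq> 0" "A = diag_SL2 a \<or> A = antidiag_SL2 a"
  shows "sym_power (2 * N) A * pairing_mat N =
    pairing_mat N * direct_sum (\<lambda>m. entry_power (2 * m + 1)) 2 N A" (is "?L = ?R")
proof -
  define D where "D = direct_sum (\<lambda>m. entry_power (2 * m + 1)) 2 N A"
  have A: "entry_power e A \<in> carrier_mat 2 2" for e using assms(2) by auto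
  have D: "D \<in> carrier_mat (2 * N) (2 * N)"
    unfolding D_def using A by (rule direct_sum_carrier)
  have Dmc: "D $$ (p, c) = (if p div 2 = c div 2 then entry_power (2 * (p div 2) + 1) A $$ (p mod 2, c mod 2) else 0)"
    if "p < 2 * N" "c < 2 * N" for p c
    unfolding D_def using A that by (subst index_direct_sum) auto
  have odd_e: "odd (2 * m + 1)" for m :: nat by simp
  have "sym_power (2 * N) A * pairing_mat N = pairing_mat N * D"
  proof (rule eq_matI)
    fix i c assume "i < dim_row (pairing_mat N * D)" "c < dim_col (pairing_mat N * D)"
    then have ic: "i < 2 * N" "c < 2 * N" using D by (auto simp: pairing_mat_def)
    have i': "2 * N - 1 - i < 2 * N" using ic by simp
    have c2: "c mod 2 = 0 \<or> c mod 2 = 1" by auto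
    have cm: "c = 2 * m \<longleftrightarrow> c div 2 = m \<and> c mod 2 = 0" "c = 2 * m + 1 \<longleftrightarrow> c div 2 = m \<and> c mod 2 = 1" for m
      by presburger+
    have pm: "(2 * m) div 2 = m" "(2 * m) mod 2 = 0" "(2 * m + 1) div 2 = m" "(2 * m + 1) mod 2 = 1" for m :: nat
      by auto
    have R: "(pairing_mat N * D) $$ (i, c) = pairing_sign N i * D $$ (pairing_index N i, c)"
      by (rule pairing_mat_mult [OF D ic])
    note Dic = Dmc [OF pairing_index_less [OF ic(1)] ic(2)]
    have L: "(sym_power (2 * N) A * pairing_mat N) $$ (i, c) =
        (\<Sum>e<2 * N. sym_power (2 * N) A $$ (i, e) * pairing_mat N $$ (e, c))"
      by (rule index_mult_mat_sum [OF sym_power_carrier pairing_mat_carrier ic])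
    \<comment> \<open>The exponents of \<open>a\<close> and \<open>inverse a\<close> at the
      coordinates of pair m differ by 2m + 1, the origin of the odd exponents.\<close>
    have split: "a ^ (N + m) * inverse a ^ (N - 1 - m) = a ^ (2 * m + 1)"
      "a ^ (N - 1 - m) * inverse a ^ (N + m) = inverse a ^ (2 * m + 1)" if "m < N" for m
    proof -
      have e: "N + m = (N - 1 - m) + (2 * m + 1)" using that by simp
      show "a ^ (N + m) * inverse a ^ (N - 1 - m) = a ^ (2 * m + 1)"
        "a ^ (N - 1 - m) * inverse a ^ (N + m) = inverse a ^ (2 * m + 1)"
        unfolding e using assms(1) by (simp_all add: power_add field_simps)
    qed
    let ?i = "2 * N - 1 - i"
    show "(sym_power (2 * N) A * pairing_mat N) $$ (i, c) = (pairing_mat N * D) $$ (i, c)"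
      using assms(2)
    proof
      assume A: "A = diag_SL2 a"
      have "(sym_power (2 * N) A * pairing_mat N) $$ (i, c) =
          (\<Sum>e<2 * N. (if e = i then a ^ i * inverse a ^ (2 * N - 1 - i) else 0) * pairing_mat N $$ (e, c))"
        unfolding L by (intro sum.cong HOL.refl) (use ic in \<open>simp add: A sym_power_diag [OF assms(1)]\<close>)
      also have "\<dots> = a ^ i * inverse a ^ (2 * N - 1 - i) * pairing_mat N $$ (i, c)"
        by (rule sum_single_nat [OF ic(1)])
      also have "\<dots> = a ^ i * inverse a ^ ?i * (if c = pairing_index N i then pairing_sign N i else 0)"
        using ic by (simp add: pairing_mat_def)
      also have "\<dots> = pairing_sign N i * D $$ (pairing_index N i, c)"
        using ic(1)
      proof (cases rule: pairing_index_cases)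
        case (1 m)
        have "a ^ i * inverse a ^ ?i = a ^ (2 * m + 1)"
          unfolding 1(3) unfolding 1(2) by (rule split(1) [OF 1(1)])
        then show ?thesis
          using c2 unfolding 1(4) Dic [unfolded 1(4) pm] cm A entry_power_monomial [OF odd_e] by auto
      next
        case (2 m)
        have "a ^ i * inverse a ^ ?i = inverse a ^ (2 * m + 1)"
          unfolding 2(3) unfolding 2(2) by (rule split(2) [OF 2(1)])
        then show ?thesis
          using c2 unfolding 2(4) Dic [unfolded 2(4) pm] cm A entry_power_monomial [OF odd_e] by (auto simp: power_inverse)
      qed
      finally show ?thesis by (simp only: R)
    next
      assume A: "A = antidiag_SL2 a"
      have "(sym_power (2 * N) A * pairing_mat N) $$ (i, c) =
          (\<Sum>e<2 * N. (if e = ?i then (- a) ^ i * inverse a ^ ?i else 0) * pairing_mat N $$ (e, c))"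
        unfolding L by (intro sum.cong HOL.refl) (use ic in \<open>auto simp: A sym_power_antidiag [OF assms(1)]\<close>)
      also have "\<dots> = (- a) ^ i * inverse a ^ ?i * pairing_mat N $$ (?i, c)"
        by (rule sum_single_nat [OF i'])
      also have "\<dots> = (- a) ^ i * inverse a ^ ?i * (if c = pairing_index N ?i then pairing_sign N ?i else 0)"
        using ic i' by (simp add: pairing_mat_def)
      also have "\<dots> = pairing_sign N i * D $$ (pairing_index N i, c)"
        using ic(1)
      proof (cases rule: pairing_index_cases)
        case (1 m)
        \<comment> \<open>The number (N + m) + (N - m) is even, so the sign coming from
          \<open>- a\<close> and the pairing sign cancel.\<close>
        have "N + m + (N - 1 - m + 1) = 2 * N" using 1(1) by simp
        then have s: "(- 1 :: complex) ^ (N + m) * (- 1) ^ (N - 1 - m + 1) = 1"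
          by (simp only: power_add [symmetric]) simp
        have "(- a) ^ (N + m) * inverse a ^ (N - 1 - m) * (- 1) ^ (N - 1 - m + 1) =
            (- 1) ^ (N + m) * (- 1) ^ (N - 1 - m + 1) * (a ^ (N + m) * inverse a ^ (N - 1 - m))"
          by (simp only: power_minus [of a] mult_ac)
        then have sgn: "(- a) ^ i * inverse a ^ ?i * (- 1) ^ (N - 1 - m + 1) = a ^ (2 * m + 1)"
          unfolding s split(1) [OF 1(1)] mult_1 by (simp only: 1(3)) (simp only: 1(2))
        have "pairing_sign N i = 1" "pairing_sign N ?i = (- 1) ^ (N - 1 - m + 1)"
          unfolding 1(3) unfolding 1(2) using 1(1) by (auto simp: pairing_sign_def)
        then show ?thesis
          using c2 sgn unfolding 1(4,5) Dic [unfolded 1(4) pm] cm A entry_power_monomial [OF odd_e] by auto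
      next
        case (2 m)
        have "(- a) ^ (N - 1 - m) * inverse a ^ (N + m) =
            (- 1) ^ (N - 1 - m) * (a ^ (N - 1 - m) * inverse a ^ (N + m))"
          by (simp only: power_minus [of a] mult_ac)
        \<comment> \<open>One factor -1 is left over; it is the sign of the lower left entry of
          \<open>antidiag_SL2\<close>.\<close>
        also have "\<dots> = (- 1) ^ (N - 1 - m + 1) * (- (inverse a ^ (2 * m + 1)))"
          unfolding split(2) [OF 2(1)] by simp
        finally have sgn: "(- a) ^ i * inverse a ^ ?i = (- 1) ^ (N - 1 - m + 1) * (- (inverse a ^ (2 * m + 1)))"
          by (simp only: 2(3)) (simp only: 2(2))
        have "pairing_sign N ?i = 1" "pairing_sign N i = (- 1) ^ (N - 1 - m + 1)"
          unfolding 2(3) unfolding 2(2) using 2(1) by (auto simp: pairing_sign_def)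
        then show ?thesis
          using c2 sgn unfolding 2(4,5) Dic [unfolded 2(4) pm] cm A entry_power_monomial [OF odd_e]
          by (auto simp: power_inverse)
      qed
      finally show ?thesis by (simp only: R)
    qed
  qed (use D in \<open>auto simp: pairing_mat_def\<close>)
  then show ?thesis by (simp only: D_def)
qed

section \<open>Irreducible metabelian representations\<close>

lemma power_int_sum:
  fixes x :: "'a :: field"
  assumes "x \<noteq> 0"
  shows "x powi (sum f A) = (\<Prod>i\<in>A. x powi f i)"
  using assms by (induction A rule: infinite_finite_induct) (simp_all add: power_int_add)

lemma prod_power_int: "(prod f A) powi n = (\<Prod>i\<in>A. f i powi n)"
  for f :: "'b \<Rightarrow> 'a :: field"
  by (induction A rule: infinite_finite_induct) (simp_all add: power_int_mult_distrib)

text \<open>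
  If the relations \<open>z\<^sub>i = \<Prod>\<^sub>j z\<^sub>j\<^bsup>2n(i,j)\<^esup>\<close> hold, the integer matrix \<open>1 - 2n\<close> annihilates \<open>z\<close>
  multiplicatively; its determinant is odd, and it annihilates each \<open>z\<^sub>i\<close> by Cramer's rule.
\<close>

lemma roots_of_unity_if_squares:
  fixes z :: "nat \<Rightarrow> 'a :: field"
  assumes nz: "\<And>i. i < k \<Longrightarrow> z i \<noteq> 0"
    and rel: "\<And>i. i < k \<Longrightarrow> z i = (\<Prod>j<k. z j powi n i j)\<^sup>2"
  shows "\<exists>q>0. \<forall>i<k. z i ^ q = 1"
proof -
  define B :: "int mat" where "B = mat k k (\<lambda>(i, j). (if i = j then 1 else 0) - 2 * n i j)"
  have B: "B \<in> carrier_mat k k" by (simp add: B_def)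
  have det: "det B \<noteq> 0"
  proof
    assume "det B = 0"
    \<comment> \<open>In the two-element field the even part disappears, so the determinant reduces
      to 1 there and cannot be zero.\<close>
    have "map_mat (of_int :: int \<Rightarrow> bit) B = 1\<^sub>m k"
      by (rule eq_matI) (auto simp: B_def)
    then have "of_int (det B) = (1 :: bit)" by (metis of_int_hom.hom_det det_one)
    then show False using \<open>det B = 0\<close> by simp
  qed
  have rel': "(\<Prod>j<k. z j powi B $$ (i, j)) = 1" if i: "i < k" for i
  proof -
    have "(\<Prod>j<k. z j powi B $$ (i, j)) = (\<Prod>j<k. (if j = i then z j else 1) * inverse ((z j powi n i j)\<^sup>2))"
    proof (intro prod.cong HOL.refl)
      fix j assume "j \<in> {..<k}"
      then have "z j \<noteq> 0" "B $$ (i, j) = (if j = i then 1 else 0) + - (n i j * 2)"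
        using nz i by (auto simp: B_def)
      then show "z j powi B $$ (i, j) = (if j = i then z j else 1) * inverse ((z j powi n i j)\<^sup>2)"
        by (simp add: power_int_add power_int_minus power_int_mult power_int_diff divide_inverse)
    qed
    also have "\<dots> = z i * inverse ((\<Prod>j<k. z j powi n i j)\<^sup>2)"
      using i by (simp add: prod.distrib prod_power_distrib prod_inversef [symmetric] comp_def)
    also have "\<dots> = 1" using rel [OF i] nz [OF i] by simp
    finally show ?thesis .
  qed
  have "z l powi det B = 1" if l: "l < k" for l
  proof -
    have "z l powi det B = (\<Prod>j<k. if j = l then z j powi det B else 1)"
      using l by simp
    also have "\<dots> = (\<Prod>j<k. z j powi (adj_mat B * B) $$ (l, j))"
      unfolding adj_mat(3) [OF B] using l by (intro prod.cong) auto
    also have "\<dots> = (\<Prod>j<k. \<Prod>i<k. z j powi (adj_mat B $$ (l, i) * B $$ (i, j)))"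
    proof (intro prod.cong HOL.refl)
      fix j assume "j \<in> {..<k}"
      then have "j < k" by simp
      show "z j powi (adj_mat B * B) $$ (l, j) = (\<Prod>i<k. z j powi (adj_mat B $$ (l, i) * B $$ (i, j)))"
        unfolding index_mult_mat_sum [OF adj_mat(1) [OF B] B l \<open>j < k\<close>]
        by (rule power_int_sum) (rule nz [OF \<open>j < k\<close>])
    qed
    also have "\<dots> = (\<Prod>i<k. (\<Prod>j<k. z j powi B $$ (i, j)) powi adj_mat B $$ (l, i))"
      by (subst prod.swap) (simp add: prod_power_int mult.commute [of "adj_mat B $$ _"] power_int_mult)
    also have "\<dots> = 1" by (simp add: rel')
    finally show ?thesis .
  qed
  then have "z l ^ nat \<bar>det B\<bar> = 1" if "l < k" for l
    using that by (cases "det B \<ge> 0") (auto simp: power_int_def power_inverse)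
  then show ?thesis using det by (intro exI [of _ "nat \<bar>det B\<bar>"]) auto
qed

lemma SL2_mult_inv: "Q \<in> carrier (SL 2) \<Longrightarrow> Q * inv\<^bsub>SL 2\<^esub> Q = 1\<^sub>m 2"
  using group.r_inv [OF group_SL] by (metis SL_simps(2,3))

lemma SL2_cases:
  assumes "A \<in> carrier (SL 2)"
  obtains a b c d where "A = mat2 a b c d" "a * d - b * c = 1"
  using assms mat2_exhaust [of A] by (auto simp: SL_simps det_mat2_eq)

text \<open>An eigenvector of \<open>A\<close> is completed to a matrix of determinant 1 that has it
  as first column.\<close>

lemma exists_triangular_conjugate:
  assumes "A \<in> carrier (SL 2)"
  shows "\<exists>Q\<in>carrier (SL 2). (inv\<^bsub>SL 2\<^esub> Q * A * Q) $$ (1, 0) = 0"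
proof -
  obtain a b c d where A: "A = mat2 a b c d" "a * d - b * c = 1" using assms by (rule SL2_cases)
  \<comment> \<open>The second condition says that \<open>A\<close> maps (p, q) to a parallel
    vector. For b = 0 the vector (0, 1) is an eigenvector; otherwise (b, l - a) is one, for a root l
    of the characteristic polynomial.\<close>
  obtain p q where pq: "p \<noteq> 0 \<or> q \<noteq> 0" "(a * p + b * q) * q = (c * p + d * q) * p"
  proof (cases "b = 0")
    case True
    then show ?thesis by (intro that [of 0 1]) auto
  next
    case False
    define s where "s = csqrt ((a + d)\<^sup>2 - 4)"
    define l where "l = (a + d + s) / 2"
    have "s\<^sup>2 = (a + d)\<^sup>2 - 4" by (simp add: s_def)
    then have "(2 * l - (a + d))\<^sup>2 = (a + d)\<^sup>2 - 4" by (simp add: l_def)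
    then have "4 * (l * l) = 4 * ((a + d) * l - (a * d - b * c))"
      using A(2) by (simp add: power2_eq_square algebra_simps)
    then have l: "l * l = (a + d) * l - (a * d - b * c)"
      by (metis mult_left_cancel zero_neq_numeral)
    have "(a * b + b * (l - a)) * (l - a) - (c * b + d * (l - a)) * b =
        b * (l * l - ((a + d) * l - (a * d - b * c)))"
      by (simp add: algebra_simps)
    then have "(a * b + b * (l - a)) * (l - a) - (c * b + d * (l - a)) * b = 0" by (simp only: l) simp
    then show ?thesis using False by (intro that [of b "l - a"]) auto
  qed
  define Q where "Q = (if p \<noteq> 0 then mat2 p 0 q (inverse p) else mat2 0 (- inverse q) q 0)"
  have Q: "Q = mat2 p x q y \<and> p * y - x * q = 1"
    if "x = (if p \<noteq> 0 then 0 else - inverse q)" "y = (if p \<noteq> 0 then inverse p else 0)" for x y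
    using pq(1) that by (auto simp: Q_def)
  then obtain x y where Q: "Q = mat2 p x q y" "p * y - x * q = 1" by blast
  have "inv\<^bsub>SL 2\<^esub> Q * A * Q = mat2 y (- x) (- q) p * A * Q"
    using Q inv_SL2 [of p x q y] by (simp add: det_mat2_eq)
  then have "(inv\<^bsub>SL 2\<^esub> Q * A * Q) $$ (1, 0) = (c * p + d * q) * p - (a * p + b * q) * q"
    by (simp add: A Q mat2_mult algebra_simps)
  then show ?thesis using pq(2) Q by (intro bexI [of _ Q]) (auto simp: SL_simps det_mat2_eq)
qed

section \<open>Monomial matrices\<close>

text \<open>The normaliser of the diagonal torus of SL2.\<close>

definition monomial_SL2 :: "complex mat set" where
  "monomial_SL2 = {A. \<exists>a. a \<noteq> 0 \<and> (A = diag_SL2 a \<or> A = antidiag_SL2 a)}"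

lemma diag_mult: "diag_SL2 a * diag_SL2 b = diag_SL2 (a * b)"
  and diag_antidiag_mult: "diag_SL2 a * antidiag_SL2 b = antidiag_SL2 (a * b)"
  and antidiag_diag_mult: "antidiag_SL2 a * diag_SL2 b = antidiag_SL2 (a * inverse b)"
  and antidiag_mult: "antidiag_SL2 a * antidiag_SL2 b = diag_SL2 (- a * inverse b)"
  by (simp_all add: mat2_mult mat2_eq_iff)

lemmas monomial_mult = diag_mult diag_antidiag_mult antidiag_diag_mult antidiag_mult

lemma monomial_in_SL2: "A \<in> monomial_SL2 \<Longrightarrow> A \<in> carrier (SL 2)"
  by (auto simp: monomial_SL2_def SL_simps det_mat2_eq)

lemma subgroup_monomial_SL2: "subgroup monomial_SL2 (SL 2)"
proof -
  interpret SL2: group "SL 2" by (rule group_SL)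
  show ?thesis
  proof (rule SL2.subgroupI)
    show "monomial_SL2 \<subseteq> carrier (SL 2)" using monomial_in_SL2 by blast
    show "monomial_SL2 \<noteq> {}" by (auto simp: monomial_SL2_def intro: exI [of _ 1])
  next
    fix A assume "A \<in> monomial_SL2"
    then obtain a where a: "a \<noteq> 0" "A = diag_SL2 a \<or> A = antidiag_SL2 a" by (auto simp: monomial_SL2_def)
    then have "inv\<^bsub>SL 2\<^esub> A = diag_SL2 (inverse a) \<or> inv\<^bsub>SL 2\<^esub> A = antidiag_SL2 (- a)"
      by (auto simp: inv_SL2 det_mat2_eq mat2_eq_iff)
    then show "inv\<^bsub>SL 2\<^esub> A \<in> monomial_SL2"
      using a(1) unfolding monomial_SL2_def by (metis (mono_tags, lifting) mem_Collect_eq inverse_nonzero_iff_nonzero neg_equal_0_iff_equal)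
  next
    fix A B assume "A \<in> monomial_SL2" "B \<in> monomial_SL2"
    then obtain a b where "a \<noteq> 0" "A = diag_SL2 a \<or> A = antidiag_SL2 a"
      "b \<noteq> 0" "B = diag_SL2 b \<or> B = antidiag_SL2 b" by (auto simp: monomial_SL2_def)
    then have "A * B \<in> {diag_SL2 (a * b), antidiag_SL2 (a * b), antidiag_SL2 (a * inverse b), diag_SL2 (- a * inverse b)}"
      by (auto simp: monomial_mult)
    moreover have "a * b \<noteq> 0" "a * inverse b \<noteq> 0" "- a * inverse b \<noteq> 0" using \<open>a \<noteq> 0\<close> \<open>b \<noteq> 0\<close> by auto
    ultimately show "A \<otimes>\<^bsub>SL 2\<^esub> B \<in> monomial_SL2"
      unfolding monomial_SL2_def SL_simps by blast
  qed
qed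

lemma subgroup_diag_SL2: "subgroup {diag_SL2 a |a. a \<noteq> 0} (SL 2)"
  and comm_group_diag_SL2: "comm_group ((SL 2)\<lparr>carrier := {diag_SL2 a |a. a \<noteq> 0}\<rparr>)"
proof -
  interpret SL2: group "SL 2" by (rule group_SL)
  show sub: "subgroup {diag_SL2 a |a. a \<noteq> 0} (SL 2)"
  proof (rule SL2.subgroupI)
    fix A assume "A \<in> {diag_SL2 a |a. a \<noteq> 0}"
    then obtain a where "a \<noteq> 0" "A = diag_SL2 a" by auto
    then have "inv\<^bsub>SL 2\<^esub> A = diag_SL2 (inverse a)" "inverse a \<noteq> 0"
      by (auto simp: inv_SL2 det_mat2_eq mat2_eq_iff)
    then show "inv\<^bsub>SL 2\<^esub> A \<in> {diag_SL2 a |a. a \<noteq> 0}" by blast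
  next
    fix A B assume "A \<in> {diag_SL2 a |a. a \<noteq> 0}" "B \<in> {diag_SL2 a |a. a \<noteq> 0}"
    then obtain a b where "a * b \<noteq> 0" "A = diag_SL2 a" "B = diag_SL2 b" by auto
    then show "A \<otimes>\<^bsub>SL 2\<^esub> B \<in> {diag_SL2 a |a. a \<noteq> 0}"
      unfolding SL_simps by (simp only: diag_mult) blast
  qed (auto simp: SL_simps det_mat2_eq intro: exI [of _ 1])
  show "comm_group ((SL 2)\<lparr>carrier := {diag_SL2 a |a. a \<noteq> 0}\<rparr>)"
    by (intro group.group_comm_groupI SL2.subgroup_imp_group sub) (auto simp: SL_simps diag_mult mult.commute)
qed

section \<open>Conjugation into monomial form\<close>

locale metabelian_irreducible = deficiency_one +
  fixes \<rho> :: "'a \<Rightarrow> complex mat"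
  assumes kernel_\<alpha>: "kernel G integer_group \<alpha> = derived G (carrier G)"
    and metabelian: "metabelian_rep G \<rho>"
    and irreducible: "irreducible_rep G \<rho>"
begin

lemma derived_iff: "\<gamma> \<in> derived G (carrier G) \<longleftrightarrow> \<gamma> \<in> carrier G \<and> \<alpha> \<gamma> = 0"
  unfolding kernel_\<alpha> [symmetric] by (auto simp: kernel_def integer_group_def)

text \<open>The kernel of \<open>\<alpha>\<close> is the commutator subgroup, so together with one
  element of exponent 1 it generates the group. Multiplying by \<open>u\<close> or its inverse moves
  the exponent one step towards 0.\<close>

lemma subgroup_eq_carrier:
  assumes H: "subgroup H G" and "derived G (carrier G) \<subseteq> H" and u: "u \<in> H" "\<alpha> u = 1"
  shows "carrier G \<subseteq> H"
proof -
  interpret H: subgroup H G by (rule H)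
  have uG: "u \<in> carrier G" using u by auto
  have "\<forall>\<gamma>\<in>carrier G. \<alpha> \<gamma> = m \<longrightarrow> \<gamma> \<in> H" for m
  proof (induction m rule: int_induct [where k = 0])
    case base
    then show ?case using assms(2) derived_iff by auto
  next
    case (step1 m)
    show ?case
    proof (intro ballI impI)
      fix \<gamma> assume "\<gamma> \<in> carrier G" "\<alpha> \<gamma> = m + 1"
      then have "inv u \<otimes> \<gamma> \<in> H" using step1 uG u by (simp add: \<alpha>_mult \<alpha>_inv)
      then have "u \<otimes> (inv u \<otimes> \<gamma>) \<in> H" by (rule H.m_closed [OF u(1)])
      moreover have "u \<otimes> (inv u \<otimes> \<gamma>) = \<gamma>" using uG \<open>\<gamma> \<in> carrier G\<close> by (simp add: m_assoc [symmetric])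
      ultimately show "\<gamma> \<in> H" by simp
    qed
  next
    case (step2 m)
    show ?case
    proof (intro ballI impI)
      fix \<gamma> assume "\<gamma> \<in> carrier G" "\<alpha> \<gamma> = m - 1"
      then have "u \<otimes> \<gamma> \<in> H" using step2 uG u by (simp add: \<alpha>_mult)
      then have "inv u \<otimes> (u \<otimes> \<gamma>) \<in> H" by (rule H.m_closed [OF H.m_inv_closed [OF u(1)]])
      moreover have "inv u \<otimes> (u \<otimes> \<gamma>) = \<gamma>" using uG \<open>\<gamma> \<in> carrier G\<close> by (simp add: m_assoc [symmetric])
      ultimately show "\<gamma> \<in> H" by simp
    qed
  qed
  then show ?thesis by blast
qed

lemma \<rho>_hom: "\<rho> \<in> hom G (SL 2)"
  using metabelian by (simp add: metabelian_rep_def)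

lemma \<rho>_closed: "\<gamma> \<in> carrier G \<Longrightarrow> \<rho> \<gamma> \<in> carrier (SL 2)"
  using \<rho>_hom by (auto simp: hom_def)

lemma \<rho>_mult: "\<gamma> \<in> carrier G \<Longrightarrow> \<delta> \<in> carrier G \<Longrightarrow> \<rho> (\<gamma> \<otimes> \<delta>) = \<rho> \<gamma> * \<rho> \<delta>"
  using \<rho>_hom by (simp add: hom_def SL_simps)

lemma \<rho>_derived_commute:
  assumes "c \<in> derived G (carrier G)" "d \<in> derived G (carrier G)"
  shows "\<rho> c * \<rho> d = \<rho> d * \<rho> c"
proof -
  obtain H where "comm_group ((SL 2)\<lparr>carrier := H\<rparr>)" "\<rho> ` derived G (carrier G) \<subseteq> H"
    using metabelian by (auto simp: metabelian_rep_def)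
  then interpret H: comm_group "(SL 2)\<lparr>carrier := H\<rparr>" by simp
  have "\<rho> c \<in> H" "\<rho> d \<in> H" using \<open>\<rho> ` derived G (carrier G) \<subseteq> H\<close> assms by auto
  then show ?thesis using H.m_comm [of "\<rho> c" "\<rho> d"] by (simp add: SL_simps)
qed

definition conj_rep :: "complex mat \<Rightarrow> 'a \<Rightarrow> complex mat" where
  "conj_rep Q \<gamma> = inv\<^bsub>SL 2\<^esub> Q * \<rho> \<gamma> * Q"

context
  fixes Q assumes Q: "Q \<in> carrier (SL 2)"
begin

lemma inv_Q_closed: "inv\<^bsub>SL 2\<^esub> Q \<in> carrier (SL 2)"
  using group.inv_closed [OF group_SL Q] .

lemma conj_rep_closed: "\<gamma> \<in> carrier G \<Longrightarrow> conj_rep Q \<gamma> \<in> carrier (SL 2)"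
  using inv_Q_closed Q \<rho>_closed [of \<gamma>] unfolding conj_rep_def
  by (metis SL_simps(2) group.is_monoid group_SL monoid.m_closed)

lemma conj_rep_mult:
  assumes "\<gamma> \<in> carrier G" "\<delta> \<in> carrier G"
  shows "conj_rep Q (\<gamma> \<otimes> \<delta>) = conj_rep Q \<gamma> * conj_rep Q \<delta>"
proof -
  interpret SL2: group "SL 2" by (rule group_SL)
  show ?thesis
    using assms Q
    unfolding conj_rep_def \<rho>_mult [OF assms] SL_simps(2) [where n = 2, symmetric]
    by (simp add: SL2.m_assoc \<rho>_closed SL2.m_assoc [of Q "inv\<^bsub>SL 2\<^esub> Q", symmetric])
qed

lemma conj_rep_intertwine:
  assumes "\<gamma> \<in> carrier G"
  shows "\<rho> \<gamma> * Q = Q * conj_rep Q \<gamma>"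
proof -
  interpret SL2: group "SL 2" by (rule group_SL)
  show ?thesis
    using assms Q unfolding conj_rep_def SL_simps(2) [where n = 2, symmetric]
    by (simp add: SL2.m_assoc \<rho>_closed SL2.m_assoc [of Q "inv\<^bsub>SL 2\<^esub> Q", symmetric])
qed

lemma conj_rep_hom: "conj_rep Q \<in> hom G (SL 2)"
  using conj_rep_closed conj_rep_mult by (auto simp: hom_def SL_simps(2))

lemma conj_rep_one: "conj_rep Q \<one> = 1\<^sub>m 2"
  using hom_one [OF conj_rep_hom is_group group_SL] by (simp add: SL_simps)

lemma conj_rep_inv: "\<gamma> \<in> carrier G \<Longrightarrow> conj_rep Q (inv \<gamma>) = inv\<^bsub>SL 2\<^esub> (conj_rep Q \<gamma>)"
  using group_hom.hom_inv [of G "SL 2" "conj_rep Q" \<gamma>] conj_rep_hom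
  by (simp add: group_hom_def group_hom_axioms_def group_SL is_group)

lemma subgroup_conj_rep_vimage:
  assumes "subgroup S (SL 2)"
  shows "subgroup {\<gamma> \<in> carrier G. conj_rep Q \<gamma> \<in> S} G"
proof -
  interpret S: subgroup S "SL 2" by (rule assms)
  show ?thesis
    using S.m_closed S.m_inv_closed S.one_closed
    by (intro subgroupI) (auto simp: conj_rep_mult conj_rep_inv SL_simps conj_rep_one intro!: exI [of _ \<one>])
qed

text \<open>In the basis formed by the columns of \<open>Q\<close>, a common zero at (1, 0) would
  make the first column span an invariant line. This is the form in which irreducibility is
  used.\<close>

lemma not_all_triangular: "\<exists>\<gamma>\<in>carrier G. conj_rep Q \<gamma> $$ (1, 0) \<noteq> 0"
proof (rule ccontr)
  assume "\<not> ?thesis"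
  then have tri: "conj_rep Q \<gamma> $$ (1, 0) = 0" if "\<gamma> \<in> carrier G" for \<gamma> using that by auto
  have Qc: "Q \<in> carrier_mat 2 2" "det Q = 1" using Q by (auto simp: SL_simps)
  define v where "v = col Q 0"
  have v: "v \<in> carrier_vec 2" using Qc col_dim [of Q 0] by (auto simp: v_def)
  define W where "W = {l \<cdot>\<^sub>v v |l. True}"
  have "VectorSpace.subspace class_ring W (module_vec TYPE(complex) 2)"
    unfolding subspace_def
  proof
    show "vectorspace class_ring (module_vec TYPE(complex) 2)" by (rule vec_vs)
    show "submodule class_ring W (module_vec TYPE(complex) 2)"
    proof (rule submodule.intro)
      show "module class_ring (module_vec TYPE(complex) 2)" by (rule vec_module)
      show "\<zero>\<^bsub>module_vec TYPE(complex) 2\<^esub> \<in> W"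
        using v by (auto simp: W_def module_vec_simps intro!: exI [of _ 0])
    qed (use v in \<open>auto simp: W_def module_vec_simps smult_smult_assoc add_smult_distrib_vec [symmetric]\<close>)
  qed
  moreover have "\<rho> \<gamma> *\<^sub>v w \<in> W" if \<gamma>: "\<gamma> \<in> carrier G" and w: "w \<in> W" for \<gamma> w
  proof -
    have \<rho>: "\<rho> \<gamma> \<in> carrier_mat 2 2" using \<rho>_closed [OF \<gamma>] by (simp add: SL_simps)
    obtain a b c d where M: "conj_rep Q \<gamma> = mat2 a b c d" using conj_rep_closed [OF \<gamma>] by (rule SL2_cases)
    then have "c = 0" using tri [OF \<gamma>] by simp
    obtain p x q y where Q': "Q = mat2 p x q y" using Q by (rule SL2_cases)
    have "\<rho> \<gamma> *\<^sub>v v = col (\<rho> \<gamma> * Q) 0"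
      unfolding v_def by (rule col_mult2 [OF \<rho> Qc(1), symmetric]) simp
    also have "\<rho> \<gamma> * Q = mat2 (p * a) (p * b + x * d) (q * a) (q * b + y * d)"
      unfolding conj_rep_intertwine [OF \<gamma>] M unfolding Q' by (simp add: mat2_mult \<open>c = 0\<close>)
    also have "col \<dots> 0 = a \<cdot>\<^sub>v v"
      by (rule eq_vecI) (auto simp: v_def Q' less_2_cases_iff)
    finally have "\<rho> \<gamma> *\<^sub>v v = a \<cdot>\<^sub>v v" .
    moreover obtain l where "w = l \<cdot>\<^sub>v v" using w by (auto simp: W_def)
    ultimately have "\<rho> \<gamma> *\<^sub>v w = (l * a) \<cdot>\<^sub>v v"
      using mult_mat_vec [OF \<rho> v] by (simp add: smult_smult_assoc)
    then show ?thesis by (auto simp: W_def)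
  qed
  ultimately have "W = {0\<^sub>v 2} \<or> W = carrier_vec 2"
    using irreducible by (auto simp: irreducible_rep_def)
  obtain p x q y where Q': "Q = mat2 p x q y" "p * y - x * q = 1" using Q by (rule SL2_cases)
  have "v = vec 2 (\<lambda>i. if i = 0 then p else q)" unfolding v_def Q' by (rule eq_vecI) (auto simp: less_2_cases_iff)
  then have v0: "v $ 0 = p" "v $ 1 = q" by auto
  show False
    using \<open>W = {0\<^sub>v 2} \<or> W = carrier_vec 2\<close>
  proof
    assume "W = {0\<^sub>v 2}"
    moreover have "1 \<cdot>\<^sub>v v \<in> W" unfolding W_def by blast
    ultimately have "v = 0\<^sub>v 2" by simp
    then show False using v0 Q'(2) by auto
  next
    \<comment> \<open>The second column of \<open>Q\<close> would be a multiple of the first,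
      against determinant 1.\<close>
    assume W: "W = carrier_vec 2"
    define w where "w = vec 2 (\<lambda>i. if i = 0 then x else y)"
    have "w \<in> W" by (simp add: W w_def)
    then obtain l where "w = l \<cdot>\<^sub>v v" by (auto simp: W_def)
    then have "w $ 0 = l * p" "w $ 1 = l * q" using v v0 by auto
    then have "x = l * p" "y = l * q" by (auto simp: w_def)
    then show False using Q'(2) by (simp add: algebra_simps)
  qed
qed

end

text \<open>Upper triangular matrices form a subgroup, so a triangular image of \<open>u\<close>
  would make the whole image triangular by \<open>subgroup_eq_carrier\<close>.\<close>

lemma conj_rep_not_triangular:
  assumes Q: "Q \<in> carrier (SL 2)" and u: "u \<in> carrier G" "\<alpha> u = 1"
    and tri: "\<And>c. c \<in> derived G (carrier G) \<Longrightarrow> conj_rep Q c $$ (1, 0) = 0"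
  shows "conj_rep Q u $$ (1, 0) \<noteq> 0"
proof
  assume 0: "conj_rep Q u $$ (1, 0) = 0"
  have "subgroup {\<gamma> \<in> carrier G. conj_rep Q \<gamma> $$ (1, 0) = 0} G"
  proof (rule subgroupI)
    show "{\<gamma> \<in> carrier G. conj_rep Q \<gamma> $$ (1, 0) = 0} \<noteq> {}"
      using conj_rep_one [OF Q] by (auto intro!: exI [of _ \<one>])
  next
    fix \<gamma> assume "\<gamma> \<in> {\<gamma> \<in> carrier G. conj_rep Q \<gamma> $$ (1, 0) = 0}"
    then have \<gamma>: "\<gamma> \<in> carrier G" "conj_rep Q \<gamma> $$ (1, 0) = 0" by auto
    obtain a b c d where M: "conj_rep Q \<gamma> = mat2 a b c d" "a * d - b * c = 1"
      using conj_rep_closed [OF Q \<gamma>(1)] by (rule SL2_cases)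
    then show "inv \<gamma> \<in> {\<gamma> \<in> carrier G. conj_rep Q \<gamma> $$ (1, 0) = 0}"
      using \<gamma> inv_SL2 [of a b c d] by (simp add: conj_rep_inv [OF Q] det_mat2_eq)
  next
    fix \<gamma> \<delta> assume "\<gamma> \<in> {\<gamma> \<in> carrier G. conj_rep Q \<gamma> $$ (1, 0) = 0}" "\<delta> \<in> {\<gamma> \<in> carrier G. conj_rep Q \<gamma> $$ (1, 0) = 0}"
    then have \<gamma>: "\<gamma> \<in> carrier G" "conj_rep Q \<gamma> $$ (1, 0) = 0"
      and \<delta>: "\<delta> \<in> carrier G" "conj_rep Q \<delta> $$ (1, 0) = 0" by auto
    obtain a b c d where M: "conj_rep Q \<gamma> = mat2 a b c d" using conj_rep_closed [OF Q \<gamma>(1)] by (rule SL2_cases)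
    obtain a' b' c' d' where M': "conj_rep Q \<delta> = mat2 a' b' c' d'" using conj_rep_closed [OF Q \<delta>(1)] by (rule SL2_cases)
    show "\<gamma> \<otimes> \<delta> \<in> {\<gamma> \<in> carrier G. conj_rep Q \<gamma> $$ (1, 0) = 0}"
      using \<gamma> \<delta> M M' by (simp add: conj_rep_mult [OF Q] mat2_mult)
  qed auto
  then have "carrier G \<subseteq> {\<gamma> \<in> carrier G. conj_rep Q \<gamma> $$ (1, 0) = 0}"
    using tri 0 u derived_iff by (intro subgroup_eq_carrier [where u = u]) auto
  then show False using not_all_triangular [OF Q] by auto
qed

text \<open>The commutator subgroup has a common eigenline because it commutes with a non-scalar
  element of its own. By normality \<open>u\<close> carries this line to a second common eigenline,
  and irreducibility keeps the two apart; they are the coordinate axes of the new basis.\<close>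

lemma exists_monomial_conjugate:
  obtains Q u where "Q \<in> carrier (SL 2)" "u \<in> carrier G" "\<alpha> u = 1" "conj_rep Q u = antidiag_SL2 (- 1)"
    and "\<And>c. c \<in> derived G (carrier G) \<Longrightarrow> \<exists>a. a \<noteq> 0 \<and> conj_rep Q c = diag_SL2 a"
proof -
  let ?D = "derived G (carrier G)"
  obtain u where u: "u \<in> carrier G" "\<alpha> u = 1" using \<alpha>_surj by (metis UNIV_I imageE)
  have DG: "c \<in> carrier G" if "c \<in> ?D" for c using that derived_iff by auto
  have Duc: "inv u \<otimes> c \<otimes> u \<in> ?D" if "c \<in> ?D" for c
    using that u by (auto simp: derived_iff \<alpha>_mult \<alpha>_inv)
  \<comment> \<open>If all these images were scalar, a basis that triangularises
    \<open>\<rho> u\<close> would triangularise the whole image.\<close>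
  have "\<exists>c\<in>?D. \<forall>a. \<rho> c \<noteq> mat2 a 0 0 a"
  proof (rule ccontr)
    assume "\<not> ?thesis"
    then have scalar: "\<exists>a. \<rho> c = mat2 a 0 0 a" if "c \<in> ?D" for c using that by blast
    obtain Q where Q: "Q \<in> carrier (SL 2)" "(inv\<^bsub>SL 2\<^esub> Q * \<rho> u * Q) $$ (1, 0) = 0"
      using exists_triangular_conjugate [OF \<rho>_closed [OF u(1)]] by auto
    have "conj_rep Q c $$ (1, 0) = 0" if c: "c \<in> ?D" for c
    proof -
      obtain a where a: "\<rho> c = mat2 a 0 0 a" using scalar [OF c] by auto
      obtain p x q y where Q': "Q = mat2 p x q y" "p * y - x * q = 1" using Q(1) by (rule SL2_cases)
      then show ?thesis
        using inv_SL2 [of p x q y] by (simp add: conj_rep_def a mat2_mult det_mat2_eq)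
    qed
    then show False
      using conj_rep_not_triangular [OF Q(1) u] Q(2) by (simp add: conj_rep_def)
  qed
  then obtain c0 where c0: "c0 \<in> ?D" "\<And>a. \<rho> c0 \<noteq> mat2 a 0 0 a" by blast
  obtain Q1 where Q1: "Q1 \<in> carrier (SL 2)" "conj_rep Q1 c0 $$ (1, 0) = 0"
    using exists_triangular_conjugate [OF \<rho>_closed [OF DG [OF c0(1)]]] unfolding conj_rep_def by auto
  have nonscalar: "conj_rep Q c0 \<noteq> mat2 a 0 0 a" if Q: "Q \<in> carrier (SL 2)" for a Q
  proof
    assume eq: "conj_rep Q c0 = mat2 a 0 0 a"
    obtain p x q y where Q': "Q = mat2 p x q y" "p * y - x * q = 1" using Q by (rule SL2_cases)
    have "\<rho> c0 = \<rho> c0 * (Q * inv\<^bsub>SL 2\<^esub> Q)"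
      using \<rho>_closed [OF DG [OF c0(1)]] by (simp add: SL2_mult_inv [OF Q] SL_simps right_mult_one_mat [of _ 2 2])
    also have "\<dots> = \<rho> c0 * Q * inv\<^bsub>SL 2\<^esub> Q"
      using \<rho>_closed [OF DG [OF c0(1)]] Q inv_Q_closed [OF Q]
      by (intro assoc_mult_mat [symmetric]) (auto simp: SL_simps)
    also have "\<rho> c0 * Q = Q * mat2 a 0 0 a"
      using conj_rep_intertwine [OF Q DG [OF c0(1)]] eq by simp
    also have "Q * mat2 a 0 0 a * inv\<^bsub>SL 2\<^esub> Q = mat2 (a * (p * y - x * q)) 0 0 (a * (p * y - x * q))"
      using Q' inv_SL2 [of p x q y] by (simp add: mat2_mult det_mat2_eq mat2_eq_iff algebra_simps)
    finally show False using c0(2) Q'(2) by simp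
  qed
  \<comment> \<open>Commuting with the upper triangular, non-scalar image of \<open>c0\<close>
    leaves no room for an entry \<open>s\<close> below the diagonal: both \<open>b * s\<close> and
    \<open>(d - a) * s\<close> vanish.\<close>
  have tri1: "conj_rep Q1 c $$ (1, 0) = 0" if c: "c \<in> ?D" for c
  proof -
    obtain a b r d where M: "conj_rep Q1 c0 = mat2 a b r d" using conj_rep_closed [OF Q1(1) DG [OF c0(1)]] by (rule SL2_cases)
    then have r: "r = 0" using Q1(2) by simp
    obtain m n s t where N: "conj_rep Q1 c = mat2 m n s t" using conj_rep_closed [OF Q1(1) DG [OF c]] by (rule SL2_cases)
    have "conj_rep Q1 (c0 \<otimes> c) = conj_rep Q1 (c \<otimes> c0)"
      using \<rho>_derived_commute [OF c0(1) c] DG [OF c] DG [OF c0(1)] by (simp add: conj_rep_def \<rho>_mult)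
    then have "mat2 a b r d * mat2 m n s t = mat2 m n s t * mat2 a b r d"
      using DG [OF c] DG [OF c0(1)] by (simp add: conj_rep_mult [OF Q1(1)] M N)
    then have "b * s = 0" "d * s = s * a" by (auto simp: mat2_mult mat2_eq_iff r algebra_simps)
    moreover have "\<not> (b = 0 \<and> a = d)" using nonscalar [OF Q1(1)] M r by auto
    ultimately show ?thesis using N by auto
  qed
  obtain m n r s where U1: "conj_rep Q1 u = mat2 m n r s" "m * s - n * r = 1"
    using conj_rep_closed [OF Q1(1) u(1)] by (rule SL2_cases)
  have r: "r \<noteq> 0" using conj_rep_not_triangular [OF Q1(1) u tri1] U1 by simp
  \<comment> \<open>The columns of \<open>E\<close> will be the first basis vector and its image
    under \<open>u\<close>, both scaled by \<open>x\<close>; the equation x^2 r = 1 gives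
    determinant 1. In this basis \<open>u\<close> is a companion matrix with trace
    \<open>z\<close>.\<close>
  define x where "x = csqrt (inverse r)"
  have x2: "x * x * r = 1" using r by (simp add: x_def flip: power2_eq_square)
  have x0: "x \<noteq> 0" using x2 by auto
  define E where "E = mat2 x (x * m) 0 (x * r)"
  have E: "E \<in> carrier (SL 2)" using x2 by (simp add: E_def SL_simps det_mat2_eq mult.assoc)
  have invE: "inv\<^bsub>SL 2\<^esub> E = mat2 (x * r) (- (x * m)) 0 x"
    unfolding E_def using x2 by (subst inv_SL2) (simp_all add: det_mat2_eq mult.assoc)
  define Q where "Q = Q1 * E"
  interpret SL2: group "SL 2" by (rule group_SL)
  have Q: "Q \<in> carrier (SL 2)" using Q1 E SL2.m_closed by (simp add: Q_def flip: SL_simps(2) [where n = 2])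
  have conj: "conj_rep Q \<gamma> = inv\<^bsub>SL 2\<^esub> E * conj_rep Q1 \<gamma> * E" if "\<gamma> \<in> carrier G" for \<gamma>
    using that Q1(1) E \<rho>_closed [OF that] unfolding conj_rep_def Q_def SL_simps(2) [where n = 2, symmetric]
    by (simp add: SL2.inv_mult_group SL2.m_assoc)
  define z where "z = m + s"
  have U: "conj_rep Q u = mat2 0 (- 1) 1 z"
  proof -
    have "conj_rep Q u = mat2 0 (x * x * r * (n * r - m * s)) (x * x * r) (x * x * r * (m + s))"
      unfolding conj [OF u(1)] invE U1 unfolding E_def by (simp add: mat2_mult mat2_eq_iff algebra_simps)
    also have "n * r - m * s = - 1" using U1(2) by (simp add: algebra_simps)
    finally show ?thesis by (simp add: x2 z_def)
  qed
  have tri: "\<exists>a b d. conj_rep Q c = mat2 a b 0 d \<and> a * d = 1" if c: "c \<in> ?D" for c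
  proof -
    obtain a b t d where M: "conj_rep Q1 c = mat2 a b t d" using conj_rep_closed [OF Q1(1) DG [OF c]] by (rule SL2_cases)
    then have "t = 0" using tri1 [OF c] by simp
    then have "conj_rep Q c $$ (1, 0) = 0"
      unfolding conj [OF DG [OF c]] invE M unfolding E_def by (simp add: mat2_mult)
    moreover obtain a b t d where "conj_rep Q c = mat2 a b t d" "a * d - b * t = 1"
      using conj_rep_closed [OF Q DG [OF c]] by (rule SL2_cases)
    ultimately show ?thesis by auto
  qed
  \<comment> \<open>Entrywise comparison in c u = u (u^(-1) c u), where the last factor again lies
    in the commutator subgroup: the corner (0, 0) gives \<open>b = 0\<close>, and the two
    eigenvalues change places.\<close>
  have swap: "b = 0 \<and> d = a' \<and> a = d' \<and> d * z = b' + z * d'"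
    if c: "c \<in> ?D" and C: "conj_rep Q c = mat2 a b 0 d" and C': "conj_rep Q (inv u \<otimes> c \<otimes> u) = mat2 a' b' 0 d'"
    for c a b d a' b' d'
  proof -
    have "conj_rep Q (c \<otimes> u) = conj_rep Q (u \<otimes> (inv u \<otimes> c \<otimes> u))"
      using u DG [OF c] by (simp add: m_assoc [symmetric])
    then have "mat2 a b 0 d * mat2 0 (- 1) 1 z = mat2 0 (- 1) 1 z * mat2 a' b' 0 d'"
      using u DG [OF c] DG [OF Duc [OF c]] by (simp add: conj_rep_mult [OF Q] U C C' del: m_closed)
    then show ?thesis by (auto simp: mat2_mult mat2_eq_iff algebra_simps)
  qed
  have diag: "\<exists>a. a \<noteq> 0 \<and> conj_rep Q c = diag_SL2 a" if c: "c \<in> ?D" for c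
  proof -
    obtain a b d where C: "conj_rep Q c = mat2 a b 0 d" "a * d = 1" using tri [OF c] by blast
    obtain a' b' d' where C': "conj_rep Q (inv u \<otimes> c \<otimes> u) = mat2 a' b' 0 d'" using tri [OF Duc [OF c]] by blast
    have "b = 0" using swap [OF c C(1) C'] by simp
    moreover have "d = inverse a" using C(2) by (metis inverse_unique)
    moreover have "a \<noteq> 0" using C(2) by auto
    ultimately show ?thesis using C(1) by auto
  qed
  \<comment> \<open>The image of \<open>c0\<close> is diagonal but not scalar, so its eigenvalues a
    and a^(-1) differ, which forces the trace of \<open>u\<close> to vanish.\<close>
  have "z = 0"
  proof -
    obtain a where a: "a \<noteq> 0" "conj_rep Q c0 = diag_SL2 a" using diag [OF c0(1)] by auto
    obtain a' where a': "conj_rep Q (inv u \<otimes> c0 \<otimes> u) = diag_SL2 a'" using diag [OF Duc [OF c0(1)]] by auto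
    have "inverse a * z = z * inverse a'" "inverse a' = a" using swap [OF c0(1) a(2) a'] by auto
    then have "z * (inverse a - a) = 0" by (simp add: algebra_simps)
    moreover have "inverse a \<noteq> a" using nonscalar [OF Q, of a] a by auto
    ultimately show ?thesis by simp
  qed
  then have "conj_rep Q u = antidiag_SL2 (- 1)" using U by simp
  with Q u diag show ?thesis using that by blast
qed

section \<open>Finite order of the entries\<close>

theorem monomial_form:
  obtains Q p where "Q \<in> carrier (SL 2)" "p > 0"
    and "\<And>c. c \<in> derived G (carrier G) \<Longrightarrow> \<exists>a. a \<noteq> 0 \<and> conj_rep Q c = diag_SL2 a"
    and "\<And>\<gamma>. \<gamma> \<in> carrier G \<Longrightarrow> \<exists>a. a \<noteq> 0 \<and> a ^ (2 * p) = 1 \<and> (conj_rep Q \<gamma> = diag_SL2 a \<or> conj_rep Q \<gamma> = antidiag_SL2 a)"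
proof -
  obtain Q u where Q: "Q \<in> carrier (SL 2)" and u: "u \<in> carrier G" "\<alpha> u = 1" "conj_rep Q u = antidiag_SL2 (- 1)"
    and diag: "\<And>c. c \<in> derived G (carrier G) \<Longrightarrow> \<exists>a. a \<noteq> 0 \<and> conj_rep Q c = diag_SL2 a"
    using exists_monomial_conjugate by metis
  have "carrier G \<subseteq> {\<gamma> \<in> carrier G. conj_rep Q \<gamma> \<in> monomial_SL2}"
  proof (rule subgroup_eq_carrier)
    show "subgroup {\<gamma> \<in> carrier G. conj_rep Q \<gamma> \<in> monomial_SL2} G"
      by (rule subgroup_conj_rep_vimage [OF Q subgroup_monomial_SL2])
    show "derived G (carrier G) \<subseteq> {\<gamma> \<in> carrier G. conj_rep Q \<gamma> \<in> monomial_SL2}"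
      using diag derived_iff by (auto simp: monomial_SL2_def)
    show "u \<in> {\<gamma> \<in> carrier G. conj_rep Q \<gamma> \<in> monomial_SL2}"
      using u by (auto simp: monomial_SL2_def intro!: exI [of _ "- 1"])
  qed (use u in simp)
  then have mono: "\<exists>a. a \<noteq> 0 \<and> (conj_rep Q \<gamma> = diag_SL2 a \<or> conj_rep Q \<gamma> = antidiag_SL2 a)"
    if "\<gamma> \<in> carrier G" for \<gamma> using that by (auto simp: monomial_SL2_def)
  \<comment> \<open>One of the two entries is zero, so \<open>e\<close> takes the value a^2 at
    \<open>diag_SL2 a\<close> and a^(-2) at \<open>antidiag_SL2 a\<close>. Squaring hides the sign
    in \<open>antidiag_mult\<close> and leaves only a possible inversion of the left factor.\<close>
  define e where "e \<gamma> = (conj_rep Q \<gamma> $$ (0, 0) + conj_rep Q \<gamma> $$ (1, 0))\<^sup>2" for \<gamma>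
  have e_nz: "e \<gamma> \<noteq> 0" if "\<gamma> \<in> carrier G" for \<gamma> using mono [OF that] by (auto simp: e_def)
  have e_mult: "e (\<gamma> \<otimes> \<delta>) = e \<delta> * e \<gamma> \<or> e (\<gamma> \<otimes> \<delta>) = e \<delta> * inverse (e \<gamma>)"
    if "\<gamma> \<in> carrier G" "\<delta> \<in> carrier G" for \<gamma> \<delta>
    using mono [OF that(1)] mono [OF that(2)] that
    by (auto simp: e_def conj_rep_mult [OF Q] monomial_mult power_mult_distrib power_inverse)
  have e_one: "e \<one> = 1" by (simp add: e_def conj_rep_one [OF Q])
  have e_inv: "e (inv \<gamma>) = e \<gamma> \<or> e (inv \<gamma>) = inverse (e \<gamma>)" if "\<gamma> \<in> carrier G" for \<gamma>
    using e_mult [OF that inv_closed [OF that]] e_nz [OF that] that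
    by (auto simp: e_one field_simps)
  define z where "z i = e (g i)" for i
  \<comment> \<open>The group generated by the \<open>z j\<close>, with explicit exponent vectors,
    since these become the rows of the integer matrix in
    \<open>roots_of_unity_if_squares\<close>.\<close>
  define Z where "Z = {(\<Prod>j<k. z j powi n j) |n. True}"
  have z_nz: "z i \<noteq> 0" if "i < k" for i using e_nz [OF g_closed [OF that]] by (simp add: z_def)
  have Z_mult: "v * w \<in> Z" if vw: "v \<in> Z" "w \<in> Z" for v w
  proof -
    obtain n m where "v = (\<Prod>j<k. z j powi n j)" "w = (\<Prod>j<k. z j powi m j)" using vw by (auto simp: Z_def)
    then have "v * w = (\<Prod>j<k. z j powi (n j + m j))"
      using z_nz by (simp add: power_int_add prod.distrib)
    then show ?thesis by (auto simp: Z_def)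
  qed
  have Z_inv: "inverse v \<in> Z" if v: "v \<in> Z" for v
  proof -
    obtain n where "v = (\<Prod>j<k. z j powi n j)" using v by (auto simp: Z_def)
    then have "inverse v = (\<Prod>j<k. z j powi (- n j))"
      by (simp add: power_int_minus prod_inversef [symmetric] comp_def)
    then show ?thesis by (auto simp: Z_def)
  qed
  have Z_one: "1 \<in> Z" by (auto simp: Z_def intro!: exI [of _ "\<lambda>_. 0"])
  have Z_gen: "z i \<in> Z" if i: "i < k" for i
  proof -
    have "(\<Prod>j<k. z j powi (if j = i then 1 else 0)) = z i"
      using i by (simp add: if_distrib [of "(powi) _"] cong: if_cong)
    then show ?thesis
      unfolding Z_def by (intro CollectI exI [of _ "\<lambda>j. if j = i then 1 else 0"]) simp
  qed
  have e_Z: "e \<gamma> \<in> Z" if "\<gamma> \<in> carrier G" for \<gamma>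
    using that
  proof (induction rule: generator_induct)
    case (gen i b \<delta>)
    let ?l = "letter_eval G g (i, b)"
    have l: "?l \<in> carrier G" using letter_eval_closed [OF gen(1)] .
    have "e ?l \<in> Z"
      using Z_gen [OF gen(1)] Z_inv e_inv [OF g_closed [OF gen(1)]] by (auto simp: z_def)
    then show ?case using e_mult [OF l gen(2)] gen(3) Z_mult Z_inv by metis
  qed (simp add: e_one Z_one)
  \<comment> \<open>The kernel of \<open>e\<close> modulo squares of \<open>Z\<close>. It also
    contains \<open>u\<close>, at which \<open>e\<close> is 1, and hence everything.\<close>
  define T where "T = {\<gamma> \<in> carrier G. \<exists>v\<in>Z. e \<gamma> = v\<^sup>2}"
  have T: "subgroup T G"
  proof (rule subgroupI)
    show "T \<noteq> {}" using e_one Z_one by (auto simp: T_def intro!: exI [of _ \<one>] bexI [of _ 1])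
  next
    fix \<gamma> assume "\<gamma> \<in> T"
    then obtain v where "\<gamma> \<in> carrier G" "v \<in> Z" "e \<gamma> = v\<^sup>2" by (auto simp: T_def)
    then show "inv \<gamma> \<in> T"
      using e_inv [of \<gamma>] Z_inv [of v] by (auto simp: T_def simp flip: power_inverse)
  next
    fix \<gamma> \<delta> assume "\<gamma> \<in> T" "\<delta> \<in> T"
    then obtain v w where "\<gamma> \<in> carrier G" "v \<in> Z" "e \<gamma> = v\<^sup>2" "\<delta> \<in> carrier G" "w \<in> Z" "e \<delta> = w\<^sup>2"
      by (auto simp: T_def)
    moreover from this have "w * v \<in> Z" "w * inverse v \<in> Z" using Z_mult Z_inv by auto
    moreover have "e (\<gamma> \<otimes> \<delta>) = (w * v)\<^sup>2 \<or> e (\<gamma> \<otimes> \<delta>) = (w * inverse v)\<^sup>2"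
      using e_mult [of \<gamma> \<delta>] calculation by (simp add: power_mult_distrib power_inverse)
    ultimately show "\<gamma> \<otimes> \<delta> \<in> T" by (auto simp: T_def)
  qed (auto simp: T_def)
  have "derived G (carrier G) \<subseteq> T"
    unfolding derived_def
  proof (rule generate_subgroup_incl [OF _ T])
    show "derived_set G (carrier G) \<subseteq> T"
    proof safe
      fix a b assume ab: "a \<in> carrier G" "b \<in> carrier G"
      \<comment> \<open>In the value of \<open>e\<close> at a commutator, \<open>a\<close> and its
        inverse each contribute \<open>e a\<close> or its inverse, and likewise for
        \<open>b\<close>. Two such contributions multiply to a square: w^2, w^(-2) or 1.\<close>
      define pm where "pm x w \<longleftrightarrow> x = w \<or> x = inverse w" for x w :: complex
      have sq: "\<exists>v\<in>Z. x * y = v\<^sup>2" if "w \<in> Z" "w \<noteq> 0" "pm x w" "pm y w" for x y w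
        using that Z_one Z_inv [of w] by (auto simp: pm_def power2_eq_square intro: bexI [of _ 1])
      have pm_inv: "pm (inverse x) w" if "pm x w" for x w using that by (auto simp: pm_def)
      have pm_ab: "pm (e (inv a)) (e a)" "pm (e (inv b)) (e b)" using e_inv ab by (auto simp: pm_def)
      have "\<exists>x y. pm x (e a) \<and> pm y (e b) \<and> e (a \<otimes> b) = x * y"
        using e_mult [OF ab] unfolding pm_def by (metis mult.commute)
      then obtain x1 y1 where 1: "pm x1 (e a)" "pm y1 (e b)" "e (a \<otimes> b) = x1 * y1" by blast
      have "\<exists>x y. pm x (e a) \<and> pm y (e b) \<and> e (a \<otimes> b \<otimes> inv a) = e (inv a) * (x * y)"
        using e_mult [of "a \<otimes> b" "inv a"] 1 pm_inv ab by (simp add: inverse_mult_distrib) metis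
      then obtain x2 y2 where 2: "pm x2 (e a)" "pm y2 (e b)" "e (a \<otimes> b \<otimes> inv a) = e (inv a) * (x2 * y2)" by blast
      have "\<exists>x x' y. pm x (e a) \<and> pm x' (e a) \<and> pm y (e b) \<and> e (a \<otimes> b \<otimes> inv a \<otimes> inv b) = e (inv b) * (x * (x' * y))"
        using e_mult [of "a \<otimes> b \<otimes> inv a" "inv b"] 2 pm_inv ab pm_ab(1) by (simp add: inverse_mult_distrib) metis
      then obtain x x' y where 3: "pm x (e a)" "pm x' (e a)" "pm y (e b)"
        "e (a \<otimes> b \<otimes> inv a \<otimes> inv b) = e (inv b) * (x * (x' * y))" by blast
      obtain v where v: "v \<in> Z" "x * x' = v\<^sup>2"
        using sq [OF e_Z [OF ab(1)] e_nz [OF ab(1)] 3(1,2)] by blast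
      obtain w where w: "w \<in> Z" "e (inv b) * y = w\<^sup>2"
        using sq [OF e_Z [OF ab(2)] e_nz [OF ab(2)] pm_ab(2) 3(3)] by blast
      have "e (a \<otimes> b \<otimes> inv a \<otimes> inv b) = (x * x') * (e (inv b) * y)" using 3(4) by simp
      also have "\<dots> = (v * w)\<^sup>2" unfolding v w by (simp add: power_mult_distrib)
      finally show "a \<otimes> b \<otimes> inv a \<otimes> inv b \<in> T"
        using ab Z_mult [OF v(1) w(1)] by (auto simp: T_def)
    qed
  qed
  moreover have "u \<in> T"
    using u(1,3) Z_one by (auto simp: T_def e_def intro!: bexI [of _ 1])
  ultimately have "carrier G \<subseteq> T"
    using T u(2) by (intro subgroup_eq_carrier)
  \<comment> \<open>At the generators, membership in \<open>T\<close> becomes a closed system of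
    relations among the finitely many \<open>z i\<close>.\<close>
  then have "\<exists>n. z i = (\<Prod>j<k. z j powi n j)\<^sup>2" if "i < k" for i
    using g_closed [OF that] by (auto simp: T_def Z_def z_def)
  then obtain n where "\<And>i. i < k \<Longrightarrow> z i = (\<Prod>j<k. z j powi n i j)\<^sup>2" by metis
  then obtain p where p: "p > 0" "\<And>i. i < k \<Longrightarrow> z i ^ p = 1"
    using roots_of_unity_if_squares [of k z n] z_nz by blast
  have "v ^ p = 1" if v: "v \<in> Z" for v
  proof -
    obtain n where n: "v = (\<Prod>j<k. z j powi n j)" using v by (auto simp: Z_def)
    have "(z j powi n j) ^ p = 1" if "j < k" for j
    proof -
      have "(z j powi n j) ^ p = z j powi (int p * n j)"
        by (metis mult.commute power_int_mult power_int_of_nat)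
      also have "\<dots> = (z j ^ p) powi n j" by (simp add: power_int_mult)
      finally show ?thesis using p(2) [OF that] by simp
    qed
    then show ?thesis by (simp add: n prod_power_distrib)
  qed
  then have e_p: "e \<gamma> ^ p = 1" if "\<gamma> \<in> carrier G" for \<gamma> using e_Z [OF that] by simp
  have "\<exists>a. a \<noteq> 0 \<and> a ^ (2 * p) = 1 \<and> (conj_rep Q \<gamma> = diag_SL2 a \<or> conj_rep Q \<gamma> = antidiag_SL2 a)"
    if \<gamma>: "\<gamma> \<in> carrier G" for \<gamma>
  proof -
    obtain a where a: "a \<noteq> 0" "conj_rep Q \<gamma> = diag_SL2 a \<or> conj_rep Q \<gamma> = antidiag_SL2 a" using mono [OF \<gamma>] by auto
    then have "a ^ (2 * p) = 1"
      using e_p [OF \<gamma>] by (auto simp: e_def power_mult power_inverse)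
    then show ?thesis using a by blast
  qed
  then show ?thesis using that [OF Q p(1) diag] by blast
qed

end

section \<open>The asymptotic formula\<close>

lemma path_class_eqI: "homotopic_paths X p q \<Longrightarrow> path_class X p = path_class X q"
  unfolding path_class_def using homotopic_paths_sym homotopic_paths_trans by blast

lemma loops_at_homotopic_paths: "p \<in> loops_at X x \<Longrightarrow> homotopic_paths X p p"
  by (simp add: loops_at_def)

lemma loops_at_join: "p \<in> loops_at X x \<Longrightarrow> q \<in> loops_at X x \<Longrightarrow> p +++ q \<in> loops_at X x"
  by (simp add: loops_at_def path_image_join)

text \<open>All members of the double union are the same class, and both index sets are
  nonempty.\<close>

lemma fundamental_group_mult:
  assumes "p \<in> loops_at X x" "q \<in> loops_at X x"
  shows "path_class X p \<otimes>\<^bsub>fundamental_group X x\<^esub> path_class X q = path_class X (p +++ q)"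
proof -
  have eq: "path_class X (p' +++ q') = path_class X (p +++ q)"
    if p': "p' \<in> path_class X p" and q': "q' \<in> path_class X q" for p' q'
  proof -
    have "homotopic_paths X p p'" "homotopic_paths X q q'" "pathfinish p = pathstart q"
      using p' q' assms by (auto simp: path_class_def loops_at_def)
    then have "homotopic_paths X (p +++ q) (p' +++ q')" by (rule homotopic_paths_join)
    then show ?thesis by (rule path_class_eqI [symmetric])
  qed
  have "p \<in> path_class X p" "q \<in> path_class X q"
    using assms by (simp_all add: path_class_def loops_at_homotopic_paths del: homotopic_paths_refl)
  then have ne: "path_class X p \<noteq> {}" "path_class X q \<noteq> {}" by blast+
  have "path_class X p \<otimes>\<^bsub>fundamental_group X x\<^esub> path_class X q =
      (\<Union>p'\<in>path_class X p. \<Union>q'\<in>path_class X q. path_class X (p' +++ q'))"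
    by (simp add: fundamental_group_def)
  also have "\<dots> = (\<Union>p'\<in>path_class X p. \<Union>q'\<in>path_class X q. path_class X (p +++ q))"
    by (intro SUP_cong HOL.refl eq)
  also have "\<dots> = path_class X (p +++ q)" by (simp only: UN_constant ne if_False)
  finally show ?thesis .
qed

lemma group_fundamental_group:
  fixes x :: "'a :: real_normed_vector"
  assumes "x \<in> X"
  shows "group (fundamental_group X x)"
proof -
  let ?G = "fundamental_group X x"
  have carrier: "carrier ?G = path_class X ` loops_at X x"
    and one: "\<one>\<^bsub>?G\<^esub> = path_class X (linepath x x)"
    by (simp_all add: fundamental_group_def linepath_refl)
  have rep: "\<exists>p. p \<in> loops_at X x \<and> a = path_class X p" if "a \<in> carrier ?G" for a
    using that by (auto simp: carrier)
  have const: "linepath x x \<in> loops_at X x" using assms by (simp add: loops_at_def)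
  show ?thesis
  proof (rule groupI)
    fix a b assume a: "a \<in> carrier ?G" and b: "b \<in> carrier ?G"
    obtain p q where pq: "p \<in> loops_at X x" "a = path_class X p" "q \<in> loops_at X x" "b = path_class X q"
      using rep [OF a] rep [OF b] by blast
    show "a \<otimes>\<^bsub>?G\<^esub> b \<in> carrier ?G"
      unfolding pq(2,4) fundamental_group_mult [OF pq(1,3)] carrier
      by (rule imageI) (rule loops_at_join [OF pq(1,3)])
  next
    fix a b c assume a: "a \<in> carrier ?G" and b: "b \<in> carrier ?G" and c: "c \<in> carrier ?G"
    obtain p where p: "p \<in> loops_at X x" "a = path_class X p" using rep [OF a] by blast
    obtain q where q: "q \<in> loops_at X x" "b = path_class X q" using rep [OF b] by blast
    obtain r where r: "r \<in> loops_at X x" "c = path_class X r" using rep [OF c] by blast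
    have "homotopic_paths X (p +++ (q +++ r)) ((p +++ q) +++ r)"
      by (rule homotopic_paths_assoc) (use p(1) q(1) r(1) in \<open>simp_all add: loops_at_def\<close>)
    then have assoc: "path_class X (p +++ (q +++ r)) = path_class X ((p +++ q) +++ r)"
      by (rule path_class_eqI)
    then show "a \<otimes>\<^bsub>?G\<^esub> b \<otimes>\<^bsub>?G\<^esub> c = a \<otimes>\<^bsub>?G\<^esub> (b \<otimes>\<^bsub>?G\<^esub> c)"
      unfolding p(2) q(2) r(2) by (simp only: fundamental_group_mult loops_at_join p(1) q(1) r(1) assoc)
  next
    fix a assume a: "a \<in> carrier ?G"
    obtain p where p: "p \<in> loops_at X x" "a = path_class X p" using rep [OF a] by blast
    have "homotopic_paths X (linepath x x +++ p) p"
      using p by (intro homotopic_paths_lid') (auto simp: loops_at_def)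
    then have "path_class X (linepath x x +++ p) = path_class X p" by (rule path_class_eqI)
    then show "\<one>\<^bsub>?G\<^esub> \<otimes>\<^bsub>?G\<^esub> a = a"
      using p const by (simp add: one fundamental_group_mult)
    have rev: "reversepath p \<in> loops_at X x" using p by (simp add: loops_at_def)
    have "homotopic_paths X (reversepath p +++ p) (linepath x x)"
      using p homotopic_paths_linv [of p X] by (auto simp: loops_at_def)
    then have "path_class X (reversepath p +++ p) = path_class X (linepath x x)" by (rule path_class_eqI)
    then have "path_class X (reversepath p) \<otimes>\<^bsub>?G\<^esub> a = \<one>\<^bsub>?G\<^esub>"
      using p rev by (simp add: one fundamental_group_mult)
    then show "\<exists>b\<in>carrier ?G. b \<otimes>\<^bsub>?G\<^esub> a = \<one>\<^bsub>?G\<^esub>"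
      using rev by (intro bexI [of _ "path_class X (reversepath p)"]) (simp_all add: carrier)
  qed (use const in \<open>auto simp: carrier one\<close>)
qed

section \<open>Values of rational functions\<close>

text \<open>The given quotient may have common factors: by coprimality the reduced numerator and
  denominator divide \<open>a\<close> and \<open>b\<close>, so they cannot vanish at z
  either.\<close>

lemma no_zero_or_pole_fractI:
  assumes f: "f = to_fract a / to_fract b" and nz: "poly a z \<noteq> 0" "poly b z \<noteq> 0"
  shows "no_zero_or_pole f z" and "rat_eval f z = poly a z / poly b z"
proof -
  define n where "n = fst (quot_of_fract f)"
  define d where "d = snd (quot_of_fract f)"
  have "f = to_fract n / to_fract d" by (simp add: n_def d_def flip: Fract_conv_to_fract)
  moreover have "d \<noteq> 0" by (simp add: d_def)
  moreover have "b \<noteq> 0" using nz by auto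
  ultimately have "to_fract (a * d) = to_fract (n * b)"
    using f by (simp add: frac_eq_eq)
  then have eq: "a * d = n * b" by (simp only: to_fract_eq_iff)
  have cop: "coprime n d" unfolding n_def d_def by (rule coprime_quot_of_fract)
  have "n dvd a * d" by (simp add: eq)
  then have "n dvd a" using cop by (simp add: coprime_dvd_mult_left_iff)
  then have n: "poly n z \<noteq> 0" using nz by (auto elim!: dvdE)
  have "d dvd n * b" by (simp flip: eq)
  then have "d dvd b" using cop by (simp add: coprime_dvd_mult_right_iff coprime_commute)
  then have d: "poly d z \<noteq> 0" using nz by (auto elim!: dvdE)
  show "no_zero_or_pole f z" using n d by (simp add: no_zero_or_pole_def n_def d_def)
  have "poly a z * poly d z = poly n z * poly b z" by (metis eq poly_mult)
  then show "rat_eval f z = poly a z / poly b z"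
    using d nz by (simp add: rat_eval_def frac_eq_eq flip: n_def d_def)
qed

lemma no_zero_or_poleE:
  assumes "no_zero_or_pole f z"
  obtains a b where "f = to_fract a / to_fract b" "poly a z \<noteq> 0" "poly b z \<noteq> 0"
    "rat_eval f z = poly a z / poly b z"
proof (rule that)
  show "f = to_fract (fst (quot_of_fract f)) / to_fract (snd (quot_of_fract f))"
    by (simp flip: Fract_conv_to_fract)
qed (use assms in \<open>simp_all add: no_zero_or_pole_def rat_eval_def\<close>)

lemma no_zero_or_pole_mult:
  assumes "no_zero_or_pole f z" "no_zero_or_pole g z"
  shows "no_zero_or_pole (f * g) z" "rat_eval (f * g) z = rat_eval f z * rat_eval g z"
proof -
  obtain a b where f: "f = to_fract a / to_fract b" "poly a z \<noteq> 0" "poly b z \<noteq> 0"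
    "rat_eval f z = poly a z / poly b z" using assms(1) by (rule no_zero_or_poleE)
  obtain c d where g: "g = to_fract c / to_fract d" "poly c z \<noteq> 0" "poly d z \<noteq> 0"
    "rat_eval g z = poly c z / poly d z" using assms(2) by (rule no_zero_or_poleE)
  have "f * g = to_fract (a * c) / to_fract (b * d)" by (simp add: f(1) g(1))
  note * = no_zero_or_pole_fractI [OF this, of z]
  show "no_zero_or_pole (f * g) z" "rat_eval (f * g) z = rat_eval f z * rat_eval g z"
    using * f g by auto
qed

lemma no_zero_or_pole_inverse:
  assumes "no_zero_or_pole f z"
  shows "no_zero_or_pole (inverse f) z"
proof -
  obtain a b where f: "f = to_fract a / to_fract b" "poly a z \<noteq> 0" "poly b z \<noteq> 0"
    using assms by (rule no_zero_or_poleE)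
  then have "inverse f = to_fract b / to_fract a" by simp
  then show ?thesis using f(2,3) by (intro no_zero_or_pole_fractI)
qed

lemma no_zero_or_pole_one: "no_zero_or_pole 1 z" "rat_eval 1 z = 1"
  by (simp_all add: no_zero_or_pole_def rat_eval_def)

lemma no_zero_or_pole_0 [simp]: "\<not> no_zero_or_pole 0 z"
  by (simp add: no_zero_or_pole_def)

lemma rat_eval_nonzero: "no_zero_or_pole f z \<Longrightarrow> rat_eval f z \<noteq> 0"
  by (simp add: no_zero_or_pole_def rat_eval_def)

lemma no_zero_or_pole_prod:
  assumes "\<And>i. i \<in> A \<Longrightarrow> no_zero_or_pole (f i) z"
  shows "no_zero_or_pole (prod f A) z \<and> rat_eval (prod f A) z = (\<Prod>i\<in>A. rat_eval (f i) z)"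
  using assms
  by (induction A rule: infinite_finite_induct) (auto simp: no_zero_or_pole_one no_zero_or_pole_mult)

section \<open>Means of periodic sequences\<close>

lemma periodic_mod:
  fixes a :: "nat \<Rightarrow> 'a"
  assumes "\<And>m. a (m + p) = a m"
  shows "a m = a (m mod p)"
proof -
  have "a (r + n * p) = a r" for r n
    by (induction n) (simp_all add: assms add.commute [of p] flip: add.assoc)
  then show ?thesis by (metis mod_div_mult_eq)
qed

text \<open>Once the linear trend given by the mean is subtracted, the partial sums are periodic,
  hence bounded, and their quotient by 2N tends to zero.\<close>

lemma periodic_mean_tendsto:
  fixes a :: "nat \<Rightarrow> 'a :: real_normed_field"
  assumes p: "p > 0" and per: "\<And>m. a (m + p) = a m"
  shows "(\<lambda>N. (\<Sum>m<N. a m) / (2 * of_nat N)) \<longlonglongrightarrow> (1 / (2 * of_nat p)) * (\<Sum>m<p. a m)"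
proof -
  define S where "S = (\<Sum>m<p. a m)"
  define d where "d N = (\<Sum>m<N. a m) - of_nat N / of_nat p * S" for N
  have split: "(\<Sum>m<N + p. a m) = S + (\<Sum>m<N. a m)" for N
    by (induction N) (simp_all add: S_def per)
  have "d (N + p) = d N" for N
    using p by (simp add: d_def split add_divide_distrib distrib_right)
  then have dmod: "d N = d (N mod p)" for N by (rule periodic_mod)
  define B where "B = (\<Sum>r<p. norm (d r))"
  have bound: "norm (d N) \<le> B" for N
    unfolding dmod [of N] B_def using p by (intro member_le_sum) auto
  have lim: "(\<lambda>N. d N / (2 * of_nat N)) \<longlonglongrightarrow> 0"
  proof (rule Lim_null_comparison)
    show "\<forall>\<^sub>F N in sequentially. norm (d N / (2 * of_nat N)) \<le> B / real N"
    proof (rule always_eventually, rule allI)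
      fix N
      have "norm (d N / (2 * of_nat N)) = norm (d N) / (2 * real N)"
        by (simp add: norm_divide norm_mult)
      also have "\<dots> \<le> B / (2 * real N)" by (intro divide_right_mono bound) simp
      also have "\<dots> \<le> B / real N"
        using bound [of 0] norm_ge_zero [of "d 0"] by (cases "N = 0") (auto simp: field_simps simp del: norm_ge_zero)
      finally show "norm (d N / (2 * of_nat N)) \<le> B / real N" .
    qed
    show "(\<lambda>N. B / real N) \<longlonglongrightarrow> 0" by (rule lim_const_over_n)
  qed
  have "\<forall>\<^sub>F N in sequentially. (1 / (2 * of_nat p)) * S + d N / (2 * of_nat N) = (\<Sum>m<N. a m) / (2 * of_nat N)"
    using eventually_gt_at_top [of 0]
  proof eventually_elim
    case (elim N)
    then show ?case using p by (simp add: d_def field_simps)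
  qed
  then show ?thesis
    using tendsto_add [OF tendsto_const [of "(1 / (2 * of_nat p)) * S"] lim]
    by (simp add: S_def Lim_transform_eventually)
qed

text \<open>Each factor is a quotient of consecutive products, so a point that is neither zero nor
  pole of any \<open>F N\<close> is neither for any \<open>f m\<close>. Logarithms of
  \<open>F N\<close> are partial sums of a periodic sequence, so both halves of
  \<open>log_limit_eq\<close> reduce to \<open>periodic_mean_tendsto\<close>.\<close>

lemma log_limit_eq_periodic_product:
  assumes p: "p > 0" and per: "\<And>m. f (m + p) = f m"
    and F: "\<And>N. N \<ge> 1 \<Longrightarrow> F N = (\<Prod>m<N. f m)"
    and h: "\<And>m. m < p \<Longrightarrow> h (Suc m) = f m"
  shows "log_limit_eq F (1 / (2 * real p)) p h"
  unfolding log_limit_eq_def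
proof (intro conjI allI impI)
  fix z assume z: "z \<noteq> 0 \<and> (\<forall>N\<ge>1. no_zero_or_pole (F N) z)"
  have nzp: "no_zero_or_pole (f m) z" for m
  \<comment> \<open>The product formula starts at N = 1, so \<open>f 0\<close> is read off from
    \<open>F 1\<close> and not as a quotient by \<open>F 0\<close>.\<close>
  proof (cases "m = 0")
    case True
    then show ?thesis using z F [of 1] by (metis le_refl prod.lessThan_Suc lessThan_0 prod.empty One_nat_def mult_1)
  next
    case False
    then have m: "no_zero_or_pole (F m) z" "no_zero_or_pole (F (Suc m)) z" using z by auto
    have "F (Suc m) = F m * f m" using F [of m] F [of "Suc m"] False by simp
    moreover have "F m \<noteq> 0" using m(1) by auto
    ultimately have "f m = F (Suc m) * inverse (F m)" by simp
    then show ?thesis using m no_zero_or_pole_mult no_zero_or_pole_inverse by metis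
  qed
  show "\<forall>j\<in>{1..p}. no_zero_or_pole (h j) z"
  proof
    fix j assume "j \<in> {1..p}"
    then have "h j = f (j - 1)" using h [of "j - 1"] by auto
    then show "no_zero_or_pole (h j) z" using nzp by simp
  qed
  define a where "a m = ln (cmod (rat_eval (f m) z))" for m
  have "(\<lambda>N. (\<Sum>m<N. a m) / (2 * real N)) \<longlonglongrightarrow> (1 / (2 * real p)) * (\<Sum>m<p. a m)"
    using p per by (intro periodic_mean_tendsto) (simp_all add: a_def)
  moreover have "(\<Sum>m<p. a m) = (\<Sum>j = 1..p. ln (cmod (rat_eval (h j) z)))"
    by (simp add: sum.atLeast1_atMost_eq a_def h)
  moreover have "\<forall>\<^sub>F N in sequentially. (\<Sum>m<N. a m) / (2 * real N) = ln (cmod (rat_eval (F N) z)) / (2 * real N)"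
    using eventually_ge_at_top [of 1]
  proof eventually_elim
    case (elim N)
    have "rat_eval (F N) z = (\<Prod>m<N. rat_eval (f m) z)"
      using no_zero_or_pole_prod [of "{..<N}" f z] nzp F [OF elim] by simp
    then have "cmod (rat_eval (F N) z) = (\<Prod>m<N. cmod (rat_eval (f m) z))"
      by (simp add: prod_norm)
    moreover have "ln (\<Prod>m<N. cmod (rat_eval (f m) z)) = (\<Sum>m<N. a m)"
      using rat_eval_nonzero [OF nzp] by (subst ln_prod) (auto simp: a_def)
    ultimately show ?case by simp
  qed
  ultimately show "(\<lambda>N. ln (cmod (rat_eval (F N) z)) / (2 * real N))
      \<longlonglongrightarrow> 1 / (2 * real p) * (\<Sum>j = 1..p. ln (cmod (rat_eval (h j) z)))"
    by (simp add: Lim_transform_eventually)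
next
  fix D l assume D: "open D \<and> 0 \<notin> D \<and> (\<forall>j\<in>{1..p}. log_branch_on D (h j) (l j))"
  \<comment> \<open>The given branches, numbered from 1, are repeated with period p; taking the same
    branch for equal factors keeps the summands periodic, imaginary parts included.\<close>
  define b where "b m = l (Suc (m mod p))" for m
  have b: "log_branch_on D (f m) (b m)" for m
  proof -
    have "m mod p < p" using p by simp
    then have "h (Suc (m mod p)) = f m" using h periodic_mod [of f p m, OF per] by simp
    then show ?thesis using D \<open>m mod p < p\<close> unfolding b_def by (metis Suc_leI atLeastAtMost_iff le_add1 plus_1_eq_Suc)
  qed
  define L where "L N z = (\<Sum>m<N. b m z)" for N z
  show "\<exists>L. (\<forall>N\<ge>1. log_branch_on D (F N) (L N)) \<and>
      (\<forall>z\<in>D. (\<lambda>N. L N z / (2 * of_nat N))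
        \<longlonglongrightarrow> complex_of_real (1 / (2 * real p)) * (\<Sum>j = 1..p. l j z))"
  proof (intro exI [of _ L] conjI allI impI ballI)
    fix N :: nat assume N: "N \<ge> 1"
    show "log_branch_on D (F N) (L N)"
      unfolding log_branch_on_def
    proof (intro conjI ballI)
      show "L N holomorphic_on D"
        unfolding L_def using b by (intro holomorphic_on_sum) (simp add: log_branch_on_def)
      fix z assume z: "z \<in> D"
      then have nzp: "no_zero_or_pole (f m) z" "exp (b m z) = rat_eval (f m) z" for m
        using b [of m] by (auto simp: log_branch_on_def)
      show "no_zero_or_pole (F N) z" "exp (L N z) = rat_eval (F N) z"
        using no_zero_or_pole_prod [of "{..<N}" f z] nzp by (simp_all add: F [OF N] L_def exp_sum)
    qed
  next
    fix z assume "z \<in> D"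
    have "(\<lambda>N. (\<Sum>m<N. b m z) / (2 * of_nat N)) \<longlonglongrightarrow> (1 / (2 * of_nat p)) * (\<Sum>m<p. b m z)"
      using p by (intro periodic_mean_tendsto) (simp_all add: b_def)
    moreover have "(\<Sum>m<p. b m z) = (\<Sum>j = 1..p. l j z)"
      by (simp add: sum.atLeast1_atMost_eq b_def)
    ultimately show "(\<lambda>N. L N z / (2 * of_nat N)) \<longlonglongrightarrow> complex_of_real (1 / (2 * real p)) * (\<Sum>j = 1..p. l j z)"
      by (simp add: L_def)
  qed
qed

section \<open>Entrywise powers of a monomial representation\<close>

lemma entry_power_closed_monomial: "A \<in> monomial_SL2 \<Longrightarrow> odd e \<Longrightarrow> entry_power e A \<in> monomial_SL2"
proof -
  assume "A \<in> monomial_SL2" and e: "odd e"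
  then obtain a where a: "a \<noteq> 0" "A = diag_SL2 a \<or> A = antidiag_SL2 a"
    by (auto simp: monomial_SL2_def)
  then have "entry_power e A = diag_SL2 (a ^ e) \<or> entry_power e A = antidiag_SL2 (a ^ e)"
    using entry_power_monomial [OF e] by blast
  then show ?thesis using a(1) unfolding monomial_SL2_def by (intro CollectI exI [of _ "a ^ e"]) simp
qed

text \<open>Every entry of a product of two monomial matrices is a single product or zero. Entrywise
  powers, not multiplicative in general, therefore respect such products.\<close>

lemma entry_power_mult_monomial:
  assumes "A \<in> monomial_SL2" "B \<in> monomial_SL2" "odd e"
  shows "entry_power e (A * B) = entry_power e A * entry_power e B"
proof -
  obtain a b where "A = diag_SL2 a \<or> A = antidiag_SL2 a" "B = diag_SL2 b \<or> B = antidiag_SL2 b"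
    using assms by (auto simp: monomial_SL2_def)
  moreover have zero: "(0 :: complex) ^ e = 0" using odd_pos [OF assms(3)] by (rule zero_power)
  ultimately show ?thesis
    using assms(3)
    by (auto simp: zero entry_power_mat2 mat2_mult mat2_eq_iff power_mult_distrib power_inverse)
qed

lemma direct_sum_comp: "direct_sum (\<lambda>m x. f m (h x)) n N x = direct_sum f n N (h x)"
  by (induction N) simp_all

context metabelian_irreducible
begin

lemma mat_repI_SL:
  assumes "\<phi> \<in> hom G (SL n)"
  shows "mat_rep n \<phi>"
  using assms hom_one [OF assms is_group group_SL] by (auto simp: mat_rep_def hom_def SL_simps)

text \<open>The symmetric power of \<open>Q\<close>, followed by the pairing matrix, intertwines the
  symmetric power of \<open>\<rho>\<close> with the direct sum of the \<open>\<theta> m\<close>.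
  Working at one index throughout turns the quotient of products into the product of
  quotients.\<close>

theorem twisted_alexander_sym_powers:
  obtains \<theta> p where "p > 0" "\<And>m. metabelian_rep G (\<theta> m)"
    and "twisted_alexander G k g rs \<alpha> 2 \<rho> = twisted_alexander G k g rs \<alpha> 2 (\<theta> 0)"
    and "\<And>m. twisted_alexander G k g rs \<alpha> 2 (\<theta> (m + p)) = twisted_alexander G k g rs \<alpha> 2 (\<theta> m)"
    and "\<And>N. twisted_alexander G k g rs \<alpha> (2 * N) (\<lambda>\<gamma>. sym_power (2 * N) (\<rho> \<gamma>)) =
      (\<Prod>m<N. twisted_alexander G k g rs \<alpha> 2 (\<theta> m))"
proof -
  interpret SL2: group "SL 2" by (rule group_SL)
  obtain Q p where Q: "Q \<in> carrier (SL 2)" and p: "p > 0"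
    and diag: "\<And>c. c \<in> derived G (carrier G) \<Longrightarrow> \<exists>a. a \<noteq> 0 \<and> conj_rep Q c = diag_SL2 a"
    and mono: "\<And>\<gamma>. \<gamma> \<in> carrier G \<Longrightarrow> \<exists>a. a \<noteq> 0 \<and> a ^ (2 * p) = 1 \<and>
      (conj_rep Q \<gamma> = diag_SL2 a \<or> conj_rep Q \<gamma> = antidiag_SL2 a)"
    by (rule monomial_form) blast
  define \<theta> where "\<theta> m \<gamma> = entry_power (2 * m + 1) (conj_rep Q \<gamma>)" for m \<gamma>
  have M: "conj_rep Q \<gamma> \<in> monomial_SL2" if "\<gamma> \<in> carrier G" for \<gamma>
    using mono [OF that] by (auto simp: monomial_SL2_def)
  have \<theta>_mono: "\<theta> m \<gamma> \<in> monomial_SL2" if "\<gamma> \<in> carrier G" for m \<gamma>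
    unfolding \<theta>_def by (rule entry_power_closed_monomial [OF M [OF that]]) simp
  have \<theta>_mult: "\<theta> m (\<gamma> \<otimes> \<delta>) = \<theta> m \<gamma> * \<theta> m \<delta>" if "\<gamma> \<in> carrier G" "\<delta> \<in> carrier G" for m \<gamma> \<delta>
    unfolding \<theta>_def conj_rep_mult [OF Q that] using M that by (intro entry_power_mult_monomial) auto
  have \<theta>_hom: "\<theta> m \<in> hom G (SL 2)" for m
    using monomial_in_SL2 [OF \<theta>_mono] by (auto simp: hom_def SL_simps(2) \<theta>_mult)
  have \<theta>_diag: "\<theta> m c \<in> {diag_SL2 a |a. a \<noteq> 0}" if c: "c \<in> derived G (carrier G)" for m c
  proof -
    obtain a where a: "a \<noteq> 0" "conj_rep Q c = diag_SL2 a" using diag [OF c] by auto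
    have "\<theta> m c = diag_SL2 (a ^ (2 * m + 1))"
      unfolding \<theta>_def a(2) by (rule entry_power_monomial(1)) simp
    moreover have "a ^ (2 * m + 1) \<noteq> 0" using a(1) by simp
    ultimately show ?thesis by blast
  qed
  have \<theta>_metabelian: "metabelian_rep G (\<theta> m)" for m
    unfolding metabelian_rep_def using \<theta>_hom \<theta>_diag subgroup_diag_SL2 comm_group_diag_SL2
    by (intro conjI exI [of _ "{diag_SL2 a |a. a \<noteq> 0}"] image_subsetI)
  have \<theta>_0: "\<theta> 0 \<gamma> = conj_rep Q \<gamma>" for \<gamma> by (simp add: \<theta>_def) (auto intro: eq_matI)
  have \<theta>_period: "\<theta> (m + p) \<gamma> = \<theta> m \<gamma>" if \<gamma>: "\<gamma> \<in> carrier G" for m \<gamma>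
  proof -
    obtain a where a: "a ^ (2 * p) = 1" "conj_rep Q \<gamma> = diag_SL2 a \<or> conj_rep Q \<gamma> = antidiag_SL2 a"
      using mono [OF \<gamma>] by blast
    have "2 * (m + p) + 1 = (2 * m + 1) + 2 * p" by simp
    then have pow: "a ^ (2 * (m + p) + 1) = a ^ (2 * m + 1)" by (simp only: power_add a(1) mult_1_right)
    have odd: "odd (2 * (m + p) + 1)" "odd (2 * m + 1)" by simp_all
    show ?thesis
      unfolding \<theta>_def using a(2)
    proof
      assume A: "conj_rep Q \<gamma> = diag_SL2 a"
      show "entry_power (2 * (m + p) + 1) (conj_rep Q \<gamma>) = entry_power (2 * m + 1) (conj_rep Q \<gamma>)"
        unfolding A entry_power_monomial(1) [OF odd(1)] entry_power_monomial(1) [OF odd(2)] pow ..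
    next
      assume A: "conj_rep Q \<gamma> = antidiag_SL2 a"
      show "entry_power (2 * (m + p) + 1) (conj_rep Q \<gamma>) = entry_power (2 * m + 1) (conj_rep Q \<gamma>)"
        unfolding A entry_power_monomial(2) [OF odd(1)] entry_power_monomial(2) [OF odd(2)] pow ..
    qed
  qed
  have rep: "mat_rep 2 (\<theta> m)" "mat_rep 2 \<rho>" for m by (intro mat_repI_SL \<theta>_hom \<rho>_hom)+
  \<comment> \<open>At this index the denominators of \<open>\<rho>\<close> and of every
    \<open>\<theta> m\<close> are nonzero; that of the symmetric power will be a product of the
    latter.\<close>
  obtain l where l: "l < k" "\<alpha> (g l) \<noteq> 0" using exists_generator_nonzero by blast
  have den: "wada_denominator G g \<alpha> 2 \<phi> l \<noteq> 0" if "\<phi> \<in> hom G (SL 2)" for \<phi>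
  proof (rule wada_denominator_SL2_neq_0 [OF l])
    have "\<phi> (g l) \<in> carrier (SL 2)" using that g_closed [OF l(1)] by (auto simp: hom_def)
    then show "\<phi> (g l) \<in> carrier_mat 2 2" "det (\<phi> (g l)) = 1" by (auto simp: SL_simps)
    show "\<phi> \<one> = 1\<^sub>m 2" using mat_repI_SL [OF that] by (simp add: mat_rep_def)
  qed
  have Qc: "Q \<in> carrier_mat 2 2" "inv\<^bsub>SL 2\<^esub> Q \<in> carrier_mat 2 2"
    using Q SL2.inv_closed [OF Q] by (auto simp: SL_simps)
  have \<rho>0: "twisted_alexander G k g rs \<alpha> 2 \<rho> = twisted_alexander G k g rs \<alpha> 2 (\<theta> 0)"
    by (rule twisted_alexander_conjugate [OF rep(2,1) _ l(1) den [OF \<rho>_hom] Qc SL2_mult_inv [OF Q]])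
      (simp_all add: \<theta>_0 conj_rep_intertwine [OF Q])
  have period: "twisted_alexander G k g rs \<alpha> 2 (\<theta> (m + p)) = twisted_alexander G k g rs \<alpha> 2 (\<theta> m)" for m
  \<comment> \<open>The two maps are known to agree on the group only, not as functions on the whole
    type, so they are compared as conjugates under the identity matrix.\<close>
  proof (rule twisted_alexander_conjugate [OF rep(1,1) _ l(1) den [OF \<theta>_hom], of "1\<^sub>m 2" "1\<^sub>m 2"])
    fix \<gamma> assume \<gamma>: "\<gamma> \<in> carrier G"
    then have "\<theta> m \<gamma> \<in> carrier_mat 2 2" using rep by (simp add: mat_rep_def)
    then show "\<theta> (m + p) \<gamma> * 1\<^sub>m 2 = 1\<^sub>m 2 * \<theta> m \<gamma>" by (simp add: \<theta>_period [OF \<gamma>])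
  qed auto
  have product: "twisted_alexander G k g rs \<alpha> (2 * N) (\<lambda>\<gamma>. sym_power (2 * N) (\<rho> \<gamma>)) =
      (\<Prod>m<N. twisted_alexander G k g rs \<alpha> 2 (\<theta> m))" for N
  proof -
    define \<phi> where "\<phi> \<gamma> = sym_power (2 * N) (\<rho> \<gamma>)" for \<gamma>
    define SQ where "SQ = sym_power (2 * N) Q"
    define SQ' where "SQ' = sym_power (2 * N) (inv\<^bsub>SL 2\<^esub> Q)"
    let ?P = "pairing_mat N" and ?c = "carrier_mat (2 * N) (2 * N)"
    have c: "SQ \<in> ?c" "SQ' \<in> ?c" "?P \<in> ?c" "?P\<^sup>T \<in> ?c" by (simp_all add: SQ_def SQ'_def)
    have \<theta>c: "\<theta> m \<gamma> \<in> carrier_mat 2 2" if "\<gamma> \<in> carrier G" for m \<gamma>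
      using rep(1) that by (simp add: mat_rep_def)
    have ds: "direct_sum \<theta> 2 N \<gamma> \<in> ?c" if "\<gamma> \<in> carrier G" for \<gamma>
      using \<theta>c [OF that] by (rule direct_sum_carrier)
    have inv: "(SQ * ?P) * (?P\<^sup>T * SQ') = 1\<^sub>m (2 * N)"
    proof -
      have "(SQ * ?P) * (?P\<^sup>T * SQ') = SQ * (?P * (?P\<^sup>T * SQ'))"
        by (rule assoc_mult_mat [OF c(1) c(3) mult_carrier_mat [OF c(4) c(2)]])
      also have "?P * (?P\<^sup>T * SQ') = SQ'"
        unfolding assoc_mult_mat [OF c(3) c(4) c(2), symmetric] pairing_mat_orthogonal
        by (rule left_mult_one_mat [OF c(2)])
      also have "SQ * SQ' = sym_power (2 * N) (Q * inv\<^bsub>SL 2\<^esub> Q)"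
        using sym_power_mult [OF Q SL2.inv_closed [OF Q]] by (simp add: SQ_def SQ'_def)
      finally show ?thesis by (simp add: SL2_mult_inv [OF Q] sym_power_one)
    qed
    have eq: "\<phi> \<gamma> * (SQ * ?P) = (SQ * ?P) * direct_sum \<theta> 2 N \<gamma>" if \<gamma>: "\<gamma> \<in> carrier G" for \<gamma>
    proof -
      define R where "R = sym_power (2 * N) (conj_rep Q \<gamma>)"
      have Rc: "R \<in> ?c" "\<phi> \<gamma> \<in> ?c" by (simp_all add: R_def \<phi>_def)
      obtain a where a: "a \<noteq> 0" "conj_rep Q \<gamma> = diag_SL2 a \<or> conj_rep Q \<gamma> = antidiag_SL2 a"
        using mono [OF \<gamma>] by blast
      have RP: "R * ?P = ?P * direct_sum \<theta> 2 N \<gamma>"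
        unfolding R_def sym_power_monomial [OF a] \<theta>_def [abs_def]
          direct_sum_comp [where f = "\<lambda>m. entry_power (2 * m + 1)" and h = "conj_rep Q"] ..
      have "\<phi> \<gamma> * SQ = SQ * R"
        unfolding \<phi>_def SQ_def R_def
        using sym_power_mult [OF \<rho>_closed [OF \<gamma>] Q] sym_power_mult [OF Q conj_rep_closed [OF Q \<gamma>]]
          conj_rep_intertwine [OF Q \<gamma>] by metis
      then have "\<phi> \<gamma> * (SQ * ?P) = SQ * R * ?P"
        using assoc_mult_mat [OF Rc(2) c(1) c(3)] by simp
      also have "\<dots> = SQ * (R * ?P)" by (rule assoc_mult_mat [OF c(1) Rc(1) c(3)])
      also have "\<dots> = SQ * ?P * direct_sum \<theta> 2 N \<gamma>"
        unfolding RP by (rule assoc_mult_mat [OF c(1) c(3) ds [OF \<gamma>], symmetric])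
      finally show ?thesis .
    qed
    have carr: "SQ * ?P \<in> ?c" "?P\<^sup>T * SQ' \<in> ?c" by (rule mult_carrier_mat [OF c(1) c(3)], rule mult_carrier_mat [OF c(4) c(2)])
    have \<phi>c: "\<phi> \<gamma> \<in> ?c" for \<gamma> by (simp add: \<phi>_def)
    have num: "wada_numerator G g rs \<alpha> (2 * N) \<phi> l = (\<Prod>m<N. wada_numerator G g rs \<alpha> 2 (\<theta> m) l)"
    proof -
      have "wada_numerator G g rs \<alpha> (2 * N) \<phi> l = wada_numerator G g rs \<alpha> (2 * N) (direct_sum \<theta> 2 N) l"
        by (rule wada_intertwine(1) [OF carr inv]; (rule \<phi>c | erule ds | erule eq))
      also have "\<dots> = (\<Prod>m<N. wada_numerator G g rs \<alpha> 2 (\<theta> m) l)"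
        by (rule wada_direct_sum(1)) (rule \<theta>c, assumption)
      finally show ?thesis .
    qed
    have dn: "wada_denominator G g \<alpha> (2 * N) \<phi> l = (\<Prod>m<N. wada_denominator G g \<alpha> 2 (\<theta> m) l)"
    proof -
      have "wada_denominator G g \<alpha> (2 * N) \<phi> l = wada_denominator G g \<alpha> (2 * N) (direct_sum \<theta> 2 N) l"
        by (rule wada_intertwine(2) [OF carr inv _ _ _ l(1)]; (rule \<phi>c | erule ds | erule eq))
      also have "\<dots> = (\<Prod>m<N. wada_denominator G g \<alpha> 2 (\<theta> m) l)"
        by (rule wada_direct_sum(2)) (rule \<theta>c, assumption, rule l(1))
      finally show ?thesis .
    qed
    have "mat_rep (2 * N) \<phi>"
      using rep(2) \<rho>_closed by (auto simp: mat_rep_def \<phi>_def sym_power_one sym_power_mult)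
    then have "twisted_alexander G k g rs \<alpha> (2 * N) \<phi> =
        wada_numerator G g rs \<alpha> (2 * N) \<phi> l / wada_denominator G g \<alpha> (2 * N) \<phi> l"
      using den [OF \<theta>_hom] l by (intro twisted_alexander_eq) (auto simp: dn)
    also have "\<dots> = (\<Prod>m<N. twisted_alexander G k g rs \<alpha> 2 (\<theta> m))"
      unfolding num dn prod_dividef [symmetric]
      by (intro prod.cong HOL.refl twisted_alexander_eq [OF rep(1) _ l(1) den [OF \<theta>_hom], symmetric]) simp
    finally show ?thesis unfolding \<phi>_def .
  qed
  show ?thesis using that [OF p \<theta>_metabelian \<rho>0 period product] .
qed

end

theorem theorem3p2:
  fixes K :: "(real^4) set"
    and h :: "complex \<times> complex \<Rightarrow> real^4"
    and x\<^sub>0 :: "real^4"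
    and \<alpha> :: "(real \<Rightarrow> real^4) set \<Rightarrow> int"
    and k :: nat
    and g :: "nat \<Rightarrow> (real \<Rightarrow> real^4) set"
    and rs :: "group_word list"
    and \<rho> :: "(real \<Rightarrow> real^4) set \<Rightarrow> complex mat"
  defines "G \<equiv> fundamental_group (exterior h) x\<^sub>0"
  assumes "knot K"
    and "tubular_embedding K h"
    and "x\<^sub>0 \<in> exterior h"
    and "knot_abelianization h x\<^sub>0 \<alpha>"
    and "deficiency_one_presentation G k g rs"
    and "metabelian_rep G \<rho>"
    and "irreducible_rep G \<rho>"
  shows "\<exists>(p::nat) \<psi>.
    p \<ge> 1 \<and> (\<forall>j\<in>{1..p}. metabelian_rep G (\<psi> j)) \<and> \<psi> 1 = \<rho> \<and>
    log_limit_eq (\<lambda>N. twisted_alexander G k g rs \<alpha> (2 * N) (\<lambda>\<gamma>. sym_power (2 * N) (\<rho> \<gamma>)))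
      (1 / (2 * real p)) p (\<lambda>j. twisted_alexander G k g rs \<alpha> 2 (\<psi> j))"
proof -
  interpret group G
    unfolding G_def using \<open>x\<^sub>0 \<in> exterior h\<close> by (rule group_fundamental_group)
  have ab: "\<alpha> \<in> hom G integer_group" "\<alpha> ` carrier G = UNIV"
    "kernel G integer_group \<alpha> = derived G (carrier G)"
    using \<open>knot_abelianization h x\<^sub>0 \<alpha>\<close> by (simp_all only: knot_abelianization_def Let_def G_def)
  interpret metabelian_irreducible G \<alpha> k g rs \<rho>
    by unfold_locales fact+
  obtain \<theta> p where p: "p > 0" and \<theta>: "\<And>m. metabelian_rep G (\<theta> m)"
    "twisted_alexander G k g rs \<alpha> 2 \<rho> = twisted_alexander G k g rs \<alpha> 2 (\<theta> 0)"
    "\<And>m. twisted_alexander G k g rs \<alpha> 2 (\<theta> (m + p)) = twisted_alexander G k g rs \<alpha> 2 (\<theta> m)"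
    "\<And>N. twisted_alexander G k g rs \<alpha> (2 * N) (\<lambda>\<gamma>. sym_power (2 * N) (\<rho> \<gamma>)) =
      (\<Prod>m<N. twisted_alexander G k g rs \<alpha> 2 (\<theta> m))"
    by (rule twisted_alexander_sym_powers) blast
  \<comment> \<open>The first representation has to be \<open>\<rho>\<close> itself, while
    \<open>\<theta> 0\<close> is only a conjugate of it; their twisted Alexander polynomials
    coincide. The shift passes from numbering by 0, ..., p - 1 to 1, ..., p.\<close>
  define \<psi> where "\<psi> j = (if j = 1 then \<rho> else \<theta> (j - 1))" for j
  have "log_limit_eq (\<lambda>N. twisted_alexander G k g rs \<alpha> (2 * N) (\<lambda>\<gamma>. sym_power (2 * N) (\<rho> \<gamma>)))
      (1 / (2 * real p)) p (\<lambda>j. twisted_alexander G k g rs \<alpha> 2 (\<psi> j))"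
    using p \<theta> by (intro log_limit_eq_periodic_product [where f = "\<lambda>m. twisted_alexander G k g rs \<alpha> 2 (\<theta> m)"])
      (auto simp: \<psi>_def)
  then show ?thesis
    using p \<theta>(1) \<open>metabelian_rep G \<rho>\<close> by (intro exI [of _ p] exI [of _ \<psi>]) (auto simp: \<psi>_def)
qed

end
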